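(* Let $n\ge2$ and $x\in\mathbb{N}^n$, and let $X^n$ be the crystal process started at $x$. Let $v^2=\frac{2\beta_0\beta_1}{\beta_0+\beta_1}$ and $v^{2,\infty}=\frac{2\beta_1\beta_2}{\beta_1+\beta_2}$. (i) If $\beta_2<\beta_0\le\beta_1$, then $t^{-1}X^n_t$ converges $\mathbb{P}_x$-a.s. as $t\to\infty$ and its limit belongs a.s. to $\mathcal E_1$, the set of $n$-tuples of the form $(a_1,\beta_2,a_2,\beta_2,\dots,a_{k-1},\beta_2,a_k)$ with $k\ge1$ and each block $a_i$ equal to $(\beta_0)$ or $(v^2,v^2)$. (ii) If $\beta_2<\beta_1<\beta_0$, then $t^{-1}X^n_t$ converges $\mathbb{P}_x$-a.s. and its limit belongs a.s. to $\mathcal E_2$, the set of $n$-tuples $(\beta_{i_1},\dots,\beta_{i_n})$ with $i_j\in\{0,1,2\}$, $i_j\ne i_{j+1}$ for $1\le j\le n-1$, and $i_1\ne2$, $i_n\ne2$. (iii) If $\beta_1\le\beta_2<\beta_0$, then $t^{-1}X^n_t$ converges $\mathbb{P}_x$-a.s. and its limit belongs a.s. to $\mathcal E_3$, the set of $n$-tuples of the form $(e_L,\beta_0,a_1,\beta_0,a_2,\dots,a_{k-1},\beta_0,a_k,\beta_0,e_R)$ with $k\ge0$ (for $k=0$ the tuple is $(e_L,\beta_0,e_R)$), each block $a_i$ equal to $(\beta_2)$ or $(v^{2,\infty},v^{2,\infty})$, and each of $e_L,e_R$ equal to $(\beta_1)$ or the empty tuple.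
   Context: Fix $n\ge2$ and $\beta=(\beta_0,\beta_1,\beta_2)\in(0,\infty)^3$. For $x\in\mathbb{N}^n$, with the zero boundary convention $x(0)=x(n+1)=0$, let $V_j(x)=\mathbf 1_{\{x(j-1)>x(j)\}}+\mathbf 1_{\{x(j+1)>x(j)\}}\in\{0,1,2\}$. The crystal process $X^n$ is the continuous-time Markov chain on $\mathbb{N}^n$ jumping from $x$ to $x+e_j$ at rate $\beta_{V_j(x)}$ ($j=1,\dots,n$) with no other transitions; $\mathbb{P}_x$ is its law from $x$. $t^{-1}X^n_t$ denotes the vector $(t^{-1}X^n_t(1),\dots,t^{-1}X^n_t(n))$, and tuples are concatenated blockwise. *)

theory Defs
  imports "HOL-Probability.Probability"
begin

definition beta :: "real \<Rightarrow> real \<Rightarrow> real \<Rightarrow> nat \<Rightarrow> real" where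
  "beta b0 b1 b2 i = (if i = 0 then b0 else if i = 1 then b1 else b2)"

text \<open>A configuration of N^n is a function on sites 1..n; extension by zero boundary.\<close>
definition ext :: "nat \<Rightarrow> (nat \<Rightarrow> nat) \<Rightarrow> nat \<Rightarrow> nat" where
  "ext n x j = (if 1 \<le> j \<and> j \<le> n then x j else 0)"

definition Vn :: "nat \<Rightarrow> (nat \<Rightarrow> nat) \<Rightarrow> nat \<Rightarrow> nat" where
  "Vn n x j = (if ext n x (j - 1) > ext n x j then 1 else 0)
            + (if ext n x (j + 1) > ext n x j then 1 else 0)"

definition rate :: "real \<Rightarrow> real \<Rightarrow> real \<Rightarrow> nat \<Rightarrow> (nat \<Rightarrow> nat) \<Rightarrow> nat \<Rightarrow> real" where
  "rate b0 b1 b2 n x j = beta b0 b1 b2 (Vn n x j)"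

definition total_rate :: "real \<Rightarrow> real \<Rightarrow> real \<Rightarrow> nat \<Rightarrow> (nat \<Rightarrow> nat) \<Rightarrow> real" where
  "total_rate b0 b1 b2 n x = (\<Sum>j=1..n. rate b0 b1 b2 n x j)"

text \<open>Choice of the jumping site from a uniform variable u in [0,1]: site j is chosen
  with probability rate j / total rate.\<close>
definition choose_site :: "real \<Rightarrow> real \<Rightarrow> real \<Rightarrow> nat \<Rightarrow> (nat \<Rightarrow> nat) \<Rightarrow> real \<Rightarrow> nat" where
  "choose_site b0 b1 b2 n x u =
     (if \<exists>j. 1 \<le> j \<and> j \<le> n \<and> u * total_rate b0 b1 b2 n x \<le> (\<Sum>i=1..j. rate b0 b1 b2 n x i)
      then (LEAST j. 1 \<le> j \<and> j \<le> n \<and> u * total_rate b0 b1 b2 n x \<le> (\<Sum>i=1..j. rate b0 b1 b2 n x i))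
      else n)"

primrec jump_chain :: "real \<Rightarrow> real \<Rightarrow> real \<Rightarrow> nat \<Rightarrow> (nat \<Rightarrow> nat) \<Rightarrow> (nat \<Rightarrow> real)
    \<Rightarrow> nat \<Rightarrow> (nat \<Rightarrow> nat)" where
  "jump_chain b0 b1 b2 n x u 0 = x"
| "jump_chain b0 b1 b2 n x u (Suc k) =
     (let y = jump_chain b0 b1 b2 n x u k; j = choose_site b0 b1 b2 n y (u k) in y(j := y j + 1))"

text \<open>Jump times: holding time in state y is e_k / q(y) with e_k ~ Exp(1).\<close>
primrec jump_time :: "real \<Rightarrow> real \<Rightarrow> real \<Rightarrow> nat \<Rightarrow> (nat \<Rightarrow> nat) \<Rightarrow> (nat \<Rightarrow> real)
    \<Rightarrow> (nat \<Rightarrow> real) \<Rightarrow> nat \<Rightarrow> real" where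
  "jump_time b0 b1 b2 n x e u 0 = 0"
| "jump_time b0 b1 b2 n x e u (Suc k) = jump_time b0 b1 b2 n x e u k
     + e k / total_rate b0 b1 b2 n (jump_chain b0 b1 b2 n x u k)"

definition crystal :: "real \<Rightarrow> real \<Rightarrow> real \<Rightarrow> nat \<Rightarrow> (nat \<Rightarrow> nat) \<Rightarrow> (nat \<Rightarrow> real)
    \<Rightarrow> (nat \<Rightarrow> real) \<Rightarrow> real \<Rightarrow> (nat \<Rightarrow> nat)" where
  "crystal b0 b1 b2 n x e u t =
     jump_chain b0 b1 b2 n x u (card {k. 0 < k \<and> jump_time b0 b1 b2 n x e u k \<le> t})"

definition vel :: "real \<Rightarrow> real \<Rightarrow> real" where
  "vel a b = 2 * a * b / (a + b)"

definition E1 :: "real \<Rightarrow> real \<Rightarrow> real \<Rightarrow> nat \<Rightarrow> real list set" where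
  "E1 b0 b1 b2 n = {l. length l = n \<and> (\<exists>a as.
      (let B = {[b0], [vel b0 b1, vel b0 b1]} in a \<in> B \<and> (\<forall>c\<in>set as. c \<in> B)) \<and>
      l = a @ concat (map (\<lambda>c. b2 # c) as))}"

definition E2 :: "real \<Rightarrow> real \<Rightarrow> real \<Rightarrow> nat \<Rightarrow> real list set" where
  "E2 b0 b1 b2 n = {map (beta b0 b1 b2) is | is. length is = n \<and> set is \<subseteq> {0,1,2}
      \<and> (\<forall>j. j + 1 < n \<longrightarrow> is ! j \<noteq> is ! (j + 1)) \<and> hd is \<noteq> 2 \<and> last is \<noteq> 2}"

definition E3 :: "real \<Rightarrow> real \<Rightarrow> real \<Rightarrow> nat \<Rightarrow> real list set" where
  "E3 b0 b1 b2 n = {l. length l = n \<and> (\<exists>eL eR as.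
      eL \<in> {[], [b1]} \<and> eR \<in> {[], [b1]} \<and>
      (\<forall>c\<in>set as. c \<in> {[b2], [vel b1 b2, vel b1 b2]}) \<and>
      l = eL @ [b0] @ concat (map (\<lambda>c. c @ [b0]) as) @ eR)}"

definition converges_into :: "real \<Rightarrow> real \<Rightarrow> real \<Rightarrow> nat \<Rightarrow> (nat \<Rightarrow> nat) \<Rightarrow> (nat \<Rightarrow> real)
    \<Rightarrow> (nat \<Rightarrow> real) \<Rightarrow> real list set \<Rightarrow> bool" where
  "converges_into b0 b1 b2 n x e u E \<longleftrightarrow> (\<exists>l. length l = n \<and> l \<in> E \<and>
     (\<forall>j<n. ((\<lambda>t. real (crystal b0 b1 b2 n x e u t (j + 1)) / t) \<longlongrightarrow> l ! j) at_top))"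

end

theory Submission
  imports Defs "HOL-Library.Discrete_Functions"
begin

text \<open>
  Consider the embedded jump chain. If \<open>b2\<close> is the smallest rate, a strict local minimum loses ground to
  its neighbours at a linear rate and hence stays a strict local minimum forever with probability
  bounded below; if \<open>b0\<close> is the largest rate, the same holds for strict local maxima. Therefore the set of
  strict valleys (in case (i)), of strict peaks (in case (iii)), or both (in case (ii)) is almost surely
  eventually constant. A run of too many consecutive unlabelled sites cannot persist: either their rates
  are equal and a recurrent walk of dimension one or two forces a new peak or valley with positive
  probability, or the rates contract the run and Foster's criterion brings it back to a bounded region,
  from which a new peak or valley appears with probability bounded below. In the remaining
  configurations every site has an eventually constant rate or belongs to an isolated pair, and a law of
  large numbers for the compensated jump counts determines the speeds.
\<close>

subsection \<open>Finite-range Markov chains\<close>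

text \<open>Which site jumps is decided by the \<open>U\<close> variables alone, so the eventual set
  of peaks or valleys is a question about the jump chain; the exponential clocks matter only once
  speeds are measured. Every site is chosen with probability at least a fixed \<open>c\<close>, so a
  word of bounded length leading out of a set bounds \<open>stay\<close> away from 1, and staying
  forever can be studied by finite recursions over words (\<open>surv\<close>, \<open>EW\<close>)
  without a path measure. Two obstacles shape the rest. When two rates coincide, a block of three
  sites has no drift and no Lyapunov function with a strict decrease is used; a martingale bound for
  two heights and exchangeability of three heights take its place, although other sites jump in
  between with state-dependent probabilities. And the speed of a pair is found without a stationary
  law for its gap: it suffices that the gap grows sublinearly, which also covers equal
  rates.\<close>

locale finite_range_chain =
  fixes p :: "'s \<Rightarrow> 'i \<Rightarrow> real" and act :: "'s \<Rightarrow> 'i \<Rightarrow> 's" and I :: "'i set" and c :: real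
  assumes finite_I: "finite I" and c_pos: "0 < c"
    and p_ge: "\<And>y i. i \<in> I \<Longrightarrow> c \<le> p y i" and p_sum: "\<And>y. (\<Sum>i\<in>I. p y i) = 1"
begin

lemma p_pos: "i \<in> I \<Longrightarrow> 0 < p y i"
  using p_ge[of i y] c_pos by linarith

lemma p_nonneg: "i \<in> I \<Longrightarrow> 0 \<le> p y i"
  using p_pos[of i y] by linarith

lemma c_le_1: "c \<le> 1"
proof -
  have "I \<noteq> {}" using p_sum[of undefined] by auto
  then obtain i where i: "i \<in> I" by auto
  have "p undefined i \<le> (\<Sum>i\<in>I. p undefined i)"
    by (rule member_le_sum) (use i p_nonneg finite_I in auto)
  then show ?thesis using p_ge[OF i, of undefined] p_sum[of undefined] by simp
qed

text \<open>The one-step transition operator acting on functions of the state.\<close>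

definition K :: "('s \<Rightarrow> real) \<Rightarrow> 's \<Rightarrow> real" where
  "K f y = (\<Sum>i\<in>I. p y i * f (act y i))"

lemma K_mono: "(\<And>i. i \<in> I \<Longrightarrow> f (act y i) \<le> g (act y i)) \<Longrightarrow> K f y \<le> K g y"
  unfolding K_def by (intro sum_mono mult_left_mono p_nonneg) auto

lemma K_const [simp]: "K (\<lambda>_. a) y = a"
  unfolding K_def using p_sum by (simp flip: sum_distrib_right)

lemma K_add: "K (\<lambda>z. f z + g z) y = K f y + K g y"
  unfolding K_def by (simp add: algebra_simps sum.distrib)

lemma K_diff: "K (\<lambda>z. f z - g z) y = K f y - K g y"
  unfolding K_def by (simp add: algebra_simps sum_subtractf)

lemma K_cmult: "K (\<lambda>z. a * f z) y = a * K f y"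
  unfolding K_def by (simp add: sum_distrib_left mult_ac)

lemma K_le: "(\<And>i. i \<in> I \<Longrightarrow> f (act y i) \<le> a) \<Longrightarrow> K f y \<le> a"
  using K_mono[of f y "\<lambda>_. a"] by simp

lemma K_ge: "(\<And>i. i \<in> I \<Longrightarrow> a \<le> f (act y i)) \<Longrightarrow> a \<le> K f y"
  using K_mono[of "\<lambda>_. a" y f] by simp

lemma K_drift: "K f y - f y = (\<Sum>i\<in>I. p y i * (f (act y i) - f y))"
  using K_diff[of f "\<lambda>_. f y" y] unfolding K_const by (simp add: K_def)

text \<open>Probability that the states at times 0 to \<open>k\<close> all lie in \<open>A\<close>:
  \<open>k\<close> jumps but \<open>k + 1\<close> membership tests, so \<open>surv A 0\<close> is
  the indicator of \<open>A\<close>.\<close>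

primrec surv :: "'s set \<Rightarrow> nat \<Rightarrow> 's \<Rightarrow> real" where
  "surv A 0 y = (if y \<in> A then 1 else 0)"
| "surv A (Suc k) y = (if y \<in> A then K (surv A k) y else 0)"

lemma surv_outside [simp]: "y \<notin> A \<Longrightarrow> surv A k y = 0"
  by (cases k) auto

lemma surv_nonneg: "0 \<le> surv A k y"
proof (induction k arbitrary: y)
  case (Suc k)
  then show ?case by (auto intro: K_ge)
qed auto

lemma surv_le_1: "surv A k y \<le> 1"
proof (induction k arbitrary: y)
  case (Suc k)
  then show ?case by (auto intro: K_le)
qed auto

lemma surv_Suc_le: "surv A (Suc k) y \<le> surv A k y"
proof (induction k arbitrary: y)
  case 0
  then show ?case using surv_le_1[of A "Suc 0" y] by auto
next
  case (Suc k)
  show ?case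
  proof (cases "y \<in> A")
    case True
    have "K (surv A (Suc k)) y \<le> K (surv A k) y" using Suc by (intro K_mono)
    then show ?thesis using True by (metis surv.simps(2))
  qed auto
qed

lemma surv_antimono: "k \<le> l \<Longrightarrow> surv A l y \<le> surv A k y"
  by (rule lift_Suc_antimono_le[of "\<lambda>k. surv A k y"]) (use surv_Suc_le in auto)

definition stay :: "'s set \<Rightarrow> 's \<Rightarrow> real" where
  "stay A y = lim (\<lambda>k. surv A k y)"

lemma stay_LIMSEQ: "(\<lambda>k. surv A k y) \<longlonglongrightarrow> stay A y"
proof -
  have "convergent (\<lambda>k. surv A k y)"
    by (rule Bseq_monoseq_convergent)
      (use surv_nonneg surv_le_1 surv_antimono in
        \<open>auto intro!: BseqI'[of _ 1] simp: monoseq_def\<close>)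
  then show ?thesis by (simp add: stay_def convergent_LIMSEQ_iff)
qed

lemma stay_le_surv: "stay A y \<le> surv A k y"
  by (rule LIMSEQ_le_const2[OF stay_LIMSEQ]) (use surv_antimono in blast)

lemma stay_ge: "(\<And>k. a \<le> surv A k y) \<Longrightarrow> a \<le> stay A y"
  by (rule LIMSEQ_le_const[OF stay_LIMSEQ]) auto

lemma stay_nonneg: "0 \<le> stay A y"
  by (rule stay_ge) (rule surv_nonneg)

lemma stay_le_1: "stay A y \<le> 1"
  using stay_le_surv[of A y 0] surv_le_1[of A 0 y] by linarith

lemma stay_outside [simp]: "y \<notin> A \<Longrightarrow> stay A y = 0"
  using stay_le_surv[of A y 0] stay_nonneg[of A y] by auto

lemma stay_harmonic: "y \<in> A \<Longrightarrow> stay A y = K (stay A) y"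
proof -
  assume y: "y \<in> A"
  have "(\<lambda>k. K (surv A k) y) \<longlonglongrightarrow> K (stay A) y"
    unfolding K_def by (intro tendsto_sum tendsto_mult tendsto_const stay_LIMSEQ)
  moreover have "(\<lambda>k. surv A (Suc k) y) \<longlonglongrightarrow> stay A y"
    using stay_LIMSEQ by (rule LIMSEQ_Suc)
  ultimately show ?thesis using y LIMSEQ_unique by auto
qed

text \<open>By the Markov property at time \<open>k\<close>, staying forever requires surviving
  until \<open>k\<close> and then staying forever once more, which has probability at most
  \<open>s\<close>. Letting \<open>k\<close> grow makes \<open>stay\<close> at most \<open>s\<close>
  times itself.\<close>

lemma stay_zero_if_bounded:
  assumes "s < 1" and "\<And>z. stay A z \<le> s"
  shows "stay A y = 0"
proof -
  have s0: "0 \<le> s" using assms(2)[of y] stay_nonneg[of A y] by linarith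
  have *: "stay A z \<le> s * surv A k z" for k z
  proof (induction k arbitrary: z)
    case 0
    then show ?case using assms(2) by auto
  next
    case (Suc k)
    show ?case
    proof (cases "z \<in> A")
      case True
      have "stay A z \<le> K (\<lambda>z. s * surv A k z) z"
        unfolding stay_harmonic[OF True] by (rule K_mono) (rule Suc)
      then show ?thesis using True by (simp add: K_cmult)
    qed auto
  qed
  have "stay A y \<le> s * stay A y"
    by (rule LIMSEQ_le_const[OF tendsto_mult[OF tendsto_const stay_LIMSEQ]]) (use * in auto)
  then have "(1 - s) * stay A y \<le> 0" by (simp add: algebra_simps)
  then show ?thesis using assms(1) stay_nonneg[of A y]
    by (metis diff_gt_0_iff_gt antisym mult_le_0_iff not_le)
qed

text \<open>The jumps of \<open>w\<close> occur in this order with probability at least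
  \<open>c ^ length w\<close>, and then the state at time \<open>length w\<close> is outside
  \<open>A\<close>.\<close>

lemma surv_le_reach:
  "set w \<subseteq> I \<Longrightarrow> foldl act y w \<notin> A \<Longrightarrow> surv A (length w) y \<le> 1 - c ^ length w"
proof (induction w arbitrary: y)
  case (Cons j w)
  have j: "j \<in> I" using Cons by auto
  have IH: "surv A (length w) (act y j) \<le> 1 - c ^ length w" using Cons by auto
  have "K (surv A (length w)) y \<le> K (\<lambda>_. 1) y - p y j * c ^ length w"
  proof -
    have "K (surv A (length w)) y = p y j * surv A (length w) (act y j)
        + (\<Sum>i\<in>I-{j}. p y i * surv A (length w) (act y i))"
      unfolding K_def using finite_I j by (simp add: sum.remove)
    also have "\<dots> \<le> p y j * (1 - c ^ length w) + (\<Sum>i\<in>I-{j}. p y i * 1)"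
      by (intro add_mono sum_mono mult_left_mono IH surv_le_1 p_nonneg j) auto
    also have "\<dots> = (\<Sum>i\<in>I. p y i) - p y j * c ^ length w"
      using finite_I j by (simp add: sum.remove algebra_simps)
    finally show ?thesis by (simp add: p_sum)
  qed
  also have "\<dots> \<le> 1 - c * c ^ length w"
    using mult_right_mono[OF p_ge[OF j, of y], of "c ^ length w"] c_pos by simp
  finally show ?case using c_pos c_le_1 power_le_one[of c "Suc (length w)"] by auto
qed auto

lemma stay_le_reach:
  assumes "set w \<subseteq> I" "foldl act y w \<notin> A" "length w \<le> L"
  shows "stay A y \<le> 1 - c ^ L"
proof -
  have "c ^ L \<le> c ^ length w" using assms(3) c_pos c_le_1 by (intro power_decreasing) auto
  then show ?thesis using surv_le_reach[OF assms(1,2)] stay_le_surv[of A y "length w"] by linarith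
qed

text \<open>Each step inside \<open>A\<close> consumes at least \<open>\<epsilon>\<close> of the
  nonnegative \<open>f\<close> on average, so the expected time in \<open>A\<close> is finite. The
  induction proves a tail form directly: \<open>k + 1\<close> times the survival probability is at
  most \<open>f y / \<epsilon>\<close>.\<close>

lemma stay_zero_Foster:
  assumes "\<And>y. 0 \<le> f y" "0 < \<epsilon>" "\<And>y. y \<in> A \<Longrightarrow> K f y \<le> f y - \<epsilon>"
  shows "stay A y = 0"
proof -
  have *: "real (k + 1) * surv A k y \<le> f y / \<epsilon>" if "y \<in> A" for k y using that
  proof (induction k arbitrary: y)
    case 0
    have "\<epsilon> \<le> f y" using assms(3)[OF 0] K_ge[of 0 f y] assms(1) by (auto intro: order_trans)
    then show ?case using 0 assms(2) by (auto simp: field_simps)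
  next
    case (Suc k)
    have IH: "real (k + 1) * surv A k z \<le> f z / \<epsilon>" for z
      using Suc.IH[of z] assms(1)[of z] assms(2) by (cases "z \<in> A") auto
    have "real (k + 1) * K (surv A k) y = K (\<lambda>z. real (k + 1) * surv A k z) y" by (simp add: K_cmult)
    also have "\<dots> \<le> K (\<lambda>z. (1 / \<epsilon>) * f z) y" by (rule K_mono) (use IH in auto)
    also have "\<dots> = (1 / \<epsilon>) * K f y" by (rule K_cmult)
    also have "\<dots> \<le> (1 / \<epsilon>) * (f y - \<epsilon>)"
      using assms(2,3) Suc.prems by (intro mult_left_mono) auto
    also have "\<dots> = f y / \<epsilon> - 1" using assms(2) by (simp add: field_simps)
    finally have "real (k + 1) * K (surv A k) y + surv A (Suc k) y \<le> f y / \<epsilon>"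
      using surv_le_1[of A "Suc k" y] by linarith
    then show ?case using Suc.prems by (simp add: algebra_simps)
  qed
  have **: "surv A k y \<le> (f y / \<epsilon>) / real (k + 1)" for k
    using *[of y k] assms(1)[of y] assms(2)
    by (cases "y \<in> A") (auto simp: pos_le_divide_eq mult.commute add.commute)
  have "(\<lambda>k. (f y / \<epsilon>) / real (k + 1)) \<longlonglongrightarrow> 0"
    using LIMSEQ_ignore_initial_segment[OF lim_const_over_n[of "f y / \<epsilon>"], of 1] by simp
  then have "stay A y \<le> 0"
    by (rule LIMSEQ_le[OF stay_LIMSEQ]) (use ** in auto)
  then show ?thesis using stay_nonneg[of A y] by linarith
qed

text \<open>The chain cannot remain in \<open>A - G\<close>, so it leaves \<open>A\<close> or meets
  \<open>G\<close>, from where a short word leaves \<open>A\<close>. The bound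
  \<open>1 - c ^ L\<close> is uniform in the starting state even if the time to meet
  \<open>G\<close> is not.\<close>

lemma stay_zero_two_stage:
  assumes "\<And>y. stay (A - G) y = 0"
    and "\<And>y. y \<in> A \<Longrightarrow> y \<in> G \<Longrightarrow> \<exists>w. set w \<subseteq> I \<and> length w \<le> L \<and> foldl act y w \<notin> A"
  shows "stay A y = 0"
proof (rule stay_zero_if_bounded)
  show "1 - c ^ L < 1" using c_pos by simp
  fix z
  have c1: "c ^ L \<le> 1" using c_pos c_le_1 by (simp add: power_le_one)
  \<comment> \<open>The last term is the chance that neither \<open>G\<close> nor the complement of
    \<open>A\<close> has been met up to time \<open>k\<close>.\<close>
  have *: "stay A z \<le> 1 - c ^ L + surv (A - G) k z" for k z
  proof (induction k arbitrary: z)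
    case 0
    show ?case using stay_le_1[of A z] stay_le_reach[of _ z A L] assms(2)[of z] c1
      by (cases "z \<in> A"; cases "z \<in> G") (fastforce simp: c_pos less_imp_le)+
  next
    case (Suc k)
    consider "z \<notin> A" | "z \<in> A" "z \<in> G" | "z \<in> A - G" by auto
    then show ?case
    proof cases
      case 3
      then have "stay A z \<le> K (\<lambda>z. 1 - c ^ L + surv (A - G) k z) z"
        using Suc by (auto simp: stay_harmonic intro!: K_mono)
      also have "\<dots> = 1 - c ^ L + K (surv (A - G) k) z" by (simp add: K_add)
      finally show ?thesis using 3 by simp
    next
      case 2
      then show ?thesis using assms(2)[of z] stay_le_reach[of _ z A L] by auto
    qed (use c1 in auto)
  qed
  have "(\<lambda>k. 1 - c ^ L + surv (A - G) k z) \<longlonglongrightarrow> 1 - c ^ L + stay (A - G) z"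
    by (intro tendsto_intros stay_LIMSEQ)
  then have "stay A z \<le> 1 - c ^ L + stay (A - G) z"
    by (rule LIMSEQ_le_const) (use * in auto)
  then show "stay A z \<le> 1 - c ^ L" using assms(1) by simp
qed

text \<open>Optional stopping at the exit from \<open>B\<close>: \<open>f\<close> is at least 1
  there, while its mean does not exceed \<open>f y\<close>.\<close>

lemma surv_ge_supermartingale:
  assumes "\<And>y. 0 \<le> f y" "\<And>y. y \<notin> B \<Longrightarrow> 1 \<le> f y" "\<And>y. y \<in> B \<Longrightarrow> K f y \<le> f y"
  shows "1 - f y \<le> surv B k y"
proof (induction k arbitrary: y)
  case 0
  then show ?case using assms(1,2)[of y] by auto
next
  case (Suc k)
  show ?case
  proof (cases "y \<in> B")
    case True
    have "1 - f y \<le> 1 - K f y" using assms(3) True by auto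
    also have "\<dots> = K (\<lambda>z. 1 - f z) y" by (simp add: K_diff)
    also have "\<dots> \<le> K (surv B k) y" by (rule K_mono) (rule Suc)
    finally show ?thesis using True by simp
  qed (use assms(2)[of y] in auto)
qed

lemma surv_ge_path:
  "set w \<subseteq> I \<Longrightarrow> (\<And>i. i < length w \<Longrightarrow> foldl act y (take i w) \<in> B)
    \<Longrightarrow> c ^ length w * surv B k (foldl act y w) \<le> surv B (length w + k) y"
proof (induction w arbitrary: y)
  case (Cons j w)
  have j: "j \<in> I" using Cons by auto
  have y: "y \<in> B" using Cons.prems(2)[of 0] by auto
  have IH: "c ^ length w * surv B k (foldl act (act y j) w) \<le> surv B (length w + k) (act y j)"
    using Cons.prems Cons.prems(2)[of "Suc _"] by (intro Cons.IH) auto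
  have "c * (c ^ length w * surv B k (foldl act (act y j) w))
      \<le> p y j * surv B (length w + k) (act y j)"
    by (intro mult_mono p_ge j IH p_nonneg) (use c_pos surv_nonneg in auto)
  also have "\<dots> \<le> K (surv B (length w + k)) y"
    unfolding K_def by (rule member_le_sum) (use j p_nonneg surv_nonneg finite_I in auto)
  finally show ?case using y by simp
qed auto

section \<open>Counting exits, and expectations over words of jumps\<close>

primrec exits :: "'s set \<Rightarrow> 's \<Rightarrow> 'i list \<Rightarrow> nat" where
  "exits B y [] = 0"
| "exits B y (j # w) = (if y \<in> B \<and> act y j \<notin> B then 1 else 0) + exits B (act y j) w"

lemma exits_snoc: "exits B y (w @ [j]) =
    exits B y w + (if foldl act y w \<in> B \<and> act (foldl act y w) j \<notin> B then 1 else 0)"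
  by (induction w arbitrary: y) auto

text \<open>Expectation of \<open>F\<close> over the word of the first \<open>k\<close> jumps from
  \<open>y\<close>. Functions of words rather than of states are required for exit counts and
  martingales.\<close>

primrec EW :: "nat \<Rightarrow> 's \<Rightarrow> ('i list \<Rightarrow> real) \<Rightarrow> real" where
  "EW 0 y F = F []"
| "EW (Suc k) y F = (\<Sum>i\<in>I. p y i * EW k (act y i) (\<lambda>w. F (i # w)))"

lemma EW_mono:
  "(\<And>w. length w = k \<Longrightarrow> set w \<subseteq> I \<Longrightarrow> F w \<le> G w) \<Longrightarrow> EW k y F \<le> EW k y G"
proof (induction k arbitrary: y F G)
  case (Suc k)
  show ?case unfolding EW.simps
    by (intro sum_mono mult_left_mono Suc.IH p_nonneg) (use Suc.prems in auto)
qed auto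

lemma EW_cong:
  "(\<And>w. length w = k \<Longrightarrow> set w \<subseteq> I \<Longrightarrow> F w = G w) \<Longrightarrow> EW k y F = EW k y G"
  by (intro antisym EW_mono) auto

lemma EW_const [simp]: "EW k y (\<lambda>_. a) = a"
  by (induction k arbitrary: y) (auto simp: p_sum simp flip: sum_distrib_right)

lemma EW_add: "EW k y (\<lambda>w. F w + G w) = EW k y F + EW k y G"
  by (induction k arbitrary: y F G) (auto simp: sum.distrib algebra_simps)

lemma EW_cmult: "EW k y (\<lambda>w. a * F w) = a * EW k y F"
  by (induction k arbitrary: y F) (auto simp: sum_distrib_left algebra_simps)

lemma EW_append: "EW (k + l) y F = EW k y (\<lambda>w. EW l (foldl act y w) (\<lambda>w'. F (w @ w')))"
  by (induction k arbitrary: y F) auto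

lemma EW_tendsto:
  "(\<And>w. (\<lambda>m. F m w) \<longlonglongrightarrow> G w) \<Longrightarrow> (\<lambda>m. EW k y (F m)) \<longlonglongrightarrow> EW k y G"
proof (induction k arbitrary: y F G)
  case (Suc k)
  show ?case unfolding EW.simps
    by (intro tendsto_sum tendsto_mult tendsto_const Suc.IH Suc.prems)
qed auto

lemma EW_surv:
  "EW k y (\<lambda>w. of_bool (\<forall>i\<le>k. foldl act y (take i w) \<in> A)) = surv A k y"
proof (induction k arbitrary: y)
  case (Suc k)
  have *: "(\<forall>i\<le>Suc k. foldl act y (take i (j # w)) \<in> A)
     \<longleftrightarrow> y \<in> A \<and> (\<forall>i\<le>k. foldl act (act y j) (take i w) \<in> A)" for j w
    using All_less_Suc2[of "Suc k" "\<lambda>i. foldl act y (take i (j # w)) \<in> A"]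
    by (auto simp: less_Suc_eq_le)
  show ?case
    by (cases "y \<in> A") (auto simp: * Suc K_def)
qed auto

text \<open>From a state of \<open>B\<close> no exit happens within the horizon with probability at
  least \<open>d\<close>, so each further exit costs a factor \<open>1 - d\<close>.\<close>

lemma EW_exits_le:
  assumes d: "0 \<le> d" "d \<le> 1" and B: "\<And>y k. y \<in> B \<Longrightarrow> d \<le> surv B k y"
  shows "EW k y (\<lambda>w. of_bool (m \<le> exits B y w)) \<le> (1 - d) ^ m"
proof (induction m arbitrary: k y)
  case (Suc m)
  \<comment> \<open>The factor \<open>1 - surv B k y\<close> evolves exactly by \<open>K\<close>
    inside \<open>B\<close>. The plain bound \<open>1 - d\<close> would not pass through an
    induction on the horizon, since a first exit is followed only by the larger bound
    \<open>(1 - d) ^ m\<close>.\<close>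
  have inB: "EW k y (\<lambda>w. of_bool (Suc m \<le> exits B y w)) \<le> (1 - d) ^ m * (1 - surv B k y)"
    if "y \<in> B" for k y using that
  proof (induction k arbitrary: y)
    case (Suc k)
    have "EW (Suc k) y (\<lambda>w. of_bool (Suc m \<le> exits B y w))
      = (\<Sum>i\<in>I. p y i * EW k (act y i) (\<lambda>w. of_bool (Suc m \<le> exits B y (i # w))))"
      by simp
    also have "\<dots> \<le> (\<Sum>i\<in>I. p y i * ((1 - d) ^ m * (1 - surv B k (act y i))))"
    proof (intro sum_mono mult_left_mono p_nonneg, goal_cases)
      case (1 i)
      show ?case
      proof (cases "act y i \<in> B")
        case True
        then show ?thesis using Suc.IH[OF True] by simp
      next
        case False
        then show ?thesis using \<open>\<And>k y. EW k y (\<lambda>w. of_bool (m \<le> exits B y w)) \<le> (1 - d) ^ m\<close> Suc.prems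
          by simp
      qed
    qed
    also have "\<dots> = K (\<lambda>z. (1 - d) ^ m * (1 - surv B k z)) y" by (simp add: K_def)
    also have "\<dots> = (1 - d) ^ m * (1 - K (surv B k) y)" by (simp add: K_cmult K_diff)
    finally show ?case using Suc.prems by simp
  qed auto
  show ?case
  proof (induction k arbitrary: y)
    case 0
    then show ?case using d by auto
  next
    case (Suc k)
    show ?case
    proof (cases "y \<in> B")
      case True
      have "(1 - d) ^ m * (1 - surv B (Suc k) y) \<le> (1 - d) ^ m * (1 - d)"
        using B[OF True, of "Suc k"] d by (intro mult_left_mono) auto
      then show ?thesis using inB[OF True, of "Suc k"] by (simp add: mult.commute)
    next
      case False
      have "EW (Suc k) y (\<lambda>w. of_bool (Suc m \<le> exits B y w))
        = K (\<lambda>z. EW k z (\<lambda>w. of_bool (Suc m \<le> exits B z w))) y"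
        using False by (simp add: K_def)
      also have "\<dots> \<le> (1 - d) ^ Suc m" by (rule K_le) (rule Suc)
      finally show ?thesis .
    qed
  qed
qed auto

end

subsection \<open>Neutral walks\<close>

text \<open>Law of the walk with steps -1, 0, 1 of probability one third each: the difference of two
  of three coordinates when a uniformly chosen one is raised.\<close>

primrec lazy_pmf :: "nat \<Rightarrow> int \<Rightarrow> real" where
  "lazy_pmf 0 e = of_bool (e = 0)"
| "lazy_pmf (Suc l) e = (lazy_pmf l (e - 1) + lazy_pmf l e + lazy_pmf l (e + 1)) / 3"

lemma lazy_pmf_nonneg: "0 \<le> lazy_pmf l e"
  by (induction l arbitrary: e) auto

lemma lazy_pmf_minus: "lazy_pmf l (- e) = lazy_pmf l e"
proof (induction l arbitrary: e)
  case (Suc l)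
  have "- e - 1 = - (e + 1)" "- e + 1 = - (e - 1)" by auto
  then show ?case using Suc[of "e - 1"] Suc[of "e + 1"] Suc[of e] by (simp only: lazy_pmf.simps add.commute add.left_commute add.assoc)
qed auto

text \<open>After cancelling common terms the step compares the values at \<open>e + 2\<close> and
  \<open>e - 1\<close>; for \<open>e = 0\<close> symmetry turns the latter into the value at
  1.\<close>

lemma lazy_pmf_unimodal: "0 \<le> e \<Longrightarrow> lazy_pmf l (e + 1) \<le> lazy_pmf l e"
proof (induction l arbitrary: e)
  case (Suc l)
  have "lazy_pmf l (e + 2) \<le> lazy_pmf l (e - 1)"
  proof (cases "e = 0")
    case True
    then show ?thesis using Suc.IH[of 1] lazy_pmf_minus[of l 1] by simp
  next
    case False
    then have "0 \<le> e - 1" using Suc.prems by simp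
    then have "lazy_pmf l (e - 1 + 1 + 1 + 1) \<le> lazy_pmf l (e - 1 + 1 + 1)"
      "lazy_pmf l (e - 1 + 1 + 1) \<le> lazy_pmf l (e - 1 + 1)"
      "lazy_pmf l (e - 1 + 1) \<le> lazy_pmf l (e - 1)"
      by (intro Suc.IH; simp)+
    then show ?thesis by (simp add: algebra_simps)
  qed
  then show ?case by (simp add: algebra_simps)
qed auto

lemma lazy_pmf_sum_le_1: "finite S \<Longrightarrow> (\<Sum>e\<in>S. lazy_pmf l e) \<le> 1"
proof (induction l arbitrary: S)
  case 0
  have "(\<Sum>e\<in>S. lazy_pmf 0 e) = of_bool (0 \<in> S)" using 0 by (simp add: of_bool_def sum.delta)
  then show ?case by auto
next
  case (Suc l)
  have shift: "(\<Sum>e\<in>S. lazy_pmf l (e + a)) \<le> 1" for a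
    using Suc.IH[of "(\<lambda>e. e + a) ` S"] Suc.prems
    by (simp add: sum.reindex o_def)
  show ?case using shift[of "-1"] shift[of 0] shift[of 1]
    by (simp add: sum.distrib flip: sum_divide_distrib)
qed

text \<open>The mass at 0 decreases to some \<open>a\<close>, the recursion passes the same limit on
  to every other point, and masses with sum at most 1 force \<open>a = 0\<close>.\<close>

lemma lazy_pmf_tendsto_0: "(\<lambda>l. lazy_pmf l e) \<longlonglongrightarrow> 0"
proof -
  have dec: "lazy_pmf (Suc l) 0 \<le> lazy_pmf l 0" for l
    using lazy_pmf_unimodal[of 0 l] lazy_pmf_minus[of l 1] by simp
  have "decseq (\<lambda>l. lazy_pmf l 0)" by (rule decseq_SucI) (rule dec)
  then obtain a where a: "(\<lambda>l. lazy_pmf l 0) \<longlonglongrightarrow> a" and "\<And>i. a \<le> lazy_pmf i 0"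
    using decseq_convergent[of "\<lambda>l. lazy_pmf l 0" 0] lazy_pmf_nonneg by blast
  have lim: "(\<lambda>l. lazy_pmf l (int d)) \<longlonglongrightarrow> a \<and> (\<lambda>l. lazy_pmf l (int (Suc d))) \<longlonglongrightarrow> a" for d
  proof (induction d)
    case 0
    have "(\<lambda>l. (3 * lazy_pmf (Suc l) 0 - lazy_pmf l 0) / 2) \<longlonglongrightarrow> (3 * a - a) / 2"
      by (intro tendsto_intros a LIMSEQ_Suc[OF a]) auto
    moreover have "(3 * lazy_pmf (Suc l) 0 - lazy_pmf l 0) / 2 = lazy_pmf l 1" for l
      using lazy_pmf_minus[of l 1] by (simp add: field_simps)
    ultimately show ?case using a by simp
  next
    case (Suc d)
    have "(\<lambda>l. 3 * lazy_pmf (Suc l) (int (Suc d)) - lazy_pmf l (int d) - lazy_pmf l (int (Suc d)))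
        \<longlonglongrightarrow> 3 * a - a - a"
      by (intro tendsto_intros LIMSEQ_Suc[of "\<lambda>l. lazy_pmf l (int (Suc d))"]) (use Suc in auto)
    moreover have "3 * lazy_pmf (Suc l) (int (Suc d)) - lazy_pmf l (int d) - lazy_pmf l (int (Suc d))
        = lazy_pmf l (int (Suc (Suc d)))" for l
      by (simp add: algebra_simps)
    ultimately show ?case using Suc by simp
  qed
  have "real N * a \<le> 1" for N
  proof -
    have "(\<lambda>l. \<Sum>d<N. lazy_pmf l (int d)) \<longlonglongrightarrow> (\<Sum>d<N. a)"
      by (intro tendsto_sum) (use lim in blast)
    moreover have "(\<Sum>d<N. lazy_pmf l (int d)) \<le> 1" for l
      using lazy_pmf_sum_le_1[of "int ` {..<N}" l] by (simp add: sum.reindex)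
    ultimately have "(\<Sum>d<N. a) \<le> 1" by (intro LIMSEQ_le_const2) auto
    then show ?thesis by simp
  qed
  moreover have "0 \<le> a" using a lazy_pmf_nonneg by (intro LIMSEQ_le_const) auto
  ultimately have "a = 0"
    using reals_Archimedean3[of a] by (metis less_eq_real_def not_le)
  then have "(\<lambda>l. lazy_pmf l (int d)) \<longlonglongrightarrow> 0" for d using lim by simp
  moreover have "lazy_pmf l e = lazy_pmf l (int (nat \<bar>e\<bar>))" for l
    using lazy_pmf_minus[of l e] by (cases "0 \<le> e") auto
  ultimately show ?thesis by presburger
qed

section \<open>Expectations for the walk raising one of three exchangeable coordinates\<close>

primrec walk3 :: "nat \<Rightarrow> (int \<Rightarrow> int \<Rightarrow> int \<Rightarrow> real) \<Rightarrow> int \<Rightarrow> int \<Rightarrow> int \<Rightarrow> real" where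
  "walk3 0 f a b d = f a b d"
| "walk3 (Suc l) f a b d =
     (walk3 l f (a + 1) b d + walk3 l f a (b + 1) d + walk3 l f a b (d + 1)) / 3"

lemma walk3_mono: "(\<And>a b d. f a b d \<le> g a b d) \<Longrightarrow> walk3 l f a b d \<le> walk3 l g a b d"
proof (induction l arbitrary: a b d)
  case (Suc l)
  show ?case using Suc.IH[OF Suc.prems, of "a+1" b d] Suc.IH[OF Suc.prems, of a "b+1" d]
      Suc.IH[OF Suc.prems, of a b "d+1"] by simp
qed auto

lemma walk3_const: "walk3 l (\<lambda>_ _ _. r) a b d = r"
  by (induction l arbitrary: a b d) auto

lemma walk3_add: "walk3 l (\<lambda>a b d. f a b d + g a b d) a b d = walk3 l f a b d + walk3 l g a b d"
  by (induction l arbitrary: a b d) (auto simp: field_simps)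

lemma walk3_diff: "walk3 l (\<lambda>a b d. f a b d - g a b d) a b d = walk3 l f a b d - walk3 l g a b d"
  by (induction l arbitrary: a b d) (auto simp flip: diff_divide_distrib)

lemma walk3_sum:
  "finite S \<Longrightarrow> walk3 l (\<lambda>a b d. \<Sum>e\<in>S. f e a b d) a b d = (\<Sum>e\<in>S. walk3 l (f e) a b d)"
  by (induction S rule: finite_induct) (auto simp: walk3_const walk3_add)

lemma walk3_swap12: "walk3 l (\<lambda>a b d. f b a d) a b d = walk3 l f b a d"
  by (induction l arbitrary: a b d) (auto simp: algebra_simps)

lemma walk3_swap23: "walk3 l (\<lambda>a b d. f a d b) a b d = walk3 l f a d b"
  by (induction l arbitrary: a b d) (auto simp: algebra_simps)

lemma walk3_shift:
  "walk3 l (\<lambda>x y z. f (a + x) (b + y) (d + z)) x y z = walk3 l f (a + x) (b + y) (d + z)"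
  by (induction l arbitrary: x y z) (auto simp: algebra_simps)

lemma walk3_diff12: "walk3 l (\<lambda>a b d. of_bool (a - b = e)) a b d = lazy_pmf l (e - (a - b))"
proof (induction l arbitrary: a b d)
  case (Suc l)
  have "e - (a + 1 - b) = e - (a - b) - 1" "e - (a - (b + 1)) = e - (a - b) + 1" by auto
  then show ?case by (simp only: walk3.simps lazy_pmf.simps Suc.IH) simp
qed auto

lemma walk3_tie_tendsto_0:
  "(\<lambda>l. walk3 l (\<lambda>a b d. of_bool (\<bar>a - b\<bar> \<le> h)) 0 0 0) \<longlonglongrightarrow> 0"
proof -
  have "(\<lambda>a b d::int. of_bool (\<bar>a - b\<bar> \<le> h) :: real)
      = (\<lambda>a b d. \<Sum>e\<in>{-h..h}. of_bool (a - b = e))"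
  proof (intro ext)
    fix a b :: int
    show "of_bool (\<bar>a - b\<bar> \<le> h) = (\<Sum>e\<in>{-h..h}. of_bool (a - b = e) :: real)"
      by (subst of_bool_def, subst sum.delta') auto
  qed
  then have "walk3 l (\<lambda>a b d. of_bool (\<bar>a - b\<bar> \<le> h)) 0 0 0 = (\<Sum>e\<in>{-h..h}. lazy_pmf l e)" for l
    by (simp only: walk3_sum[OF finite_atLeastAtMost_int] walk3_diff12) simp
  moreover have "(\<lambda>l. \<Sum>e\<in>{-h..h}. lazy_pmf l e) \<longlonglongrightarrow> (\<Sum>e\<in>{-h..h}. 0)"
    by (intro tendsto_sum lazy_pmf_tendsto_0)
  ultimately show ?thesis by simp
qed

text \<open>By exchangeability the middle coordinate is the extremal one with asymptotic probability
  at least one third, because ties up to a fixed distance become negligible.\<close>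

lemma walk3_extremal:
  fixes m :: "int \<Rightarrow> int \<Rightarrow> int \<Rightarrow> real"
  assumes "\<And>a b d. \<bar>a - b\<bar> > h \<Longrightarrow> \<bar>b - d\<bar> > h \<Longrightarrow> \<bar>a - d\<bar> > h \<Longrightarrow> 1 \<le> m a b d + m b a d + m a d b"
    and "\<And>a b d. 0 \<le> m a b d"
  shows "\<exists>l. walk3 l m 0 0 0 \<ge> 1 / 4"
proof -
  define t :: "int \<Rightarrow> int \<Rightarrow> int \<Rightarrow> real" where "t = (\<lambda>a b d. of_bool (\<bar>a - b\<bar> \<le> h))"
  \<comment> \<open>Ties within \<open>h\<close> of the three pairs of coordinates are charged to
    three copies of \<open>t\<close>. All terms are written as explicit abstractions so that the
    walk expectation splits and the permutations can be undone one by one.\<close>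
  have pw: "1 \<le> (((((\<lambda>a b d. m a b d) a b d + (\<lambda>a b d. m b a d) a b d) + (\<lambda>a b d. m a d b) a b d)
      + t a b d) + (\<lambda>a b d. t a d b) a b d) + (\<lambda>a b d. (\<lambda>a b d. t a d b) b a d) a b d" for a b d
  proof (cases "\<bar>a - b\<bar> > h \<and> \<bar>b - d\<bar> > h \<and> \<bar>a - d\<bar> > h")
    case True
    then show ?thesis using assms(1)[of a b d] by (simp add: t_def)
  next
    case False
    then show ?thesis using assms(2)[of a b d] assms(2)[of b a d] assms(2)[of a d b]
      by (auto simp: t_def not_less)
  qed
  have main: "1 \<le> 3 * walk3 l m 0 0 0 + 3 * walk3 l t 0 0 0" for l
  proof -
    have "walk3 l (\<lambda>_ _ _. 1) 0 0 0 \<le> walk3 l (\<lambda>a b d. (((((\<lambda>a b d. m a b d) a b d + (\<lambda>a b d. m b a d) a b d) + (\<lambda>a b d. m a d b) a b d)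
      + t a b d) + (\<lambda>a b d. t a d b) a b d) + (\<lambda>a b d. (\<lambda>a b d. t a d b) b a d) a b d) 0 0 0"
      by (rule walk3_mono) (rule pw)
    also have "\<dots> = 3 * walk3 l m 0 0 0 + 3 * walk3 l t 0 0 0"
      unfolding walk3_add walk3_swap12[of l "\<lambda>a b d. t a d b"] walk3_swap12[of l m]
        walk3_swap23[of l m] walk3_swap23[of l t] by simp
    finally show ?thesis by (simp add: walk3_const)
  qed
  \<comment> \<open>The value \<open>1 / 12\<close> is the difference between one third and the
    required \<open>1 / 4\<close>.\<close>
  have "\<forall>\<^sub>F l in sequentially. walk3 l t 0 0 0 < 1 / 12"
    using order_tendstoD(2)[OF walk3_tie_tendsto_0[of h], of "1 / 12"] by (simp add: t_def)
  then obtain l where "walk3 l t 0 0 0 < 1 / 12" by (auto simp: eventually_sequentially)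
  then show ?thesis using main[of l] by (intro exI[of _ l]) simp
qed

definition bump :: "(nat \<Rightarrow> nat) \<Rightarrow> nat \<Rightarrow> (nat \<Rightarrow> nat)" where
  "bump y j = y(j := y j + 1)"

lemma bump_same [simp]: "bump y j j = y j + 1"
  and bump_other [simp]: "i \<noteq> j \<Longrightarrow> bump y j i = y i"
  by (auto simp: bump_def)

lemma bump_apply: "bump y j i = y i + (if i = j then 1 else 0)"
  by (simp add: bump_def)

lemma count_list_replicate: "count_list (replicate k s) i = (if i = s then k else 0)"
  by (induction k) auto

lemma foldl_bump_apply: "foldl bump y w i = y i + count_list w i"
  by (induction w arbitrary: y) (auto simp: bump_apply)

locale growth_chain = finite_range_chain p bump I c
  for p :: "(nat \<Rightarrow> nat) \<Rightarrow> nat \<Rightarrow> real" and I c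
begin

text \<open>As the two heights never tie on \<open>A\<close>, their distance \<open>D\<close> is a
  martingale there. Staying in \<open>A\<close> forever means reaching distance \<open>R\<close>, of
  probability at most \<open>D y / R\<close>, or remaining at bounded distance, of probability 0;
  then \<open>R\<close> tends to infinity.\<close>

lemma stay_zero_neutral_pair:
  assumes ij: "i \<in> I" "j \<in> I" "i \<noteq> j"
    and eq: "\<And>y. y \<in> A \<Longrightarrow> p y i = p y j" and ne: "\<And>y. y \<in> A \<Longrightarrow> y i \<noteq> y j"
  shows "stay A y = 0"
proof -
  define D where "D y = \<bar>real (y i) - real (y j)\<bar>" for y :: "nat \<Rightarrow> nat"
  have KD: "K D y = D y" if "y \<in> A" for y
  proof -
    have "K D y - D y = (\<Sum>l\<in>{i,j}. p y l * (D (bump y l) - D y))"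
      unfolding K_drift by (rule sum.mono_neutral_right) (use ij finite_I in \<open>auto simp: D_def\<close>)
    also have "\<dots> = p y i * (D (bump y i) + D (bump y j) - 2 * D y)"
      using ij eq[OF that] by (simp add: algebra_simps)
    also have "D (bump y i) + D (bump y j) - 2 * D y = 0"
      using ne[OF that] ij unfolding D_def by (cases "y i < y j") (auto simp: bump_apply)
    finally show ?thesis by simp
  qed
  have le: "stay A y \<le> D y / real R" if "R > 0" for R y
  proof -
    define A' where "A' = A \<inter> {y. D y < real R}"
    have A'0: "stay A' y = 0" for y
    proof (rule stay_zero_two_stage[where G = UNIV and L = R])
      show "stay (A' - UNIV) y = 0" for y by simp
      fix y assume y: "y \<in> A'"
      \<comment> \<open>The higher of the two sites: \<open>R\<close> jumps of it push the distance
        to at least \<open>R\<close>.\<close>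
      define s where "s = (if y i < y j then j else i)"
      have "real R \<le> D (foldl bump y (replicate R s))"
        unfolding D_def foldl_bump_apply s_def using ij
        by (auto simp: count_list_replicate)
      then show "\<exists>w. set w \<subseteq> I \<and> length w \<le> R \<and> foldl bump y w \<notin> A'"
        using ij by (intro exI[of _ "replicate R s"]) (auto simp: A'_def s_def)
    qed
    have *: "stay A y \<le> D y / real R + surv A' k y" for k y
    proof (induction k arbitrary: y)
      case 0
      have "0 \<le> D y / real R" by (simp add: D_def)
      moreover have "1 \<le> D y / real R" if "real R \<le> D y"
        using that \<open>R > 0\<close> by (simp add: field_simps)
      ultimately show ?case using stay_le_1[of A y]
        by (cases "y \<in> A"; cases "D y < real R") (fastforce simp: A'_def not_less)+
    next
      case (Suc k)
      consider "y \<notin> A" | "y \<in> A" "real R \<le> D y" | "y \<in> A'" "y \<in> A" by (force simp: A'_def)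
      then show ?case
      proof cases
        case 1
        then show ?thesis using surv_nonneg[of A' "Suc k" y] by (auto simp: D_def)
      next
        case 2
        then have "1 \<le> D y / real R" using that by (simp add: field_simps)
        then show ?thesis using stay_le_1[of A y] surv_nonneg[of A' "Suc k" y] by linarith
      next
        case 3
        then have "stay A y \<le> K (\<lambda>z. (1 / real R) * D z + surv A' k z) y"
          using Suc by (simp add: stay_harmonic K_mono)
        also have "\<dots> = D y / real R + K (surv A' k) y"
          by (simp only: K_add K_cmult KD[OF 3(2)]) simp
        finally show ?thesis using 3 by simp
      qed
    qed
    have "stay A y \<le> D y / real R + stay A' y"
      by (rule LIMSEQ_le_const[OF tendsto_add[OF tendsto_const stay_LIMSEQ]]) (use * in auto)
    then show ?thesis using A'0 by simp
  qed
  have "(\<lambda>R. D y / real R) \<longlonglongrightarrow> 0" by (rule lim_const_over_n)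
  then have "stay A y \<le> 0" by (rule LIMSEQ_le_const) (use le in \<open>auto intro!: exI[of _ 1]\<close>)
  then show ?thesis using stay_nonneg[of A y] by simp
qed

text \<open>Observed only when \<open>i\<close>, \<open>j\<close> or \<open>k\<close> jumps, the
  three heights perform \<open>walk3\<close>, because on \<open>A\<close> these sites are equally
  likely. Staying forever implies being in \<open>A\<close> after \<open>l\<close> such jumps, and
  \<open>h\<close> dominates the indicator of \<open>A\<close>.\<close>

lemma stay_le_walk3:
  assumes I: "i \<in> I" "j \<in> I" "k \<in> I" and dist: "i \<noteq> j" "j \<noteq> k" "i \<noteq> k"
    and eq: "\<And>y. y \<in> A \<Longrightarrow> p y i = p y j \<and> p y j = p y k"
    and h: "\<And>a b d. 0 \<le> h a b d" "\<And>y. y \<in> A \<Longrightarrow> 1 \<le> h (int (y i)) (int (y j)) (int (y k))"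
  shows "stay A y \<le> walk3 l h (int (y i)) (int (y j)) (int (y k))"
proof (induction l arbitrary: y)
  case 0
  then show ?case using stay_le_1[of A y] h(1) h(2)[of y] by (cases "y \<in> A") (auto intro: order_trans)
next
  case (Suc l)
  define W where "W y = walk3 (Suc l) h (int (y i)) (int (y j)) (int (y k))" for y :: "nat \<Rightarrow> nat"
  have W0: "0 \<le> W y" for y
    unfolding W_def using walk3_mono[of "\<lambda>_ _ _. 0" h] h(1) by (metis walk3_const)
  \<comment> \<open>The error term covers the event that none of the three sites jumps within
    \<open>r\<close> steps.\<close>
  have *: "stay A y \<le> W y + (1 - c) ^ r" for r y
  proof (induction r arbitrary: y)
    case 0
    then show ?case using stay_le_1[of A y] W0[of y] by simp
  next
    case IH: (Suc r)
    show ?case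
    proof (cases "y \<in> A")
      case False
      then show ?thesis using W0[of y] c_le_1 by simp
    next
      case True
      define T where "T = {i, j, k}"
      have T: "T \<subseteq> I" "finite T" using I by (auto simp: T_def)
      let ?s = "\<lambda>t. p y t * stay A (bump y t)"
      have "stay A y = sum ?s T + sum ?s (I - T)"
        unfolding stay_harmonic[OF True] K_def
        using T finite_I sum.subset_diff[of T I ?s] by linarith
      moreover have "sum ?s T = p y i * (stay A (bump y i) + stay A (bump y j) + stay A (bump y k))"
        unfolding T_def using dist eq[OF True] by (simp add: algebra_simps)
      moreover have "p y i * (stay A (bump y i) + stay A (bump y j) + stay A (bump y k))
          \<le> p y i * (3 * W y)"
      proof (intro mult_left_mono p_nonneg I)
        show "stay A (bump y i) + stay A (bump y j) + stay A (bump y k) \<le> 3 * W y"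
          using Suc[of "bump y i"] Suc[of "bump y j"] Suc[of "bump y k"] dist
          by (simp add: W_def algebra_simps)
      qed
      moreover have "sum ?s (I - T) \<le> (\<Sum>t\<in>I-T. p y t * (W y + (1 - c) ^ r))"
      proof (intro sum_mono mult_left_mono)
        fix t assume "t \<in> I - T"
        then have "W (bump y t) = W y" by (simp add: W_def T_def)
        then show "stay A (bump y t) \<le> W y + (1 - c) ^ r" using IH[of "bump y t"] by simp
      qed (use p_nonneg in auto)
      moreover have "(\<Sum>t\<in>I-T. p y t * (W y + (1 - c) ^ r)) = (1 - 3 * p y i) * (W y + (1 - c) ^ r)"
      proof -
        have "(\<Sum>t\<in>I. p y t) = (\<Sum>t\<in>T. p y t) + (\<Sum>t\<in>I-T. p y t)"
          using T finite_I sum.subset_diff[of T I "p y"] by linarith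
        moreover have "(\<Sum>t\<in>T. p y t) = 3 * p y i" unfolding T_def using dist eq[OF True] by simp
        ultimately have "(\<Sum>t\<in>I-T. p y t) = 1 - 3 * p y i" by (simp add: p_sum)
        then show ?thesis by (metis sum_distrib_right)
      qed
      moreover have "p y i * (3 * W y) + (1 - 3 * p y i) * (W y + (1 - c) ^ r)
          = W y + (1 - 3 * p y i) * (1 - c) ^ r"
        by (simp add: algebra_simps)
      moreover have "(1 - 3 * p y i) * (1 - c) ^ r \<le> (1 - c) * (1 - c) ^ r"
        using p_ge[OF I(1), of y] c_pos c_le_1 by (intro mult_right_mono) auto
      ultimately have "stay A y \<le> W y + (1 - c) * (1 - c) ^ r" by linarith
      then show ?thesis by simp
    qed
  qed
  have "(\<lambda>r. W y + (1 - c) ^ r) \<longlonglongrightarrow> W y + 0"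
    using c_pos c_le_1 by (intro tendsto_intros LIMSEQ_realpow_zero) auto
  then have "stay A y \<le> W y + 0" by (rule LIMSEQ_le_const) (use * in auto)
  then show ?case by (simp add: W_def)
qed

text \<open>On \<open>A\<close> the middle site avoids one extremal position, which the walk takes
  with probability at least 1/4 from any start after suitably many jumps. So \<open>stay\<close> is
  at most 3/4 everywhere, hence 0.\<close>

lemma stay_zero_neutral_triple:
  assumes I: "i \<in> I" "j \<in> I" "k \<in> I" and dist: "i \<noteq> j" "j \<noteq> k" "i \<noteq> k"
    and eq: "\<And>y. y \<in> A \<Longrightarrow> p y i = p y j \<and> p y j = p y k"
    and ext: "(\<forall>y\<in>A. \<not> (y j < y i \<and> y j < y k)) \<or> (\<forall>y\<in>A. \<not> (y i < y j \<and> y k < y j))"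
  shows "stay A y = 0"
proof (rule stay_zero_if_bounded)
  show "(3/4::real) < 1" by simp
  fix y
  obtain Q where Q: "Q = (\<lambda>a b d::int. b < a \<and> b < d) \<or> Q = (\<lambda>a b d::int. a < b \<and> d < b)"
    and QA: "\<And>y. y \<in> A \<Longrightarrow> \<not> Q (int (y i)) (int (y j)) (int (y k))"
    using ext by (elim disjE) (fastforce simp: Ball_def)+
  define h :: "int \<Rightarrow> int \<Rightarrow> int \<Rightarrow> real" where "h = (\<lambda>a b d. 1 - of_bool (Q a b d))"
  \<comment> \<open>All pairwise differences of the initial heights are at most \<open>g\<close>, so
    displacements more than \<open>g\<close> apart order the heights in the same way.\<close>
  define g where "g = \<bar>int (y i) - int (y j)\<bar> + \<bar>int (y j) - int (y k)\<bar>"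
  define m :: "int \<Rightarrow> int \<Rightarrow> int \<Rightarrow> real" where
    "m = (\<lambda>a b d. of_bool (Q (int (y i) + a) (int (y j) + b) (int (y k) + d)))"
  have "\<exists>l. walk3 l m 0 0 0 \<ge> 1 / 4"
  proof (rule walk3_extremal[where h = g])
    fix a b d :: int
    assume "\<bar>a - b\<bar> > g" "\<bar>b - d\<bar> > g" "\<bar>a - d\<bar> > g"
    then show "1 \<le> m a b d + m b a d + m a d b"
      using Q unfolding m_def g_def of_bool_def by (elim disjE) (simp; smt (verit))+
  qed (auto simp: m_def)
  then obtain l where l: "walk3 l m 0 0 0 \<ge> 1 / 4" by blast
  have "stay A y \<le> walk3 l h (int (y i)) (int (y j)) (int (y k))"
    by (rule stay_le_walk3[OF I dist eq]) (use QA in \<open>auto simp: h_def\<close>)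
  also have "\<dots> = walk3 l (\<lambda>a b d. 1 - m a b d) 0 0 0"
    using walk3_shift[of l h "int (y i)" "int (y j)" "int (y k)" 0 0 0] by (simp add: h_def m_def)
  also have "\<dots> = 1 - walk3 l m 0 0 0" by (simp add: walk3_diff walk3_const)
  finally show "stay A y \<le> 3 / 4" using l by simp
qed

end

subsection \<open>Peaks and valleys\<close>

context growth_chain
begin

text \<open>The gap grows with probability \<open>p y hi\<close> and shrinks with probability
  \<open>p y lo\<close>, so the drift carries the factor \<open>p y lo - r * p y hi\<close>. The gap
  is positive before the jump, so truncated subtraction is exact.\<close>

lemma K_gap_power_le:
  assumes "hi \<in> I" "lo \<in> I" "y lo < y hi" "0 \<le> r" "r \<le> 1" "p y lo \<le> r * p y hi"
  shows "K (\<lambda>y. r ^ (y hi - y lo)) y \<le> r ^ (y hi - y lo)"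
proof -
  let ?g = "\<lambda>y. r ^ (y hi - y lo)"
  obtain a where a: "y hi = y lo + Suc a" using assms(3) less_imp_Suc_add by auto
  have ne: "hi \<noteq> lo" using assms(3) by auto
  have "K ?g y - ?g y = (\<Sum>l\<in>{hi,lo}. p y l * (?g (bump y l) - ?g y))"
    unfolding K_drift[of ?g y] by (rule sum.mono_neutral_right) (use assms finite_I in auto)
  also have "\<dots> = (1 - r) * r ^ a * (p y lo - r * p y hi)"
    using ne a by (simp add: algebra_simps)
  also have "\<dots> \<le> 0"
    using assms by (intro mult_nonneg_nonpos mult_nonneg_nonneg) auto
  finally show ?thesis by simp
qed

text \<open>The sum of \<open>r\<close> to the power of the gaps is a supermartingale, so once all gaps are large
  the configuration survives with probability at least one half; enlarging the gaps first
  costs a fixed number of jumps of the upper sites.\<close>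

lemma surv_gaps_ge:
  assumes N: "finite N" "N \<subseteq> I \<times> I" "fst ` N \<inter> snd ` N = {}"
    and r: "0 \<le> r" "r < 1"
    and rates: "\<And>y hi lo. \<forall>(hi, lo)\<in>N. y lo < y hi \<Longrightarrow> (hi, lo) \<in> N \<Longrightarrow> p y lo \<le> r * p y hi"
  shows "\<exists>d>0. d \<le> 1 \<and> (\<forall>y k. (\<forall>(hi, lo)\<in>N. y lo < y hi) \<longrightarrow>
           d \<le> surv {y. \<forall>(hi, lo)\<in>N. y lo < y hi} k y)"
proof -
  define B where "B = {y :: nat \<Rightarrow> nat. \<forall>(hi, lo)\<in>N. y lo < y hi}"
  define f where "f y = (\<Sum>(hi, lo)\<in>N. r ^ (y hi - y lo))" for y :: "nat \<Rightarrow> nat"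
  have f0: "0 \<le> f y" for y unfolding f_def using r by (intro sum_nonneg) auto
  have f1: "1 \<le> f y" if "y \<notin> B" for y
  proof -
    obtain hi lo where hl: "(hi, lo) \<in> N" "y hi \<le> y lo" using \<open>y \<notin> B\<close> by (force simp: B_def)
    then have "1 = (case (hi, lo) of (hi, lo) \<Rightarrow> r ^ (y hi - y lo))" by simp
    also have "\<dots> \<le> f y" unfolding f_def
      by (rule member_le_sum) (use hl r N in auto)
    finally show ?thesis .
  qed
  have Kf: "K f y \<le> f y" if "y \<in> B" for y
  proof -
    have "K f y = (\<Sum>e\<in>N. K (\<lambda>y. r ^ (y (fst e) - y (snd e))) y)"
      unfolding K_def f_def case_prod_unfold
      by (simp add: sum_distrib_left) (rule sum.swap)
    also have "\<dots> \<le> (\<Sum>e\<in>N. r ^ (y (fst e) - y (snd e)))"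
      by (intro sum_mono K_gap_power_le)
        (use N r that rates[of y] in \<open>auto simp: B_def\<close>)
    finally show ?thesis by (simp add: f_def case_prod_unfold)
  qed
  \<comment> \<open>There are \<open>card N\<close> gaps; once each is at least \<open>A\<close>,
    the supermartingale is at most 1/2.\<close>
  have "(\<lambda>A. real (card N) * r ^ A) \<longlonglongrightarrow> real (card N) * 0"
    using r by (intro tendsto_intros LIMSEQ_realpow_zero) auto
  then have "\<forall>\<^sub>F A in sequentially. real (card N) * r ^ A < 1 / 2"
    by (intro order_tendstoD(2)) auto
  then obtain A where A: "real (card N) * r ^ A < 1 / 2" by (auto simp: eventually_sequentially)
  obtain hs where hs: "set hs = fst ` N" using finite_list[of "fst ` N"] N by auto
  \<comment> \<open>Only upper sites jump along \<open>w\<close>, each at least \<open>A\<close>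
    times. Since no upper site is also a lower one, no gap shrinks on the way.\<close>
  define w where "w = concat (replicate A hs)"
  have wI: "set w \<subseteq> I" using hs N by (auto simp: w_def)
  have cnt0: "count_list (take i w) lo = 0" if "(hi, lo) \<in> N" for hi lo i
  proof -
    have "set w \<subseteq> fst ` N" using hs by (auto simp: w_def)
    moreover have "lo \<in> snd ` N" using that by force
    ultimately have "lo \<notin> set w" using N(3) by blast
    then show ?thesis by (metis count_list_0_iff in_set_takeD)
  qed
  have cntA: "A \<le> count_list w hi" if "(hi, lo) \<in> N" for hi lo
  proof -
    have "hi \<in> set hs" using that hs by force
    then have "1 \<le> count_list hs hi" by (metis One_nat_def Suc_leI count_list_0_iff neq0_conv)
    then show ?thesis unfolding w_def by (induction A) auto
  qed
  have path: "foldl bump y (take i w) \<in> B" if "y \<in> B" for y i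
    unfolding B_def mem_Collect_eq
  proof clarify
    fix hi lo assume "(hi, lo) \<in> N"
    then have "y lo < y hi" "count_list (take i w) lo = 0" using that cnt0 by (auto simp: B_def)
    then show "foldl bump y (take i w) lo < foldl bump y (take i w) hi"
      by (simp add: foldl_bump_apply)
  qed
  have half: "1 / 2 \<le> surv B k (foldl bump y w)" if "y \<in> B" for y k
  proof -
    have "f (foldl bump y w) \<le> (\<Sum>e\<in>N. r ^ A)"
      unfolding f_def case_prod_unfold
    proof (intro sum_mono power_decreasing)
      fix e assume e: "e \<in> N"
      then have "y (snd e) < y (fst e)" using that by (auto simp: B_def)
      then show "A \<le> foldl bump y w (fst e) - foldl bump y w (snd e)"
        using cntA[of "fst e" "snd e"] cnt0[of "fst e" "snd e" "length w"] e
        by (simp add: foldl_bump_apply)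
    qed (use r in auto)
    then have "f (foldl bump y w) \<le> 1 / 2" using A by simp
    then show ?thesis using surv_ge_supermartingale[of f B "foldl bump y w" k, OF f0 f1 Kf] by simp
  qed
  show ?thesis
  proof (intro exI[of _ "c ^ length w / 2"] conjI allI impI)
    show "c ^ length w / 2 > 0" using c_pos by simp
    have "c ^ length w \<le> 1" using c_pos c_le_1 by (simp add: power_le_one)
    then show "c ^ length w / 2 \<le> 1" by simp
    fix y :: "nat \<Rightarrow> nat" and k assume "\<forall>(hi, lo)\<in>N. y lo < y hi"
    then have y: "y \<in> B" by (simp add: B_def)
    have "c ^ length w * (1 / 2) \<le> c ^ length w * surv B k (foldl bump y w)"
      using half[OF y] c_pos by (intro mult_left_mono) auto
    also have "\<dots> \<le> surv B (length w + k) y" by (rule surv_ge_path[OF wI path[OF y]])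
    also have "\<dots> \<le> surv B k y" by (rule surv_antimono) simp
    finally show "c ^ length w / 2 \<le> surv {y. \<forall>(hi, lo)\<in>N. y lo < y hi} k y" by (simp add: B_def)
  qed
qed

text \<open>A jump at \<open>i\<close> changes each of the two ordered pairs formed with another
  site \<open>k\<close> by \<open>2 * (y i - y k) + 1\<close>; this is the origin of the factors 4
  and 2.\<close>

lemma K_spread_drift:
  assumes "T \<subseteq> I"
  defines "Q \<equiv> \<lambda>y. \<Sum>i\<in>T. \<Sum>k\<in>T. (real (y i) - real (y k))\<^sup>2"
  shows "K Q y - Q y = (\<Sum>i\<in>T. p y i * (4 * (\<Sum>k\<in>T. real (y i) - real (y k)) + 2 * (real (card T) - 1)))"
proof -
  have T: "finite T" using assms finite_I finite_subset by blast
  have in_T: "Q (bump y i) - Q y = 4 * (\<Sum>k\<in>T. real (y i) - real (y k)) + 2 * (real (card T) - 1)"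
    if i: "i \<in> T" for i
  proof -
    \<comment> \<open>The last term corrects the diagonal pair, where the first two contribute 1
      each although nothing changes.\<close>
    have pt: "(real (bump y i a) - real (bump y i b))\<^sup>2 - (real (y a) - real (y b))\<^sup>2
       = (if a = i then 2 * (real (y i) - real (y b)) + 1 else 0)
       + (if b = i then 2 * (real (y i) - real (y a)) + 1 else 0)
       - (if a = i then if b = i then 2 else 0 else 0)" for a b
      by (auto simp: bump_apply power2_eq_square algebra_simps)
    have "Q (bump y i) - Q y
        = (\<Sum>a\<in>T. \<Sum>b\<in>T. (real (bump y i a) - real (bump y i b))\<^sup>2 - (real (y a) - real (y b))\<^sup>2)"
      by (simp add: Q_def sum_subtractf)
    also have "\<dots> = (\<Sum>a\<in>T. \<Sum>b\<in>T. (if a = i then 2 * (real (y i) - real (y b)) + 1 else 0))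
       + (\<Sum>a\<in>T. \<Sum>b\<in>T. (if b = i then 2 * (real (y i) - real (y a)) + 1 else 0))
       - (\<Sum>a\<in>T. \<Sum>b\<in>T. (if a = i then if b = i then 2 else 0 else 0))"
      by (simp only: pt sum.distrib sum_subtractf)
    also have "(\<Sum>a\<in>T. \<Sum>b\<in>T. (if a = i then 2 * (real (y i) - real (y b)) + 1 else 0))
        = (\<Sum>b\<in>T. 2 * (real (y i) - real (y b)) + 1)"
      by (subst sum.swap) (simp add: T i)
    also have "(\<Sum>a\<in>T. \<Sum>b\<in>T. (if b = i then 2 * (real (y i) - real (y a)) + 1 else 0))
        = (\<Sum>b\<in>T. 2 * (real (y i) - real (y b)) + 1)"
      by (simp add: T i)
    also have "(\<Sum>a\<in>T. \<Sum>b\<in>T. (if a = i then if b = i then 2 else 0 else 0)) = (2::real)"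
      by (subst sum.swap) (simp add: T i)
    also have "(\<Sum>b\<in>T. 2 * (real (y i) - real (y b)) + 1)
        = 2 * (\<Sum>b\<in>T. real (y i) - real (y b)) + real (card T)"
      by (simp add: sum.distrib sum_distrib_left)
    finally show ?thesis by (simp add: algebra_simps)
  qed
  have out_T: "Q (bump y i) - Q y = 0" if "i \<notin> T" for i
  proof -
    have "bump y i a = y a" if "a \<in> T" for a using that \<open>i \<notin> T\<close> by (metis bump_other)
    then show ?thesis by (simp add: Q_def)
  qed
  have "K Q y - Q y = (\<Sum>i\<in>T. p y i * (Q (bump y i) - Q y))"
    unfolding K_drift by (rule sum.mono_neutral_right) (use assms finite_I out_T in auto)
  also have "\<dots> = (\<Sum>i\<in>T. p y i * (4 * (\<Sum>k\<in>T. real (y i) - real (y k)) + 2 * (real (card T) - 1)))"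
    by (intro sum.cong refl) (simp only: in_T)
  finally show ?thesis .
qed

end

text \<open>Boundary sites are excluded because their outer neighbour has height 0 and is never
  higher.\<close>

definition valley :: "nat \<Rightarrow> (nat \<Rightarrow> nat) \<Rightarrow> nat \<Rightarrow> bool" where
  "valley n y j \<longleftrightarrow> 1 < j \<and> j < n \<and> y j < y (j - 1) \<and> y j < y (j + 1)"

text \<open>An outer neighbour of height 0 never raises the rate index, so only neighbours in range
  are compared and a boundary site can be a peak.\<close>

definition peak :: "nat \<Rightarrow> (nat \<Rightarrow> nat) \<Rightarrow> nat \<Rightarrow> bool" where
  "peak n y j \<longleftrightarrow> 1 \<le> j \<and> j \<le> n \<and> (1 < j \<longrightarrow> y (j - 1) < y j) \<and> (j < n \<longrightarrow> y (j + 1) < y j)"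

definition valleys :: "nat \<Rightarrow> (nat \<Rightarrow> nat) \<Rightarrow> nat set" where
  "valleys n y = {j. valley n y j}"

definition peaks :: "nat \<Rightarrow> (nat \<Rightarrow> nat) \<Rightarrow> nat set" where
  "peaks n y = {j. peak n y j}"

lemma Vn_eq: "1 \<le> j \<Longrightarrow> j \<le> n \<Longrightarrow>
    Vn n y j = of_bool (1 < j \<and> y j < y (j - 1)) + of_bool (j < n \<and> y j < y (j + 1))"
  unfolding Vn_def ext_def by auto

lemma Vn_le_2: "Vn n y j \<le> 2"
  by (simp add: Vn_def)

lemma Vn_eq_2_iff: "1 \<le> j \<Longrightarrow> j \<le> n \<Longrightarrow> Vn n y j = 2 \<longleftrightarrow> valley n y j"
  by (auto simp: Vn_eq valley_def)

text \<open>Index 0 says that no neighbour is higher; a single jump makes this strict.\<close>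

lemma peak_bump_of_Vn_0: "1 \<le> j \<Longrightarrow> j \<le> n \<Longrightarrow> Vn n y j = 0 \<Longrightarrow> peak n (bump y j) j"
  by (auto simp: Vn_eq peak_def not_less bump_apply)

locale crystal_model =
  fixes b0 b1 b2 :: real and n :: nat
  assumes b_pos: "0 < b0" "0 < b1" "0 < b2" and n_ge: "2 \<le> n"
begin

abbreviation V :: "(nat \<Rightarrow> nat) \<Rightarrow> nat \<Rightarrow> nat" where "V \<equiv> Vn n"
abbreviation rt :: "(nat \<Rightarrow> nat) \<Rightarrow> nat \<Rightarrow> real" where "rt \<equiv> rate b0 b1 b2 n"
abbreviation q :: "(nat \<Rightarrow> nat) \<Rightarrow> real" where "q \<equiv> total_rate b0 b1 b2 n"

definition bmin where "bmin = min b0 (min b1 b2)"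
definition bmax where "bmax = max b0 (max b1 b2)"
definition pr :: "(nat \<Rightarrow> nat) \<Rightarrow> nat \<Rightarrow> real" where "pr y j = rt y j / q y"

lemma bmin_pos: "0 < bmin" and bmax_pos: "0 < bmax"
  using b_pos by (auto simp: bmin_def bmax_def)

lemma rt_ge: "bmin \<le> rt y j" and rt_le: "rt y j \<le> bmax"
  by (auto simp: rate_def beta_def bmin_def bmax_def)

lemma rt_pos: "0 < rt y j"
  using rt_ge[of y j] bmin_pos by linarith

lemma q_ge: "real n * bmin \<le> q y"
  using sum_mono[of "{1..n}" "\<lambda>_. bmin" "rt y"] rt_ge by (simp add: total_rate_def)

lemma q_le: "q y \<le> real n * bmax"
  using sum_mono[of "{1..n}" "rt y" "\<lambda>_. bmax"] rt_le by (simp add: total_rate_def)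

lemma q_pos: "0 < q y"
  using q_ge[of y] bmin_pos n_ge by (smt (verit) mult_pos_pos of_nat_0_less_iff pos2 order_less_le_trans)

sublocale growth_chain pr "{1..n}" "bmin / (real n * bmax)"
proof unfold_locales
  \<comment> \<open>The constant is the smallest rate divided by an upper bound for the total
    rate.\<close>
  show "0 < bmin / (real n * bmax)" using bmin_pos bmax_pos n_ge by simp
  show "bmin / (real n * bmax) \<le> pr y i" for y i
    unfolding pr_def using rt_ge[of y i] q_le[of y] q_pos[of y] bmin_pos by (intro frac_le) auto
  show "(\<Sum>i\<in>{1..n}. pr y i) = 1" for y
    using q_pos[of y] by (simp add: pr_def total_rate_def flip: sum_divide_distrib)
qed auto

lemma pr_le_if_rt_le: "rt y i \<le> r * rt y j \<Longrightarrow> pr y i \<le> r * pr y j"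
  unfolding pr_def using q_pos[of y] by (simp add: divide_right_mono)

text \<open>The valley moves at rate \<open>b2\<close>, while each neighbour has the lower valley
  beside it, hence index at most 1 and rate at least \<open>min b0 b1\<close>. Both gaps tend to
  grow, with ratio \<open>b2 / min b0 b1\<close>.\<close>

lemma valley_persists:
  assumes "b2 < b0" "b2 < b1"
  shows "\<exists>d>0. d \<le> 1 \<and> (\<forall>y k. valley n y j \<longrightarrow> d \<le> surv {y. valley n y j} k y)"
proof (cases "1 < j \<and> j < n")
  case False
  then show ?thesis by (intro exI[of _ 1]) (auto simp: valley_def)
next
  case True
  define N where "N = {(j - 1, j), (j + 1, j)}"
  have eq: "valley n y j \<longleftrightarrow> (\<forall>(hi, lo)\<in>N. y lo < y hi)" for y
    using True by (auto simp: valley_def N_def)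
  have "\<exists>d>0. d \<le> 1 \<and> (\<forall>y k. (\<forall>(hi, lo)\<in>N. y lo < y hi) \<longrightarrow>
           d \<le> surv {y. \<forall>(hi, lo)\<in>N. y lo < y hi} k y)"
  proof (rule surv_gaps_ge[where r = "b2 / min b0 b1"])
    fix y :: "nat \<Rightarrow> nat" and hi lo assume v: "\<forall>(hi, lo)\<in>N. y lo < y hi" and e: "(hi, lo) \<in> N"
    have "valley n y j" using v eq by simp
    then have "rt y j = b2" using True Vn_eq_2_iff[of j n y] by (auto simp: rate_def beta_def)
    moreover have "V y (j - 1) \<le> 1" "V y (j + 1) \<le> 1"
      using True v by (auto simp: N_def Vn_eq)
    then have "min b0 b1 \<le> rt y (j - 1)" "min b0 b1 \<le> rt y (j + 1)"
      by (auto simp: rate_def beta_def)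
    then have "b2 \<le> b2 / min b0 b1 * rt y (j - 1)" "b2 \<le> b2 / min b0 b1 * rt y (j + 1)"
      using b_pos by (auto simp: field_simps min_def split: if_splits)
    ultimately show "pr y lo \<le> b2 / min b0 b1 * pr y hi"
      using e by (intro pr_le_if_rt_le) (auto simp: N_def)
  qed (use True b_pos assms in \<open>auto simp: N_def\<close>)
  then show ?thesis by (simp only: eq)
qed

text \<open>A peak moves at rate \<open>b0\<close>, and each neighbour has the higher peak beside
  it, hence rate at most \<open>max b1 b2\<close>. At a boundary site \<open>N\<close> contains only
  the gap that exists.\<close>

lemma peak_persists:
  assumes "b1 < b0" "b2 < b0"
  shows "\<exists>d>0. d \<le> 1 \<and> (\<forall>y k. peak n y j \<longrightarrow> d \<le> surv {y. peak n y j} k y)"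
proof (cases "1 \<le> j \<and> j \<le> n")
  case False
  then show ?thesis by (intro exI[of _ 1]) (auto simp: peak_def)
next
  case True
  define N where "N = (if 1 < j then {(j, j - 1)} else {}) \<union> (if j < n then {(j, j + 1)} else {})"
  have eq: "peak n y j \<longleftrightarrow> (\<forall>(hi, lo)\<in>N. y lo < y hi)" for y
    using True by (auto simp: peak_def N_def)
  have "\<exists>d>0. d \<le> 1 \<and> (\<forall>y k. (\<forall>(hi, lo)\<in>N. y lo < y hi) \<longrightarrow>
           d \<le> surv {y. \<forall>(hi, lo)\<in>N. y lo < y hi} k y)"
  proof (rule surv_gaps_ge[where r = "max b1 b2 / b0"])
    fix y :: "nat \<Rightarrow> nat" and hi lo assume v: "\<forall>(hi, lo)\<in>N. y lo < y hi" and e: "(hi, lo) \<in> N"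
    have "peak n y j" using v eq by simp
    then have "rt y j = b0" using True by (auto simp: rate_def beta_def Vn_eq peak_def)
    moreover have "hi = j" "1 \<le> V y lo"
      using True v e by (auto simp: N_def Vn_eq split: if_splits)
    moreover from this have "rt y lo \<le> max b1 b2" by (auto simp: rate_def beta_def)
    ultimately show "pr y lo \<le> max b1 b2 / b0 * pr y hi"
      using b_pos by (intro pr_le_if_rt_le) auto
  qed (use True b_pos assms in \<open>auto simp: N_def split: if_splits\<close>)
  then show ?thesis by (simp only: eq)
qed

lemma pr_eq_if_V_eq: "V y i = V y j \<Longrightarrow> pr y i = pr y j"
  by (simp add: pr_def rate_def)

lemma pr_eq_if_rt_eq: "rt y i = a \<Longrightarrow> rt y j = a \<Longrightarrow> pr y i = pr y j"
  by (simp add: pr_def)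

lemma reach_new_peak:
  assumes "1 \<le> k" "k \<le> n" "V y k = 0" "k \<notin> P"
  shows "\<exists>w. set w \<subseteq> {1..n} \<and> length w \<le> 1 \<and> peaks n (foldl bump y w) \<noteq> P"
proof -
  have "k \<in> peaks n (foldl bump y [k])"
    using peak_bump_of_Vn_0[OF assms(1-3)] by (simp add: peaks_def)
  then have "peaks n (foldl bump y [k]) \<noteq> P" using assms(4) by blast
  then show ?thesis using assms(1,2) by (intro exI[of _ "[k]"]) simp
qed

text \<open>Away from the exceptional set both sites have index 1 and different heights: a neutral
  pair that never ties. In the exceptional set one jump produces a new peak or, from a tie, a new
  valley.\<close>

lemma stay_adjacent_unlabelled:
  assumes "1 \<le> j" "j + 1 \<le> n" "j \<notin> P" "j + 1 \<notin> P" "j \<notin> W" "j + 1 \<notin> W"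
  shows "stay {y. peaks n y = P \<and> valleys n y = W} y = 0"
proof (rule stay_zero_two_stage[where G = "{y. V y j = 0 \<or> V y (j + 1) = 0 \<or> y j = y (j + 1)}" and L = 1])
  fix y
  show "stay ({y. peaks n y = P \<and> valleys n y = W} - {y. V y j = 0 \<or> V y (j + 1) = 0 \<or> y j = y (j + 1)}) y = 0"
  proof (rule stay_zero_neutral_pair[of j "j + 1"])
    fix y assume y: "y \<in> {y. peaks n y = P \<and> valleys n y = W} - {y. V y j = 0 \<or> V y (j + 1) = 0 \<or> y j = y (j + 1)}"
    then have "V y j \<noteq> 2" "V y (j + 1) \<noteq> 2"
      using assms Vn_eq_2_iff[of j n y] Vn_eq_2_iff[of "j + 1" n y] by (auto simp: valleys_def)
    then have "V y j = 1" "V y (j + 1) = 1"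
      using y Vn_le_2[of n y j] Vn_le_2[of n y "j + 1"] by auto
    then show "pr y j = pr y (j + 1)" by (intro pr_eq_if_V_eq) simp
  qed (use assms in auto)
next
  fix y assume y: "y \<in> {y. peaks n y = P \<and> valleys n y = W}"
    and G: "y \<in> {y. V y j = 0 \<or> V y (j + 1) = 0 \<or> y j = y (j + 1)}"
  have pk: "\<exists>w. set w \<subseteq> {1..n} \<and> length w \<le> 1 \<and> foldl bump y w \<notin> {y. peaks n y = P \<and> valleys n y = W}"
    if "V y i = 0" "i = j \<or> i = j + 1" for i
    using reach_new_peak[of i y P] that assms by auto
  show "\<exists>w. set w \<subseteq> {1..n} \<and> length w \<le> 1 \<and> foldl bump y w \<notin> {y. peaks n y = P \<and> valleys n y = W}"
  proof (cases "V y j = 0 \<or> V y (j + 1) = 0")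
    case True
    then show ?thesis using pk by blast
  next
    case False
    then have "y j = y (j + 1)" using G by auto
    \<comment> \<open>Site \<open>j + 1\<close> has a nonzero index although it ties with
      \<open>j\<close>, so its far neighbour is higher; raising \<open>j\<close> completes the
      valley.\<close>
    then have "valley n (bump y j) (j + 1)" using False assms
      by (auto simp: Vn_eq valley_def bump_apply split: if_splits)
    then have "valleys n (bump y j) \<noteq> W" using assms by (auto simp: valleys_def)
    then show ?thesis using assms by (intro exI[of _ "[j]"]) auto
  qed
qed

text \<open>If neither index is 0, the boundary site \<open>i\<close> is lower than \<open>j\<close>
  and both have index 1, again a neutral pair that never ties.\<close>

lemma stay_edge_without_peak:
  assumes "(i = 1 \<and> j = 2) \<or> (i = n \<and> j = n - 1)" "i \<notin> P" "j \<notin> P"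
  shows "stay {y. peaks n y = P} y = 0"
proof (rule stay_zero_two_stage[where G = "{y. V y i = 0 \<or> V y j = 0}" and L = 1])
  fix y
  show "stay ({y. peaks n y = P} - {y. V y i = 0 \<or> V y j = 0}) y = 0"
  proof (rule stay_zero_neutral_pair[of i j])
    fix y assume y: "y \<in> {y. peaks n y = P} - {y. V y i = 0 \<or> V y j = 0}"
    then have lt: "y i < y j" using assms n_ge by (auto simp: Vn_eq numeral_2_eq_2)
    then show "y i \<noteq> y j" by simp
    have "V y i = 1" "V y j = 1" using assms n_ge y lt by (auto simp: Vn_eq numeral_2_eq_2)
    then show "pr y i = pr y j" by (intro pr_eq_if_V_eq) simp
  qed (use assms n_ge in auto)
next
  fix y assume y: "y \<in> {y. peaks n y = P}" and G: "y \<in> {y. V y i = 0 \<or> V y j = 0}"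
  then obtain k where k: "k = i \<or> k = j" "V y k = 0" by auto
  then show "\<exists>w. set w \<subseteq> {1..n} \<and> length w \<le> 1 \<and> foldl bump y w \<notin> {y. peaks n y = P}"
    using reach_new_peak[of k y P] assms n_ge by auto
qed

text \<open>Without index 0 all three rates are \<open>b2\<close>, and a middle site above both
  others would be a new peak. An index 0 leads to a new peak in one jump.\<close>

lemma stay_three_without_peak_neutral:
  assumes "b1 = b2" "1 \<le> j" "j + 2 \<le> n" "j \<notin> P" "j + 1 \<notin> P" "j + 2 \<notin> P"
  shows "stay {y. peaks n y = P} y = 0"
proof (rule stay_zero_two_stage[where G = "{y. V y j = 0 \<or> V y (j + 1) = 0 \<or> V y (j + 2) = 0}" and L = 1])
  fix y
  show "stay ({y. peaks n y = P} - {y. V y j = 0 \<or> V y (j + 1) = 0 \<or> V y (j + 2) = 0}) y = 0"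
  proof (rule stay_zero_neutral_triple[of j "j + 1" "j + 2"])
    fix y assume y: "y \<in> {y. peaks n y = P} - {y. V y j = 0 \<or> V y (j + 1) = 0 \<or> V y (j + 2) = 0}"
    then show "pr y j = pr y (j + 1) \<and> pr y (j + 1) = pr y (j + 2)"
      using assms(1) by (intro conjI pr_eq_if_rt_eq[of _ _ b2]) (simp_all add: rate_def beta_def)
  next
    show "(\<forall>y\<in>{y. peaks n y = P} - {y. V y j = 0 \<or> V y (j + 1) = 0 \<or> V y (j + 2) = 0}. \<not> (y (j + 1) < y j \<and> y (j + 1) < y (j + 2)))
      \<or> (\<forall>y\<in>{y. peaks n y = P} - {y. V y j = 0 \<or> V y (j + 1) = 0 \<or> V y (j + 2) = 0}. \<not> (y j < y (j + 1) \<and> y (j + 2) < y (j + 1)))"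
      using assms by (intro disjI2) (auto simp: peaks_def peak_def)
  qed (use assms in auto)
next
  fix y assume y: "y \<in> {y. peaks n y = P}" and G: "y \<in> {y. V y j = 0 \<or> V y (j + 1) = 0 \<or> V y (j + 2) = 0}"
  then obtain k where k: "k = j \<or> k = j + 1 \<or> k = j + 2" "V y k = 0" by auto
  then show "\<exists>w. set w \<subseteq> {1..n} \<and> length w \<le> 1 \<and> foldl bump y w \<notin> {y. peaks n y = P}"
    using reach_new_peak[of k y P] assms by auto
qed

text \<open>The sites are never valleys, so their indices are 0 or 1 and their rates agree at once;
  the middle site is never strictly lowest.\<close>

lemma stay_three_without_valley_neutral:
  assumes "b0 = b1" "1 \<le> j" "j + 2 \<le> n" "j \<notin> W" "j + 1 \<notin> W" "j + 2 \<notin> W"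
  shows "stay {y. valleys n y = W} y = 0"
proof (rule stay_zero_neutral_triple[of j "j + 1" "j + 2"])
  fix y assume y: "y \<in> {y. valleys n y = W}"
  then have "V y k \<noteq> 2" if "k = j \<or> k = j + 1 \<or> k = j + 2" for k
    using assms that Vn_eq_2_iff[of k n y] by (auto simp: valleys_def)
  then have "V y k = 0 \<or> V y k = 1" if "k = j \<or> k = j + 1 \<or> k = j + 2" for k
    using that Vn_le_2[of n y k] by force
  from this[of j] this[of "j + 1"] this[of "j + 2"]
  show "pr y j = pr y (j + 1) \<and> pr y (j + 1) = pr y (j + 2)"
    using assms(1) by (intro conjI pr_eq_if_rt_eq[of _ _ b1]) (auto simp add: rate_def beta_def)
next
  show "(\<forall>y\<in>{y. valleys n y = W}. \<not> (y (j + 1) < y j \<and> y (j + 1) < y (j + 2)))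
      \<or> (\<forall>y\<in>{y. valleys n y = W}. \<not> (y j < y (j + 1) \<and> y (j + 2) < y (j + 1)))"
    using assms by (intro disjI1) (auto simp: valleys_def valley_def)
qed (use assms in auto)

end

subsection \<open>Contracting blocks\<close>

lemma count_list_distinct: "distinct xs \<Longrightarrow> count_list xs a = of_bool (a \<in> set xs)"
  by (induction xs) auto

lemma finite_obtain_maximizer:
  fixes f :: "'a \<Rightarrow> 'b :: linorder"
  assumes "finite T" "a \<in> T"
  obtains i where "i \<in> T" "\<And>k. k \<in> T \<Longrightarrow> f k \<le> f i"
proof -
  have "Max (f ` T) \<in> f ` T" using assms by (intro Max_in) auto
  then obtain i where "i \<in> T" "Max (f ` T) = f i" by auto
  then show ?thesis using that[of i] assms(1) by (metis Max_ge finite_imageI imageI)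
qed

context crystal_model
begin

text \<open>Between two higher ends the interior minimum may be attained several times. Raising
  every minimiser but one by a single jump leaves a strict valley at the remaining one.\<close>

lemma reach_new_valley:
  assumes "1 \<le> u" "u < v" "v < w" "w \<le> n" "y v < y u" "y v < y w" "\<And>k. u < k \<Longrightarrow> k < w \<Longrightarrow> k \<notin> W"
  shows "\<exists>ws. set ws \<subseteq> {1..n} \<and> length ws \<le> n \<and> valleys n (foldl bump y ws) \<noteq> W"
proof -
  define Mn where "Mn = Min (y ` {u<..<w})"
  have v: "v \<in> {u<..<w}" using assms by simp
  then have Mn_le: "Mn \<le> y k" if "k \<in> {u<..<w}" for k using that by (simp add: Mn_def)
  have "Mn \<in> y ` {u<..<w}" unfolding Mn_def using v by (intro Min_in) auto
  then obtain v0 where v0: "v0 \<in> {u<..<w}" "y v0 = Mn" by auto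
  define Z where "Z = {z \<in> {u<..<w}. y z = Mn} - {v0}"
  have Z: "finite Z" "Z \<subseteq> {1..n}" using assms by (auto simp: Z_def)
  obtain zs where zs: "set zs = Z" "distinct zs" using finite_distinct_list[OF Z(1)] by auto
  have "length zs \<le> n"
    using card_mono[OF _ Z(2)] zs distinct_card[of zs] by simp
  moreover have ap: "foldl bump y zs k = y k + of_bool (k \<in> Z)" for k
    using zs by (simp add: foldl_bump_apply count_list_distinct)
  have nb: "Mn < foldl bump y zs k" if k: "k = v0 - 1 \<or> k = v0 + 1" for k
  proof -
    have "k \<noteq> v0" using k v0(1) by auto
    have "k = u \<or> k = w \<or> k \<in> {u<..<w}" using k v0(1) by auto
    then consider "k = u" | "k = w" | "k \<in> {u<..<w}" by blast
    then show ?thesis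
    proof cases
      case 3
      then show ?thesis using Mn_le[OF 3] \<open>k \<noteq> v0\<close>
        by (cases "y k = Mn") (auto simp: ap Z_def)
    qed (use assms Mn_le[OF v] in \<open>auto simp: ap\<close>)
  qed
  have "valley n (foldl bump y zs) v0"
    unfolding valley_def using nb[of "v0 - 1"] nb[of "v0 + 1"] v0 assms ap[of v0]
    by (auto simp: Z_def)
  then have "v0 \<in> valleys n (foldl bump y zs)" by (simp add: valleys_def)
  moreover have "v0 \<notin> W" using v0 assms by auto
  ultimately show ?thesis using zs Z by (intro exI[of _ zs]) auto
qed

lemma sum_differences_zero: "(\<Sum>i\<in>T. \<Sum>k\<in>T. f i - f k) = (0::real)"
  by (subst sum_subtractf[THEN sum.cong[OF refl]]) (simp add: sum_subtractf flip: sum_distrib_left)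

text \<open>Multiplying by the total rate removes the state-dependent normalisation, so that rates
  can be inserted directly.\<close>

lemma q_spread_drift:
  assumes "T \<subseteq> {1..n}"
  defines "Q \<equiv> \<lambda>y. \<Sum>i\<in>T. \<Sum>k\<in>T. (real (y i) - real (y k))\<^sup>2"
  shows "q y * (K Q y - Q y) =
    4 * (\<Sum>i\<in>T. rt y i * (\<Sum>k\<in>T. real (y i) - real (y k))) + 2 * (real (card T) - 1) * (\<Sum>i\<in>T. rt y i)"
proof -
  have "q y * (K Q y - Q y) = (\<Sum>i\<in>T. q y * (pr y i * (4 * (\<Sum>k\<in>T. real (y i) - real (y k)) + 2 * (real (card T) - 1))))"
    unfolding Q_def K_spread_drift[OF assms(1)] sum_distrib_left ..
  also have "\<dots> = (\<Sum>i\<in>T. 4 * (rt y i * (\<Sum>k\<in>T. real (y i) - real (y k))) + 2 * (real (card T) - 1) * rt y i)"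
    using q_pos[of y] by (intro sum.cong) (auto simp: pr_def algebra_simps)
  finally show ?thesis by (simp add: sum.distrib sum_distrib_left)
qed

text \<open>Inside the block the rate is \<open>b1\<close>, lowered to \<open>b0\<close> at weak
  local maxima. If all of these are block maxima and the spread is large, the slow top makes the
  quadratic spread decrease; otherwise a bounded word creates a valley.\<close>

lemma stay_three_without_valley_contracting:
  assumes "b0 < b1" and ab: "1 \<le> a" "a + 2 \<le> b" "b \<le> n" and W: "\<And>i. i \<in> {a..b} \<Longrightarrow> i \<notin> W"
    and ends: "a = 1 \<or> a - 1 \<in> W" "b = n \<or> b + 1 \<in> W"
  shows "stay {y. valleys n y = W} y = 0"
proof -
  define T where "T = {a..b}"
  have T: "T \<subseteq> {1..n}" "finite T" "a \<in> T" using ab by (auto simp: T_def)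
  define m where "m = real (card T)"
  \<comment> \<open>Chosen so that the restoring term exceeds the noise term
    \<open>2 * m * m * b1\<close> by at least 1.\<close>
  obtain C :: nat where C: "2 * m * m * b1 + 1 \<le> real C * (4 * (b1 - b0))"
    using ex_less_of_nat_mult[of "4 * (b1 - b0)" "2 * m * m * b1 + 1"] assms(1) by (auto intro: less_imp_le)
  define G where "G = {y :: nat \<Rightarrow> nat. (\<exists>i\<in>T. V y i = 0 \<and> (\<exists>k\<in>T. y i < y k)) \<or> (\<forall>i\<in>T. \<forall>k\<in>T. y i \<le> y k + C)}"
  define Q where "Q y = (\<Sum>i\<in>T. \<Sum>k\<in>T. (real (y i) - real (y k))\<^sup>2)" for y :: "nat \<Rightarrow> nat"
  show ?thesis
  proof (rule stay_zero_two_stage[where G = G and L = "n + 1 + 2 * (C + 1)"])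
    show "stay ({y. valleys n y = W} - G) y = 0" for y
    proof (rule stay_zero_Foster[where f = Q and \<epsilon> = "1 / (real n * bmax)"])
      show "0 \<le> Q y" for y by (auto simp: Q_def intro!: sum_nonneg)
      show "0 < 1 / (real n * bmax)" using bmax_pos n_ge by simp
      fix y assume y: "y \<in> {y. valleys n y = W} - G"
      define s where "s i = (\<Sum>k\<in>T. real (y i) - real (y k))" for i
      have V1: "V y i = 0 \<or> V y i = 1" if "i \<in> T" for i
      proof -
        have "\<not> valley n y i" using W[of i] that y by (auto simp: T_def valleys_def)
        then have "V y i \<noteq> 2" using Vn_eq_2_iff[of i n y] that T by auto
        then show ?thesis using Vn_le_2[of n y i] by linarith
      qed
      have rt: "rt y i = b1 - (b1 - b0) * of_bool (V y i = 0)" if "i \<in> T" for i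
        using V1[OF that] by (auto simp: rate_def beta_def)
      have top: "y k \<le> y i" if "i \<in> T" "V y i = 0" "k \<in> T" for i k
        using y that by (auto simp: G_def not_less)
      have s0: "0 \<le> s i" if "i \<in> T" "V y i = 0" for i
        unfolding s_def using top[OF that] by (intro sum_nonneg) auto
      obtain i0 where i0: "i0 \<in> T" "\<And>k. k \<in> T \<Longrightarrow> y k \<le> y i0"
        using finite_obtain_maximizer[OF T(2,3), of y] by blast
      \<comment> \<open>Sites just outside the block are valleys, hence lower, so a maximum of the
        block is a local maximum of the whole configuration.\<close>
      have "V y i0 = 0"
      proof -
        have "y (i0 - 1) \<le> y i0" if "1 < i0"
        proof (cases "i0 = a")
          case True
          then have "a - 1 \<in> W" using ends that by auto
          then have "valley n y (a - 1)" using y by (auto simp: valleys_def)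
          then show ?thesis using True by (auto simp: valley_def)
        next
          case False
          then have "i0 - 1 \<in> T" using i0(1) unfolding T_def atLeastAtMost_iff by linarith
          then show ?thesis by (rule i0(2))
        qed
        moreover have "y (i0 + 1) \<le> y i0" if "i0 < n"
        proof (cases "i0 = b")
          case True
          then have "b + 1 \<in> W" using ends that by auto
          then have "valley n y (b + 1)" using y by (auto simp: valleys_def)
          then show ?thesis using True by (auto simp: valley_def)
        next
          case False
          then show ?thesis using i0 by (auto simp: T_def)
        qed
        moreover have "1 \<le> i0" "i0 \<le> n" using i0(1) T(1) by auto
        ultimately show ?thesis by (auto simp: Vn_eq)
      qed
      obtain i1 k1 where ik: "i1 \<in> T" "k1 \<in> T" "y k1 + C < y i1"
        using y by (auto simp: G_def not_le)
      have "real C \<le> real (y i0) - real (y k1)"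
        using i0(2)[OF ik(1)] ik(3) by linarith
      also have "\<dots> \<le> s i0"
        unfolding s_def by (rule member_le_sum) (use i0 ik T in auto)
      also have "\<dots> = of_bool (V y i0 = 0) * s i0" using \<open>V y i0 = 0\<close> by simp
      also have "\<dots> \<le> (\<Sum>i\<in>T. of_bool (V y i = 0) * s i)"
        by (rule member_le_sum) (use i0 T s0 in auto)
      finally have S: "real C \<le> (\<Sum>i\<in>T. of_bool (V y i = 0) * s i)" .
      \<comment> \<open>The common rate \<open>b1\<close> cancels because the differences sum to 0;
        only the slow top sites remain.\<close>
      have "(\<Sum>i\<in>T. rt y i * s i) = (\<Sum>i\<in>T. b1 * s i - (b1 - b0) * (of_bool (V y i = 0) * s i))"
        by (intro sum.cong refl) (simp add: rt algebra_simps)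
      also have "\<dots> = b1 * (\<Sum>i\<in>T. s i) - (b1 - b0) * (\<Sum>i\<in>T. of_bool (V y i = 0) * s i)"
        by (simp add: sum_subtractf sum_distrib_left)
      also have "(\<Sum>i\<in>T. s i) = 0" unfolding s_def by (rule sum_differences_zero)
      finally have "(\<Sum>i\<in>T. rt y i * s i) \<le> - ((b1 - b0) * real C)"
        using mult_left_mono[OF S, of "b1 - b0"] assms(1) by simp
      moreover have "(\<Sum>i\<in>T. rt y i) \<le> (\<Sum>i\<in>T. b1)"
        by (intro sum_mono) (use rt assms(1) in auto)
      then have "2 * (m - 1) * (\<Sum>i\<in>T. rt y i) \<le> 2 * m * (m * b1)"
        using T by (intro mult_mono) (auto simp: m_def Suc_le_eq card_gt_0_iff sum_nonneg rt_pos less_imp_le)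
      ultimately have "q y * (K Q y - Q y) \<le> - 1"
        using q_spread_drift[OF T(1), of y] C unfolding Q_def[abs_def] s_def[abs_def] m_def
        by (simp add: algebra_simps)
      then have "K Q y - Q y \<le> - 1 / q y" using q_pos[of y] by (simp add: field_simps)
      also have "\<dots> \<le> - 1 / (real n * bmax)"
        using q_le[of y] q_pos[of y] by (simp add: frac_le)
      finally show "K Q y \<le> Q y - 1 / (real n * bmax)" by simp
    qed
  next
    fix y assume y: "y \<in> {y. valleys n y = W}" "y \<in> G"
    show "\<exists>w. set w \<subseteq> {1..n} \<and> length w \<le> n + 1 + 2 * (C + 1) \<and> foldl bump y w \<notin> {y. valleys n y = W}"
    proof (cases "\<exists>i\<in>T. V y i = 0 \<and> (\<exists>k\<in>T. y i < y k)")
      case True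
      then obtain i k where ik: "i \<in> T" "V y i = 0" "k \<in> T" "y i < y k" by blast
      have in1: "1 \<le> i" "i \<le> n" "1 \<le> k" "k \<le> n" "i \<noteq> k" using ik T by auto
      \<comment> \<open>After the jump at \<open>i\<close>, its neighbour on the side of
        \<open>k\<close> is lower than both \<open>i\<close> and \<open>k\<close>, so a valley can
        be opened between them.\<close>
      have "\<exists>ws. set ws \<subseteq> {1..n} \<and> length ws \<le> n \<and> valleys n (foldl bump (bump y i) ws) \<noteq> W"
      proof (cases "i < k")
        case True
        have "y (i + 1) \<le> y i" using ik in1 True by (auto simp: Vn_eq)
        then have "i + 1 \<noteq> k" using ik by auto
        show ?thesis
          by (rule reach_new_valley[of i "i + 1" k])
            (use in1 True \<open>i + 1 \<noteq> k\<close> \<open>y (i + 1) \<le> y i\<close> ik W in \<open>auto simp: bump_apply T_def\<close>)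
      next
        case False
        then have "k < i" using in1 by simp
        then have "y (i - 1) \<le> y i" using ik in1 by (auto simp: Vn_eq)
        then have "i - 1 \<noteq> k" using ik by auto
        show ?thesis
          by (rule reach_new_valley[of k "i - 1" i])
            (use in1 \<open>k < i\<close> \<open>i - 1 \<noteq> k\<close> \<open>y (i - 1) \<le> y i\<close> ik W in \<open>auto simp: bump_apply T_def\<close>)
      qed
      then obtain ws where "set ws \<subseteq> {1..n}" "length ws \<le> n" "valleys n (foldl bump (bump y i) ws) \<noteq> W"
        by blast
      then show ?thesis using in1 by (intro exI[of _ "i # ws"]) auto
    next
      case False
      then have le: "\<And>i k. i \<in> T \<Longrightarrow> k \<in> T \<Longrightarrow> y i \<le> y k + C" using y by (auto simp: G_def)
      \<comment> \<open>Heights in the block differ by at most \<open>C\<close>, so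
        \<open>C + 1\<close> jumps on each side put \<open>a + 1\<close> strictly below its
        neighbours.\<close>
      define w where "w = replicate (C + 1) a @ replicate (C + 1) (a + 2)"
      have "valley n (foldl bump y w) (a + 1)"
        using le[of "a + 1" a] le[of "a + 1" "a + 2"] ab
        by (auto simp: valley_def foldl_bump_apply w_def T_def count_list_replicate)
      then have "valleys n (foldl bump y w) \<noteq> W" using W[of "a + 1"] ab by (auto simp: valleys_def)
      then show ?thesis using ab by (intro exI[of _ w]) (auto simp: w_def)
    qed
  qed
qed

text \<open>If the minimum of a block is attained on a plateau, then no site of the block has the high
  rate \<open>b2\<close> and the quadratic spread does not decrease on average. The term \<open>\<Theta>\<close> makes the plateau
  states expensive; it is lost as soon as one of the two plateau sites jumps.\<close>

lemma stay_three_without_peak_contracting: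
  assumes "b1 < b2" and ab: "1 < a" "a + 2 \<le> b" "b < n" and P: "\<And>i. i \<in> {a..b} \<Longrightarrow> i \<notin> P"
    and ends: "a - 1 \<in> P" "b + 1 \<in> P"
  shows "stay {y. peaks n y = P} y = 0"
proof -
  define T where "T = {a..b}"
  have T: "T \<subseteq> {1..n}" "finite T" "a \<in> T" using ab by (auto simp: T_def)
  define m where "m = real (card T)"
  have m1: "1 \<le> m" using T by (auto simp: m_def Suc_le_eq card_gt_0_iff)
  define cc where "cc = bmin / (real n * bmax)"
  have cc: "0 < cc" "cc \<le> 1" using c_pos c_le_1 by (auto simp: cc_def)
  \<comment> \<open>Half of the lower bound for the drift coefficient
    \<open>4 * (b2 - b1) / q y\<close>; the other half pays for a reappearing
    \<open>\<Theta>\<close>.\<close>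
  define \<kappa> where "\<kappa> = 2 * (b2 - b1) / (real n * bmax)"
  have \<kappa>: "0 < \<kappa>" using assms(1) bmax_pos n_ge by (simp add: \<kappa>_def)
  define E where "E = 2 * m * m * b2 / (real n * bmin)"
  have E0: "0 \<le> E" using m1 b_pos bmin_pos by (simp add: E_def)
  \<comment> \<open>Large enough for the weaker of the two gains, \<open>cc * \<kappa> * D\<close>,
    to outweigh every bounded term in both cases below.\<close>
  obtain C :: nat where C: "E + 2 * m + \<kappa> + 1 \<le> real C * (cc * \<kappa>)"
    using ex_less_of_nat_mult[of "cc * \<kappa>" "E + 2 * m + \<kappa> + 1"] cc \<kappa> by (auto intro: less_imp_le)
  \<comment> \<open>Outside \<open>G\<close> no site of the block has index 0, every valley in the
    block lies at its minimum, and the spread exceeds \<open>C\<close>.\<close>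
  define G where "G = {y :: nat \<Rightarrow> nat. (\<exists>i\<in>T. V y i = 0) \<or> (\<exists>i\<in>T. V y i = 2 \<and> (\<exists>k\<in>T. y k < y i)) \<or> (\<forall>i\<in>T. \<forall>k\<in>T. y i \<le> y k + C)}"
  define Q where "Q y = (\<Sum>i\<in>T. \<Sum>k\<in>T. (real (y i) - real (y k))\<^sup>2)" for y :: "nat \<Rightarrow> nat"
  define mn where "mn y = Min (y ` T)" for y :: "nat \<Rightarrow> nat"
  have mn_le: "mn y \<le> y k" if "k \<in> T" for y k using that T by (simp add: mn_def)
  have mn_att: "\<exists>k\<in>T. mn y = y k" for y
    using Min_in[of "y ` T"] T unfolding mn_def by blast
  define D where "D y = (\<Sum>k\<in>T. real (y k) - real (mn y))" for y
  have D0: "0 \<le> D y" for y unfolding D_def using mn_le by (intro sum_nonneg) auto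
  have D_bump: "D (bump y i) \<le> D y + 1" for y i
  proof -
    have "mn y \<le> mn (bump y i)"
      using mn_att[of "bump y i"] mn_le[of _ y] by (fastforce simp: bump_apply split: if_splits intro: le_SucI)
    then have "D (bump y i) \<le> (\<Sum>k\<in>T. (real (y k) - real (mn y)) + (if k = i then 1 else 0))"
      unfolding D_def by (intro sum_mono) (auto simp: bump_apply)
    also have "\<dots> \<le> D y + 1" using T by (simp add: sum.distrib D_def)
    finally show ?thesis .
  qed
  define \<Theta> where "\<Theta> y = (if \<exists>i\<in>T. V y i = 2 then 0 else \<kappa> * D y)" for y
  have \<Theta>_le: "\<Theta> (bump y i) \<le> \<kappa> * (D y + 1)" for y i
    using D_bump[of y i] \<kappa> D0[of y] by (auto simp: \<Theta>_def)
  have \<Theta>0: "0 \<le> \<Theta> y" for y using D0[of y] \<kappa> by (simp add: \<Theta>_def)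
  show ?thesis
  proof (rule stay_zero_two_stage[where G = G and L = "1 + (C + 1)"])
    show "stay ({y. peaks n y = P} - G) y = 0" for y
    proof (rule stay_zero_Foster[where f = "\<lambda>y. Q y + \<Theta> y" and \<epsilon> = 1])
      show "0 \<le> Q y + \<Theta> y" for y using \<Theta>0 by (auto simp: Q_def intro!: sum_nonneg add_nonneg_nonneg)
      fix y assume y: "y \<in> {y. peaks n y = P} - G"
      define s where "s i = (\<Sum>k\<in>T. real (y i) - real (y k))" for i
      have s_sum: "(\<Sum>i\<in>T. s i) = 0" unfolding s_def by (rule sum_differences_zero)
      have V1: "V y i = 1 \<or> V y i = 2" if "i \<in> T" for i
        using y that Vn_le_2[of n y i] by (fastforce simp: G_def)
      obtain i1 k1 where ik: "i1 \<in> T" "k1 \<in> T" "y k1 + C < y i1"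
        using y by (auto simp: G_def not_le)
      have DC: "real C \<le> D y"
      proof -
        have "real C \<le> real (y i1) - real (mn y)" using ik mn_le[OF ik(2), of y] by linarith
        also have "\<dots> \<le> D y" unfolding D_def by (rule member_le_sum) (use ik T mn_le in auto)
        finally show ?thesis .
      qed
      then have CD: "E + 2 * m + \<kappa> + 1 \<le> cc * \<kappa> * D y"
      proof -
        have "real C * (cc * \<kappa>) \<le> D y * (cc * \<kappa>)" using DC cc \<kappa> by (intro mult_right_mono) auto
        then show ?thesis using C by (simp add: mult.commute)
      qed
      have drift: "q y * (K Q y - Q y) = 4 * (\<Sum>i\<in>T. rt y i * s i) + 2 * (m - 1) * (\<Sum>i\<in>T. rt y i)"
        using q_spread_drift[OF T(1), of y] unfolding Q_def[abs_def] s_def[abs_def] m_def .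
      have "K (\<lambda>y. Q y + \<Theta> y) y - (Q y + \<Theta> y) \<le> - 1"
      proof (cases "\<exists>i\<in>T. V y i = 2")
        case True
        then obtain i0 where i0: "i0 \<in> T" "V y i0 = 2" by blast
        have rt: "rt y i = b1 + (b2 - b1) * of_bool (V y i = 2)" if "i \<in> T" for i
          using V1[OF that] by (auto simp: rate_def beta_def)
        \<comment> \<open>Every valley sits at the minimum of the block, so all of them contribute
          the same amount.\<close>
        have s2: "s i = - D y" if "i \<in> T" "V y i = 2" for i
        proof -
          have "y i \<le> y k" if "k \<in> T" for k
            using y \<open>i \<in> T\<close> \<open>V y i = 2\<close> that by (auto simp: G_def not_less)
          then have "y i = mn y" using mn_att[of y] mn_le[OF \<open>i \<in> T\<close>, of y] by (metis antisym)
          then show ?thesis unfolding s_def D_def by (simp flip: sum_negf)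
        qed
        have "(\<Sum>i\<in>T. rt y i * s i) = (\<Sum>i\<in>T. b1 * s i - (b2 - b1) * (of_bool (V y i = 2) * D y))"
          by (intro sum.cong refl) (auto simp: rt s2 algebra_simps)
        also have "\<dots> = b1 * (\<Sum>i\<in>T. s i) - (b2 - b1) * (\<Sum>i\<in>T. of_bool (V y i = 2) * D y)"
          by (simp add: sum_subtractf sum_distrib_left)
        also have "\<dots> \<le> b1 * (\<Sum>i\<in>T. s i) - (b2 - b1) * D y"
        proof -
          have "D y = of_bool (V y i0 = 2) * D y" using i0 by simp
          also have "\<dots> \<le> (\<Sum>i\<in>T. of_bool (V y i = 2) * D y)"
            by (rule member_le_sum) (use i0 T D0 in auto)
          finally show ?thesis using assms(1) by (simp add: mult_left_mono)
        qed
        finally have "(\<Sum>i\<in>T. rt y i * s i) \<le> - ((b2 - b1) * D y)" by (simp add: s_sum)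
        moreover have "(\<Sum>i\<in>T. rt y i) \<le> (\<Sum>i\<in>T. b2)"
          by (intro sum_mono) (use rt assms(1) in auto)
        then have "2 * (m - 1) * (\<Sum>i\<in>T. rt y i) \<le> 2 * m * (m * b2)"
          using m1 by (intro mult_mono) (auto simp: m_def sum_nonneg rt_pos less_imp_le)
        ultimately have "q y * (K Q y - Q y) \<le> 2 * m * m * b2 - 4 * (b2 - b1) * D y"
          unfolding drift by (simp add: algebra_simps)
        then have "K Q y - Q y \<le> (2 * m * m * b2 - 4 * (b2 - b1) * D y) / q y"
          using q_pos[of y] by (simp add: pos_le_divide_eq mult.commute)
        moreover have "\<dots> = 2 * m * m * b2 / q y - 4 * (b2 - b1) * D y / q y"
          by (simp add: diff_divide_distrib)
        moreover have "2 * m * m * b2 / q y \<le> E" unfolding E_def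
          using q_ge[of y] bmin_pos n_ge m1 b_pos by (intro divide_left_mono) (auto intro: mult_pos_pos q_pos)
        moreover have "2 * \<kappa> * D y \<le> 4 * (b2 - b1) * D y / q y"
        proof -
          have "4 * (b2 - b1) * D y / (real n * bmax) \<le> 4 * (b2 - b1) * D y / q y"
            using q_le[of y] q_pos[of y] assms(1) D0[of y] bmax_pos n_ge
            by (intro divide_left_mono) auto
          then show ?thesis by (simp add: \<kappa>_def)
        qed
        ultimately have "K Q y - Q y \<le> E - 2 * \<kappa> * D y" by linarith
        moreover have "K \<Theta> y \<le> \<kappa> * (D y + 1)" by (rule K_le) (rule \<Theta>_le)
        moreover have "\<Theta> y = 0" using True by (simp add: \<Theta>_def)
        moreover have "cc * \<kappa> * D y \<le> \<kappa> * D y"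
          using cc \<kappa> D0[of y] by (intro mult_right_mono) auto
        moreover have "\<kappa> * (D y + 1) = \<kappa> * D y + \<kappa>" by (simp add: algebra_simps)
        moreover have "K (\<lambda>y. Q y + \<Theta> y) y = K Q y + K \<Theta> y" by (rule K_add)
        ultimately show ?thesis using CD m1 \<kappa> by linarith
      next
        case False
        then have V1': "V y i = 1" if "i \<in> T" for i using V1[OF that] that by auto
        then have rt: "rt y i = b1" if "i \<in> T" for i using that by (simp add: rate_def beta_def)
        \<comment> \<open>With all rates equal to \<open>b1\<close> the first-order term vanishes,
          leaving a noise of at most \<open>2 * (m - 1)\<close> that the loss of
          \<open>\<Theta>\<close> must absorb.\<close>
        have "(\<Sum>i\<in>T. rt y i * s i) = b1 * (\<Sum>i\<in>T. s i)"
          unfolding sum_distrib_left by (intro sum.cong refl) (simp add: rt)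
        moreover have "(\<Sum>i\<in>T. rt y i) \<le> q y"
          unfolding total_rate_def using T rt_pos by (intro sum_mono2) (auto intro: less_imp_le)
        ultimately have "q y * (K Q y - Q y) \<le> 2 * (m - 1) * q y"
          unfolding drift s_sum using m1 by (simp add: mult_left_mono)
        then have KQ: "K Q y - Q y \<le> 2 * (m - 1)" using q_pos[of y] by (simp add: mult.commute)
        obtain z where z: "z \<in> T" "mn y = y z" using mn_att by blast
        have zn: "1 < z" "z < n" using z ab by (auto simp: T_def)
        have outer: "y a < y (a - 1)" "y b < y (b + 1)"
        proof -
          have "peak n y (a - 1)" "peak n y (b + 1)" using y ends by (auto simp: peaks_def)
          then show "y a < y (a - 1)" "y b < y (b + 1)" using ab by (auto simp: peak_def)
        qed
        \<comment> \<open>Site \<open>z'\<close> has index 1 and ties with \<open>z\<close>, so its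
          other neighbour is higher; raising \<open>z\<close> turns \<open>z'\<close> into a
          valley.\<close>
        have nb: "V (bump y z) z' = 2" if z': "z' \<in> T" "y z' = y z" "z' = z + 1 \<or> z = z' + 1" for z'
        proof -
          have z'n: "1 < z'" "z' < n" using z'(1) ab by (auto simp: T_def)
          have one: "y z' < y (z' - 1) \<or> y z' < y (z' + 1)"
          proof (rule ccontr)
            assume "\<not> (y z' < y (z' - 1) \<or> y z' < y (z' + 1))"
            then have "V y z' = 0" using Vn_eq[of z' n y] z'n by simp
            then show False using V1'[OF z'(1)] by simp
          qed
          from z'(3) have "valley n (bump y z) z'"
          proof
            assume e: "z' = z + 1"
            have "\<not> y z' < y (z' - 1)" using e z'(2) by simp
            then have "y z' < y (z' + 1)" using one by blast
            moreover have "bump y z z' = y z'" "bump y z (z' + 1) = y (z' + 1)"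
              "bump y z (z' - 1) = y z' + 1"
              using e z'(2) by (simp_all only: bump_apply) auto
            ultimately show ?thesis unfolding valley_def using z'n by linarith
          next
            assume e: "z = z' + 1"
            have "\<not> y z' < y (z' + 1)" unfolding e[symmetric] z'(2) by (rule less_irrefl)
            then have "y z' < y (z' - 1)" using one by blast
            moreover have "bump y z z' = y z'" "bump y z (z' - 1) = y (z' - 1)"
              using e z'n by (auto simp: bump_apply)
            moreover have "bump y z (z' + 1) = y z' + 1" unfolding e[symmetric] z'(2) by simp
            ultimately show ?thesis unfolding valley_def using z'n by linarith
          qed
          then show ?thesis using z'n Vn_eq_2_iff[of z' n "bump y z"] by simp
        qed
        \<comment> \<open>An isolated minimiser would have index 2, and the higher peaks outside the
          block keep the tied neighbour inside it.\<close>
        have "\<exists>z'\<in>T. y z' = y z \<and> (z' = z + 1 \<or> z = z' + 1)"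
        proof (cases "y z < y (z + 1)")
          case True
          then have "y (z - 1) \<le> y z" using V1'[OF z(1)] zn by (auto simp: Vn_eq split: if_splits)
          moreover from this have "z \<noteq> a" using outer by auto
          then have z1: "z - 1 \<in> T" using z(1) unfolding T_def atLeastAtMost_iff by linarith
          moreover have "z = z - 1 + 1" using zn by simp
          ultimately show ?thesis using mn_le[OF z1, of y] z(2) by (metis antisym)
        next
          case False
          then have "z \<noteq> b" using outer by auto
          then show ?thesis using False mn_le[of "z + 1" y] z
            by (intro bexI[of _ "z + 1"]) (auto simp: T_def)
        qed
        then obtain z' where "z' \<in> T" "V (bump y z) z' = 2" using nb by blast
        then have "\<Theta> (bump y z) = 0" by (auto simp: \<Theta>_def)
        have zI: "z \<in> {1..n}" using zn by simp
        \<comment> \<open>The jump at \<open>z\<close>, of probability at least \<open>cc\<close>,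
          erases \<open>\<Theta>\<close>; every other jump costs at most
          \<open>\<kappa> * (D y + 1)\<close>.\<close>
        have "K \<Theta> y = (\<Sum>i\<in>{1..n} - {z}. pr y i * \<Theta> (bump y i))"
          unfolding K_def using \<open>\<Theta> (bump y z) = 0\<close> zI by (simp add: sum.remove[of _ z])
        also have "\<dots> \<le> (\<Sum>i\<in>{1..n} - {z}. pr y i * (\<kappa> * (D y + 1)))"
          by (intro sum_mono mult_left_mono \<Theta>_le p_nonneg) auto
        also have "\<dots> = (1 - pr y z) * (\<kappa> * (D y + 1))"
        proof -
          have "(\<Sum>i\<in>{1..n} - {z}. pr y i) = 1 - pr y z"
            using p_sum[of y] zI by (simp add: sum.remove[of _ z])
          then show ?thesis by (metis sum_distrib_right)
        qed
        also have "\<dots> \<le> (1 - cc) * (\<kappa> * (D y + 1))"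
          using p_ge[OF zI, of y] \<kappa> D0[of y] by (intro mult_right_mono) (auto simp: cc_def)
        finally have K\<Theta>: "K \<Theta> y \<le> (1 - cc) * (\<kappa> * (D y + 1))" .
        define t where "t = cc * \<kappa> * D y"
        have \<Theta>y: "\<Theta> y = \<kappa> * D y" using False by (simp add: \<Theta>_def)
        have "(1 - cc) * (\<kappa> * (D y + 1)) = \<kappa> * D y - t + \<kappa> - cc * \<kappa>"
          by (simp add: algebra_simps t_def)
        then have K\<Theta>': "K \<Theta> y \<le> \<kappa> * D y - t + \<kappa> - cc * \<kappa>" using K\<Theta> by simp
        have pos: "0 \<le> cc * \<kappa>" using cc \<kappa> by simp
        have arith: "(kq + kt) - (qy + d) \<le> - 1"
          if "kq - qy \<le> 2 * (m - 1)" "kt \<le> d - t + \<kappa> - e" "0 \<le> e" "E + 2 * m + \<kappa> + 1 \<le> t"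
          for kq qy kt d e :: real using that E0 by argo
        show ?thesis unfolding K_add \<Theta>y by (rule arith[OF KQ K\<Theta>' pos CD[folded t_def]])
      qed
      then show "K (\<lambda>y. Q y + \<Theta> y) y \<le> Q y + \<Theta> y - 1" by simp
    qed simp
  next
    fix y assume y: "y \<in> {y. peaks n y = P}" "y \<in> G"
    have new: "foldl bump y w \<notin> {y. peaks n y = P}" if "peak n (foldl bump y w) v" "v \<in> T" for v w
      using that P[of v] by (auto simp: peaks_def T_def)
    consider i where "i \<in> T" "V y i = 0" | i k where "i \<in> T" "k \<in> T" "V y i = 2" "y k < y i"
      | "\<And>i k. i \<in> T \<Longrightarrow> k \<in> T \<Longrightarrow> y i \<le> y k + C" using y by (auto simp: G_def)
    then show "\<exists>w. set w \<subseteq> {1..n} \<and> length w \<le> 1 + (C + 1) \<and> foldl bump y w \<notin> {y. peaks n y = P}"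
    proof cases
      case (1 i)
      then have "peak n (foldl bump y [i]) i" using peak_bump_of_Vn_0[of i n y] T by auto
      then show ?thesis using new[of "[i]" i] 1 T by (intro exI[of _ "[i]"]) auto
    next
      case (2 i k)
      have in1: "1 < i" "i < n" "1 < k" "k < n" using 2 ab by (auto simp: T_def)
      then have i2: "y i < y (i - 1)" "y i < y (i + 1)"
        using 2 Vn_eq_2_iff[of i n y] by (auto simp: valley_def)
      define u where "u = min i k"
      define w where "w = max i k"
      have uw: "{u<..<w} \<subseteq> T" "{u, w} = {i, k}" "1 \<le> u" "w \<le> n"
        using 2 in1 by (auto simp: u_def w_def T_def min_def max_def)
      have "\<exists>x\<in>{u<..<w}. y i < y x"
      proof (cases "i < k")
        case True
        then have "i + 1 \<noteq> k" using i2 2 by auto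
        then show ?thesis using True i2 by (intro bexI[of _ "i + 1"]) (auto simp: u_def w_def)
      next
        case False
        moreover have "i \<noteq> k" using 2 by auto
        moreover have "i - 1 \<noteq> k" using i2 2 by auto
        ultimately show ?thesis using i2 by (intro bexI[of _ "i - 1"]) (auto simp: u_def w_def)
      qed
      then obtain x where x: "x \<in> {u<..<w}" "y i < y x" by blast
      \<comment> \<open>The highest site strictly between \<open>i\<close> and \<open>k\<close>
        exceeds both of them, so it is a weak local maximum and one jump makes it a peak.\<close>
      obtain v where v: "v \<in> {u<..<w}" "\<And>k. k \<in> {u<..<w} \<Longrightarrow> y k \<le> y v"
        using finite_obtain_maximizer[of "{u<..<w}" x y] x by blast
      have "y v' \<le> y v" if "v' = v - 1 \<or> v' = v + 1" for v'
      proof (cases "v' \<in> {u<..<w}")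
        case False
        then have "v' \<in> {u, w}" using v(1) that by auto
        then have "v' = i \<or> v' = k" using uw by auto
        then show ?thesis using v(2)[OF x(1)] x(2) 2 by auto
      qed (use v in auto)
      then have "peak n (foldl bump y [v]) v"
        using v(1) uw by (auto simp: peak_def bump_apply less_Suc_eq_le)
      then show ?thesis using new[of "[v]" v] v(1) uw T by (intro exI[of _ "[v]"]) auto
    next
      case 3
      define w where "w = replicate (C + 1) (a + 1)"
      have "peak n (foldl bump y w) (a + 1)"
        using 3[of a "a + 1"] 3[of "a + 2" "a + 1"] ab
        by (auto simp: peak_def foldl_bump_apply w_def T_def count_list_replicate)
      then show ?thesis using new[of w "a + 1"] ab by (intro exI[of _ w]) (auto simp: w_def T_def)
    qed
  qed
qed

end

subsection \<open>Laws of large numbers\<close>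

text \<open>Between consecutive squares the sequence moves by at most the sum of \<open>w\<close>,
  negligible against the square. A variable \<open>w\<close> admits unbounded increments, as the
  clocks have.\<close>

lemma tendsto_0_from_squares:
  fixes S w :: "nat \<Rightarrow> real"
  assumes inc: "\<And>k. \<bar>S (Suc k) - S k\<bar> \<le> w k"
    and sq: "(\<lambda>r. S (r\<^sup>2) / real (r\<^sup>2)) \<longlonglongrightarrow> 0"
    and gap: "(\<lambda>r. (\<Sum>i\<in>{r\<^sup>2..<(Suc r)\<^sup>2}. w i) / real (r\<^sup>2)) \<longlonglongrightarrow> 0"
  shows "(\<lambda>k. S k / real k) \<longlonglongrightarrow> 0"
proof -
  have w0: "0 \<le> w k" for k using inc[of k] by linarith
  have diff: "\<bar>S (k + l) - S k\<bar> \<le> (\<Sum>i\<in>{k..<k + l}. w i)" for k l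
  proof (induction l)
    case (Suc l)
    have "{k..<k + Suc l} = insert (k + l) {k..<k + l}" by auto
    then show ?case using Suc inc[of "k + l"] by simp
  qed auto
  define b where "b r = \<bar>S (r\<^sup>2) / real (r\<^sup>2)\<bar> + (\<Sum>i\<in>{r\<^sup>2..<(Suc r)\<^sup>2}. w i) / real (r\<^sup>2)" for r
  have b: "b \<longlonglongrightarrow> 0"
    unfolding b_def using tendsto_add[OF tendsto_rabs[OF sq] gap] by simp
  have lim: "filterlim floor_sqrt at_top sequentially"
    unfolding filterlim_at_top eventually_sequentially
    by (metis le_floor_sqrt_iff power2_nat_le_imp_le order_trans)
  have bound: "\<bar>S k / real k\<bar> \<le> b (floor_sqrt k)" if "k > 0" for k
  proof -
    define r where "r = floor_sqrt k"
    have r: "r > 0" "r\<^sup>2 \<le> k" "k < (Suc r)\<^sup>2"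
      using that Suc_floor_sqrt_power2_gt[of k] by (auto simp: r_def)
    have "\<bar>S k - S (r\<^sup>2)\<bar> \<le> (\<Sum>i\<in>{r\<^sup>2..<k}. w i)"
      using diff[of "r\<^sup>2" "k - r\<^sup>2"] r by simp
    also have "\<dots> \<le> (\<Sum>i\<in>{r\<^sup>2..<(Suc r)\<^sup>2}. w i)"
      using r w0 by (intro sum_mono2) auto
    finally have "\<bar>S k\<bar> \<le> \<bar>S (r\<^sup>2)\<bar> + (\<Sum>i\<in>{r\<^sup>2..<(Suc r)\<^sup>2}. w i)" by linarith
    then have "\<bar>S k\<bar> / real k \<le> (\<bar>S (r\<^sup>2)\<bar> + (\<Sum>i\<in>{r\<^sup>2..<(Suc r)\<^sup>2}. w i)) / real (r\<^sup>2)"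
      using r that by (intro frac_le) (auto intro!: add_nonneg_nonneg sum_nonneg w0 simp del: of_nat_power)
    then show ?thesis by (simp add: b_def r_def add_divide_distrib)
  qed
  show ?thesis
  proof (rule Lim_null_comparison)
    show "\<forall>\<^sub>F k in sequentially. norm (S k / real k) \<le> b (floor_sqrt k)"
      using bound by (auto simp: eventually_sequentially intro!: exI[of _ 1])
    show "(\<lambda>k. b (floor_sqrt k)) \<longlonglongrightarrow> 0" by (rule filterlim_compose[OF b lim])
  qed
qed

lemma gap_const_tendsto_0:
  "(\<lambda>r. (\<Sum>i\<in>{r\<^sup>2..<(Suc r)\<^sup>2}. a) / real (r\<^sup>2)) \<longlonglongrightarrow> (0::real)"
proof -
  have "(\<Sum>i\<in>{r\<^sup>2..<(Suc r)\<^sup>2}. a) / real (r\<^sup>2) = a * (2 * (1 / real r) + (1 / real r) * (1 / real r))" for r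
  proof (cases "r = 0")
    case False
    have "(Suc r)\<^sup>2 - r\<^sup>2 = 2 * r + 1" by (simp add: power2_eq_square)
    then show ?thesis using False by (simp add: power2_eq_square field_simps)
  qed simp
  moreover have "(\<lambda>r. a * (2 * (1 / real r) + (1 / real r) * (1 / real r))) \<longlonglongrightarrow> a * (2 * 0 + 0 * 0)"
    by (intro tendsto_intros lim_const_over_n)
  ultimately show ?thesis by simp
qed

text \<open>Along squares the second moment of the average is at most \<open>1 / r^2\<close>, which
  is summable; hence the squared averages have a finite sum almost surely and tend to 0.\<close>

lemma (in prob_space) AE_squares_tendsto_0:
  fixes S :: "nat \<Rightarrow> 'a \<Rightarrow> real"
  assumes int: "\<And>k. integrable M (\<lambda>\<omega>. (S k \<omega>)\<^sup>2)" and meas: "\<And>k. S k \<in> borel_measurable M"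
    and bd: "\<And>k. (\<integral>\<omega>. (S k \<omega>)\<^sup>2 \<partial>M) \<le> real k"
  shows "AE \<omega> in M. (\<lambda>r. S (r\<^sup>2) \<omega> / real (r\<^sup>2)) \<longlonglongrightarrow> 0"
proof -
  define f where "f r \<omega> = (S (r\<^sup>2) \<omega> / real (r\<^sup>2))\<^sup>2" for r \<omega>
  have f_meas: "f r \<in> borel_measurable M" for r unfolding f_def using meas by measurable
  have le: "(\<integral>\<^sup>+ \<omega>. ennreal (f r \<omega>) \<partial>M) \<le> ennreal (inverse (real r ^ 2))" for r
  proof -
    have i: "integrable M (f r)" unfolding f_def power_divide by (intro integrable_divide_zero int) 
    have "(\<integral>\<^sup>+ \<omega>. ennreal (f r \<omega>) \<partial>M) = ennreal (\<integral>\<omega>. f r \<omega> \<partial>M)"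
      by (rule nn_integral_eq_integral[OF i]) (auto simp: f_def)
    also have "(\<integral>\<omega>. f r \<omega> \<partial>M) = (\<integral>\<omega>. (S (r\<^sup>2) \<omega>)\<^sup>2 \<partial>M) / (real (r\<^sup>2))\<^sup>2"
      unfolding f_def power_divide by simp
    also have "\<dots> \<le> real (r\<^sup>2) / (real (r\<^sup>2))\<^sup>2" using bd[of "r\<^sup>2"] by (intro divide_right_mono) auto
    also have "\<dots> = inverse (real r ^ 2)" by (cases "r = 0") (auto simp: field_simps power2_eq_square)
    finally show ?thesis by (simp add: ennreal_leI)
  qed
  have "(\<integral>\<^sup>+ \<omega>. (\<Sum>r. ennreal (f r \<omega>)) \<partial>M) = (\<Sum>r. \<integral>\<^sup>+ \<omega>. ennreal (f r \<omega>) \<partial>M)"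
    using f_meas by (intro nn_integral_suminf) measurable
  also have "\<dots> \<le> (\<Sum>r. ennreal (inverse (real r ^ 2)))"
    by (intro suminf_le summableI le)
  finally have "(\<integral>\<^sup>+ \<omega>. (\<Sum>r. ennreal (f r \<omega>)) \<partial>M) \<le> (\<Sum>r. ennreal (inverse (real r ^ 2)))" .
  moreover have "(\<Sum>r. ennreal (inverse (real r ^ 2))) \<noteq> \<infinity>"
    using inverse_power_summable[of 2, where 'a = real]
    by (subst suminf_ennreal2) auto
  ultimately have "AE \<omega> in M. (\<Sum>r. ennreal (f r \<omega>)) \<noteq> \<infinity>"
    using f_meas by (intro nn_integral_noteq_infinite) (auto simp: top_unique)
  then show ?thesis
  proof (rule AE_mp, intro AE_I2 impI)
    fix \<omega> assume "(\<Sum>r. ennreal (f r \<omega>)) \<noteq> \<infinity>"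
    then have "summable (\<lambda>r. f r \<omega>)"
      by (intro summable_suminf_not_top) (auto simp: f_def)
    then have "(\<lambda>r. f r \<omega>) \<longlonglongrightarrow> 0" by (rule summable_LIMSEQ_zero)
    then have "(\<lambda>r. sqrt (f r \<omega>)) \<longlonglongrightarrow> sqrt 0" by (rule tendsto_real_sqrt)
    then have "(\<lambda>r. \<bar>S (r\<^sup>2) \<omega> / real (r\<^sup>2)\<bar>) \<longlonglongrightarrow> 0" by (simp add: f_def)
    then show "(\<lambda>r. S (r\<^sup>2) \<omega> / real (r\<^sup>2)) \<longlonglongrightarrow> 0" by (rule tendsto_rabs_zero_cancel)
  qed
qed

section \<open>Path weights and the martingale of compensated jumps\<close>

context finite_range_chain
begin

primrec weight :: "'s \<Rightarrow> 'i list \<Rightarrow> real" where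
  "weight y [] = 1"
| "weight y (i # w) = p y i * weight (act y i) w"

lemma EW_eq_sum: "EW k y F = (\<Sum>w | set w \<subseteq> I \<and> length w = k. weight y w * F w)"
proof (induction k arbitrary: y F)
  case (Suc k)
  have "(\<Sum>w | set w \<subseteq> I \<and> length w = Suc k. weight y w * F w)
     = (\<Sum>(w, i)\<in>{w. set w \<subseteq> I \<and> length w = k} \<times> I. weight y (i # w) * F (i # w))"
    unfolding lists_length_Suc_eq by (subst sum.reindex) (auto simp: inj_on_def case_prod_unfold)
  also have "\<dots> = (\<Sum>i\<in>I. \<Sum>w | set w \<subseteq> I \<and> length w = k. weight y (i # w) * F (i # w))"
    by (subst sum.cartesian_product[symmetric]) (rule sum.swap)
  also have "\<dots> = (\<Sum>i\<in>I. p y i * EW k (act y i) (\<lambda>w. F (i # w)))"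
    by (simp add: Suc sum_distrib_left mult.assoc)
  finally show ?case by simp
qed (simp add: sum.neutral_const cong: conj_cong)

lemma weight_eq_prod: "weight y w = (\<Prod>i<length w. p (foldl act y (take i w)) (w ! i))"
  by (induction w arbitrary: y) (simp_all add: prod.lessThan_Suc_shift del: prod.lessThan_Suc)

text \<open>Discrete stochastic integral of \<open>f\<close> against the jumps at \<open>j\<close>
  minus their conditional probabilities.\<close>

primrec compensated :: "('s \<Rightarrow> real) \<Rightarrow> 'i \<Rightarrow> 's \<Rightarrow> 'i list \<Rightarrow> real" where
  "compensated f j y [] = 0"
| "compensated f j y (i # w) = f y * (of_bool (i = j) - p y j) + compensated f j (act y i) w"

lemma compensated_snoc: "compensated f j y (w @ [i]) =
    compensated f j y w + f (foldl act y w) * (of_bool (i = j) - p (foldl act y w) j)"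
  by (induction w arbitrary: y) auto

lemma EW_compensated: "j \<in> I \<Longrightarrow> EW k y (compensated f j y) = 0"
proof (induction k arbitrary: y)
  case (Suc k)
  have "EW (Suc k) y (compensated f j y) = (\<Sum>i\<in>I. p y i * (f y * (of_bool (i = j) - p y j)))"
    using Suc by (simp add: EW_add)
  also have "\<dots> = f y * ((\<Sum>i\<in>I. p y i * of_bool (i = j)) - (\<Sum>i\<in>I. p y i) * p y j)"
    by (simp add: sum_distrib_left sum_distrib_right sum_subtractf algebra_simps)
  also have "(\<Sum>i\<in>I. p y i * of_bool (i = j)) = p y j"
    using finite_I Suc.prems by (simp add: of_bool_def if_distrib sum.delta cong: if_cong)
  finally show ?case by (simp add: p_sum)
qed simp

text \<open>Increments are orthogonal: the cross term vanishes because the remaining martingale has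
  mean 0 from every state, and each increment is at most 1 in absolute value.\<close>

lemma EW_compensated_square:
  assumes j: "j \<in> I" and f: "\<And>y. \<bar>f y\<bar> \<le> 1"
  shows "EW k y (\<lambda>w. (compensated f j y w)\<^sup>2) \<le> real k"
proof (induction k arbitrary: y)
  case (Suc k)
  have d: "(f y * (of_bool (i = j) - p y j))\<^sup>2 \<le> 1" for i
  proof -
    have "p y j \<le> 1" using member_le_sum[of j I "p y"] j p_nonneg finite_I by (simp add: p_sum)
    then have "\<bar>of_bool (i = j) - p y j\<bar> \<le> 1" using p_nonneg[OF j, of y] by (auto simp: of_bool_def)
    then have "\<bar>f y * (of_bool (i = j) - p y j)\<bar> \<le> 1"
      using f[of y] by (simp add: abs_mult mult_le_one)
    then show ?thesis by (simp add: abs_square_le_1)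
  qed
  have "EW (Suc k) y (\<lambda>w. (compensated f j y w)\<^sup>2)
     = (\<Sum>i\<in>I. p y i * EW k (act y i) (\<lambda>w. (f y * (of_bool (i = j) - p y j) + compensated f j (act y i) w)\<^sup>2))"
    by simp
  also have "\<dots> \<le> (\<Sum>i\<in>I. p y i * (1 + real k))"
  proof (intro sum_mono mult_left_mono p_nonneg)
    fix i assume "i \<in> I"
    define a where "a = f y * (of_bool (i = j) - p y j)"
    have "EW k (act y i) (\<lambda>w. (a + compensated f j (act y i) w)\<^sup>2)
      = EW k (act y i) (\<lambda>w. a\<^sup>2 + (2 * a * compensated f j (act y i) w + (compensated f j (act y i) w)\<^sup>2))"
      by (rule EW_cong) (simp add: power2_sum)
    also have "\<dots> = a\<^sup>2 + (2 * a * EW k (act y i) (compensated f j (act y i)) + EW k (act y i) (\<lambda>w. (compensated f j (act y i) w)\<^sup>2))"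
      by (simp only: EW_add EW_const EW_cmult)
    also have "\<dots> \<le> 1 + real k" using d[of i] Suc[of "act y i"] EW_compensated[OF j] by (simp add: a_def)
    finally show "EW k (act y i) (\<lambda>w. (f y * (of_bool (i = j) - p y j) + compensated f j (act y i) w)\<^sup>2) \<le> 1 + real k"
      by (simp add: a_def)
  qed
  also have "\<dots> = real (Suc k)" by (simp add: p_sum flip: sum_distrib_right)
  finally show ?case .
qed simp

end

section \<open>Choosing the jump site by cutting the unit interval\<close>

context crystal_model
begin

definition cum :: "(nat \<Rightarrow> nat) \<Rightarrow> nat \<Rightarrow> real" where "cum y j = (\<Sum>i=1..j. rt y i)"

lemma cum_Suc: "cum y (Suc j) = cum y j + rt y (Suc j)"
  by (simp add: cum_def)

lemma cum_mono: "i \<le> j \<Longrightarrow> cum y i \<le> cum y j"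
  by (rule lift_Suc_mono_le[of "cum y"]) (use rt_pos in \<open>auto simp: cum_Suc less_imp_le\<close>)

text \<open>Partial sums of the rates increase, so the least index passing the test is located by
  two consecutive sums. The first site has no lower bound and the last one takes the overflow, which
  makes this valid for every real \<open>u\<close>.\<close>

lemma choose_site_eq_iff:
  assumes "1 \<le> j" "j \<le> n"
  shows "choose_site b0 b1 b2 n y u = j \<longleftrightarrow>
    (j = 1 \<or> cum y (j - 1) < u * q y) \<and> (u * q y \<le> cum y j \<or> j = n)"
proof -
  define P where "P = (\<lambda>j. 1 \<le> j \<and> j \<le> n \<and> u * q y \<le> cum y j)"
  have ch: "choose_site b0 b1 b2 n y u = (if \<exists>j. P j then LEAST j. P j else n)"
    unfolding choose_site_def P_def cum_def ..
  have up: "P j" if "P i" "i \<le> j" "j \<le> n" for i j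
    using that cum_mono[of i j y] by (auto simp: P_def)
  show ?thesis
  proof (cases "\<exists>j. P j")
    case True
    define l where "l = (LEAST j. P j)"
    have l: "P l" "\<And>i. P i \<Longrightarrow> l \<le> i" using True by (auto simp: l_def intro: LeastI Least_le)
    have "l = j \<longleftrightarrow> P j \<and> (j = 1 \<or> \<not> P (j - 1))"
    proof
      assume "l = j"
      then show "P j \<and> (j = 1 \<or> \<not> P (j - 1))" using l(1) l(2)[of "j - 1"] assms by auto
    next
      assume a: "P j \<and> (j = 1 \<or> \<not> P (j - 1))"
      have "\<not> l < j"
      proof
        assume lt: "l < j"
        then have "P (j - 1)" using assms by (intro up[OF l(1)]) auto
        moreover have "1 \<le> l" using l(1) by (simp add: P_def)
        ultimately show False using a lt by auto
      qed
      then show "l = j" using l(2)[of j] a by simp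
    qed
    moreover have "P n" using up[OF l(1), of n] l(1) by (auto simp: P_def)
    then have "P j \<longleftrightarrow> u * q y \<le> cum y j \<or> j = n" using assms by (auto simp: P_def)
    moreover have "(j = 1 \<or> \<not> P (j - 1)) \<longleftrightarrow> (j = 1 \<or> cum y (j - 1) < u * q y)"
      using assms by (auto simp: P_def not_le)
    moreover have "choose_site b0 b1 b2 n y u = l" using ch True by (simp add: l_def)
    ultimately show ?thesis by blast
  next
    case False
    then have lt: "cum y i < u * q y" if "1 \<le> i" "i \<le> n" for i
      using that unfolding P_def by (meson not_le)
    have "choose_site b0 b1 b2 n y u = n" using ch False by simp
    moreover have "\<not> u * q y \<le> cum y j" using lt[OF assms] by simp
    moreover have "j = 1 \<or> cum y (j - 1) < u * q y" using lt[of "j - 1"] assms by fastforce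
    ultimately show ?thesis by auto
  qed
qed

lemma choose_site_range: "choose_site b0 b1 b2 n y u \<in> {1..n}"
proof -
  define P where "P = (\<lambda>j. 1 \<le> j \<and> j \<le> n \<and> u * q y \<le> (\<Sum>i=1..j. rt y i))"
  have ch: "choose_site b0 b1 b2 n y u = (if \<exists>j. P j then LEAST j. P j else n)"
    unfolding choose_site_def P_def ..
  show ?thesis
  proof (cases "\<exists>j. P j")
    case True
    then have "P (LEAST j. P j)" by (auto intro: LeastI)
    then show ?thesis using ch True by (auto simp: P_def)
  qed (use ch n_ge in auto)
qed

lemma choose_site_borel: "1 \<le> j \<Longrightarrow> j \<le> n \<Longrightarrow> {u. choose_site b0 b1 b2 n y u = j} \<in> sets borel"
  by (simp add: choose_site_eq_iff)

text \<open>Within the unit interval the event is an interval of length \<open>pr y j\<close> up to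
  endpoints; the sandwich avoids deciding which endpoints belong to it.\<close>

lemma measure_choose_site:
  assumes "1 \<le> j" "j \<le> n"
  shows "measure (uniform_measure lborel {0..1}) {u. choose_site b0 b1 b2 n y u = j} = pr y j"
proof -
  define S where "S = {u. choose_site b0 b1 b2 n y u = j}"
  define l where "l = cum y (j - 1) / q y"
  define r where "r = cum y j / q y"
  have qn: "cum y n = q y" by (simp add: cum_def total_rate_def)
  have lr: "0 \<le> l" "r \<le> 1" "l \<le> r" "r - l = pr y j"
  proof -
    show "0 \<le> l" using cum_mono[of 0 "j - 1" y] q_pos[of y] by (simp add: l_def cum_def)
    show "r \<le> 1" using cum_mono[of j n y] q_pos[of y] assms by (simp add: r_def qn)
    show "l \<le> r" using cum_mono[of "j - 1" j y] q_pos[of y] by (simp add: l_def r_def divide_right_mono)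
    show "r - l = pr y j" using cum_Suc[of y "j - 1"] assms
      by (simp add: l_def r_def pr_def flip: diff_divide_distrib)
  qed
  have iff: "u \<in> S \<longleftrightarrow> (j = 1 \<or> l < u) \<and> (u \<le> r \<or> j = n)" for u
    unfolding S_def mem_Collect_eq choose_site_eq_iff[OF assms] l_def r_def
    using q_pos[of y] by (simp add: pos_divide_less_eq pos_le_divide_eq)
  have rn: "j = n \<Longrightarrow> r = 1" using q_pos[of y] qn by (simp add: r_def)
  have l1: "j = 1 \<Longrightarrow> l = 0" by (simp add: l_def cum_def)
  have S_meas: "S \<in> sets borel" unfolding S_def by (rule choose_site_borel[OF assms])
  have "{l<..r} \<subseteq> {0..1} \<inter> S" "{0..1} \<inter> S \<subseteq> {l..r}" using lr rn l1 by (auto simp: iff)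
  then have "emeasure lborel {l<..r} \<le> emeasure lborel ({0..1} \<inter> S)"
    "emeasure lborel ({0..1} \<inter> S) \<le> emeasure lborel {l..r}"
    using S_meas by (auto intro!: emeasure_mono)
  then have "emeasure lborel ({0..1} \<inter> S) = ennreal (r - l)" using lr by simp
  then have "emeasure (uniform_measure lborel {0..1}) S = ennreal (r - l)"
    using S_meas by (simp add: emeasure_uniform_measure divide_ennreal_def)
  then show ?thesis using lr S_def by (simp add: measure_def)
qed

end

subsection \<open>The crystal process\<close>

locale crystal_process = crystal_model b0 b1 b2 n + prob_space M
  for b0 b1 b2 :: real and n :: nat and M :: "'a measure" +
  fixes E U :: "nat \<Rightarrow> 'a \<Rightarrow> real" and x :: "nat \<Rightarrow> nat"
  assumes E_exp: "\<And>k. distributed M lborel (E k) (exponential_density 1)"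
    and U_meas: "\<And>k. U k \<in> borel_measurable M"
    and U_unif: "\<And>k. distr M lborel (U k) = uniform_measure lborel {0..1}"
    and EU_indep: "indep_vars (\<lambda>_. borel) (\<lambda>i. case i of Inl k \<Rightarrow> E k | Inr k \<Rightarrow> U k) UNIV"
begin

definition Y :: "nat \<Rightarrow> 'a \<Rightarrow> nat \<Rightarrow> nat" where
  "Y k \<omega> = jump_chain b0 b1 b2 n x (\<lambda>k. U k \<omega>) k"

definition J :: "nat \<Rightarrow> 'a \<Rightarrow> nat" where
  "J k \<omega> = choose_site b0 b1 b2 n (Y k \<omega>) (U k \<omega>)"

text \<open>The chosen sites up to step \<open>k\<close>; together with \<open>x\<close> this word
  determines the whole jump chain up to that time.\<close>

definition wd :: "nat \<Rightarrow> 'a \<Rightarrow> nat list" where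
  "wd k \<omega> = map (\<lambda>i. J i \<omega>) [0..<k]"

lemma Y_0 [simp]: "Y 0 \<omega> = x"
  by (simp add: Y_def)

lemma Y_Suc: "Y (Suc k) \<omega> = bump (Y k \<omega>) (J k \<omega>)"
  by (simp add: Y_def J_def Let_def bump_def)

lemma J_range: "J k \<omega> \<in> {1..n}"
  unfolding J_def by (rule choose_site_range)

lemma wd_0 [simp]: "wd 0 \<omega> = []"
  by (simp add: wd_def)

lemma wd_Suc: "wd (Suc k) \<omega> = wd k \<omega> @ [J k \<omega>]"
  by (simp add: wd_def)

lemma length_wd [simp]: "length (wd k \<omega>) = k"
  by (simp add: wd_def)

lemma set_wd: "set (wd k \<omega>) \<subseteq> {1..n}"
  using J_range by (auto simp: wd_def)

lemma take_wd: "i \<le> k \<Longrightarrow> take i (wd k \<omega>) = wd i \<omega>"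
  by (simp add: wd_def take_map)

lemma Y_foldl: "Y k \<omega> = foldl bump x (wd k \<omega>)"
  by (induction k) (auto simp: Y_Suc wd_Suc)

text \<open>Once the word is prescribed the intermediate states are deterministic, so the event
  becomes a conjunction of conditions on the separate variables \<open>U i\<close>, to which
  independence applies.\<close>

lemma wd_eq_iff:
  assumes "length w = k"
  shows "wd k \<omega> = w \<longleftrightarrow> (\<forall>i<k. choose_site b0 b1 b2 n (foldl bump x (take i w)) (U i \<omega>) = w ! i)"
proof
  assume w: "wd k \<omega> = w"
  show "\<forall>i<k. choose_site b0 b1 b2 n (foldl bump x (take i w)) (U i \<omega>) = w ! i"
  proof (intro allI impI)
    fix i assume "i < k"
    then have "foldl bump x (take i w) = Y i \<omega>" "w ! i = J i \<omega>"
      unfolding w[symmetric] by (simp_all add: take_wd Y_foldl) (simp add: wd_def)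
    then show "choose_site b0 b1 b2 n (foldl bump x (take i w)) (U i \<omega>) = w ! i" by (simp add: J_def)
  qed
next
  assume *: "\<forall>i<k. choose_site b0 b1 b2 n (foldl bump x (take i w)) (U i \<omega>) = w ! i"
  have "wd i \<omega> = take i w" if "i \<le> k" for i using that
  proof (induction i)
    case (Suc i)
    then have IH: "wd i \<omega> = take i w" by simp
    have "J i \<omega> = w ! i" using * Suc.prems unfolding J_def Y_foldl IH by simp
    then show ?case using Suc.prems assms by (simp add: wd_Suc IH take_Suc_conv_app_nth)
  qed simp
  from this[of k] show "wd k \<omega> = w" using assms by simp
qed

lemma E_meas: "E k \<in> borel_measurable M"
  using distributed_measurable[OF E_exp, of k] by simp

lemma prob_choose:
  assumes "j \<in> {1..n}"
  shows "(\<integral>\<omega>. indicator {u. choose_site b0 b1 b2 n y u = j} (U k \<omega>) \<partial>M) = pr y j"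
proof -
  let ?S = "{u. choose_site b0 b1 b2 n y u = j}"
  have S: "?S \<in> sets borel" using assms by (intro choose_site_borel) auto
  have U': "U k \<in> measurable M lborel" using U_meas[of k] by simp
  have "(\<integral>\<omega>. indicator ?S (U k \<omega>) \<partial>M) = (\<integral>u. indicator ?S u \<partial>distr M lborel (U k) :: real)"
    by (rule integral_distr[symmetric, OF U']) (use S in simp)
  also have "\<dots> = measure (distr M lborel (U k)) ?S"
    using S by (subst Bochner_Integration.integral_indicator) simp_all
  also have "\<dots> = measure (uniform_measure lborel {0..1}) ?S" by (simp only: U_unif)
  also have "\<dots> = pr y j" using assms by (intro measure_choose_site) auto
  finally show ?thesis .
qed

text \<open>The event of one fixed word imposes separate conditions on the \<open>U i\<close> and
  the other factors involve separate clocks, so the expectation factorises; the choice probabilities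
  multiply to \<open>weight x w\<close>.\<close>

lemma word_times_clocks:
  fixes \<phi> :: "nat \<Rightarrow> real \<Rightarrow> real"
  assumes w: "set w \<subseteq> {1..n}" "length w = k" and L: "finite L"
    and \<phi>: "\<And>l. \<phi> l \<in> borel_measurable borel" "\<And>l. integrable M (\<lambda>\<omega>. \<phi> l (E l \<omega>))"
  shows "integrable M (\<lambda>\<omega>. of_bool (wd k \<omega> = w) * (\<Prod>l\<in>L. \<phi> l (E l \<omega>)))"
    and "(\<integral>\<omega>. of_bool (wd k \<omega> = w) * (\<Prod>l\<in>L. \<phi> l (E l \<omega>)) \<partial>M)
      = weight x w * (\<Prod>l\<in>L. \<integral>\<omega>. \<phi> l (E l \<omega>) \<partial>M)"
proof -
  define S where "S i = {u. choose_site b0 b1 b2 n (foldl bump x (take i w)) u = w ! i}" for i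
  define T where "T = Inl ` L \<union> (Inr ` {..<k} :: (nat + nat) set)"
  \<comment> \<open>Beyond \<open>k\<close> the zero function is a placeholder that keeps every
    \<open>G s\<close> measurable, as \<open>w ! i\<close> is known to be a site only for
    \<open>i < k\<close>.\<close>
  define G :: "nat + nat \<Rightarrow> real \<Rightarrow> real" where
    "G s = (case s of Inl l \<Rightarrow> \<phi> l | Inr i \<Rightarrow> if i < k then indicator (S i) else (\<lambda>_. 0))" for s
  define X where "X s = (\<lambda>\<omega>. G s ((case s of Inl k \<Rightarrow> E k | Inr k \<Rightarrow> U k) \<omega>))" for s
  have wi: "w ! i \<in> {1..n}" if "i < k" for i using w that nth_mem by blast
  have S: "S i \<in> sets borel" if "i < k" for i
    unfolding S_def using wi[OF that] by (intro choose_site_borel) auto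
  have G: "G s \<in> borel_measurable borel" for s
    using \<phi>(1) S by (cases s) (auto simp: G_def)
  have T: "finite T" using L by (simp add: T_def)
  have ind: "indep_vars (\<lambda>_. borel) X T"
    unfolding X_def by (rule indep_vars_subset[OF indep_vars_compose2[OF EU_indep]]) (use G in auto)
  have int: "integrable M (X s)" if "s \<in> T" for s
  proof (cases s)
    case (Inl l)
    then show ?thesis using \<phi>(2) by (simp add: X_def G_def)
  next
    case (Inr i)
    have "(\<lambda>\<omega>. indicator (S i) (U i \<omega>) :: real) \<in> borel_measurable M" if "i < k"
      using S[OF that] U_meas[of i] by measurable
    then show ?thesis using Inr
      by (auto simp: X_def G_def intro!: integrable_const_bound[of _ 1] split: split_indicator)
  qed
  have split: "(\<Prod>s\<in>T. f s) = (\<Prod>i<k. f (Inr i)) * (\<Prod>l\<in>L. f (Inl l))" for f :: "nat + nat \<Rightarrow> real"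
    unfolding T_def using L
    by (subst prod.union_disjoint) (auto simp: prod.reindex mult.commute)
  have X_eq: "(\<Prod>s\<in>T. X s \<omega>) = of_bool (wd k \<omega> = w) * (\<Prod>l\<in>L. \<phi> l (E l \<omega>))" for \<omega>
  proof -
    have "(\<Prod>i<k. X (Inr i) \<omega>) = (\<Prod>i<k. of_bool (U i \<omega> \<in> S i))"
      by (intro prod.cong) (auto simp: X_def G_def indicator_def)
    also have "\<dots> = of_bool (\<forall>i<k. U i \<omega> \<in> S i)" by (induction k) (auto simp: less_Suc_eq)
    also have "(\<forall>i<k. U i \<omega> \<in> S i) \<longleftrightarrow> wd k \<omega> = w"
      unfolding wd_eq_iff[OF w(2)] by (simp add: S_def)
    finally show ?thesis unfolding split by (simp add: X_def G_def)
  qed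
  show "integrable M (\<lambda>\<omega>. of_bool (wd k \<omega> = w) * (\<Prod>l\<in>L. \<phi> l (E l \<omega>)))"
    using indep_vars_integrable[OF T ind int] by (simp add: X_eq)
  have "(\<integral>\<omega>. (\<Prod>s\<in>T. X s \<omega>) \<partial>M) = (\<Prod>s\<in>T. \<integral>\<omega>. X s \<omega> \<partial>M)"
    by (rule indep_vars_lebesgue_integral[OF T ind int])
  also have "\<dots> = (\<Prod>i<k. \<integral>\<omega>. X (Inr i) \<omega> \<partial>M) * (\<Prod>l\<in>L. \<integral>\<omega>. \<phi> l (E l \<omega>) \<partial>M)"
    unfolding split by (simp add: X_def G_def)
  also have "(\<Prod>i<k. \<integral>\<omega>. X (Inr i) \<omega> \<partial>M) = weight x w"
    unfolding weight_eq_prod w(2)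
  proof (intro prod.cong refl)
    fix i assume "i \<in> {..<k}"
    then show "(\<integral>\<omega>. X (Inr i) \<omega> \<partial>M) = pr (foldl bump x (take i w)) (w ! i)"
      using prob_choose[OF wi, of i "foldl bump x (take i w)" i] by (simp add: X_def G_def S_def)
  qed
  finally show "(\<integral>\<omega>. of_bool (wd k \<omega> = w) * (\<Prod>l\<in>L. \<phi> l (E l \<omega>)) \<partial>M)
      = weight x w * (\<Prod>l\<in>L. \<integral>\<omega>. \<phi> l (E l \<omega>) \<partial>M)" by (simp add: X_eq)
qed

lemma word_function_times_clocks:
  fixes \<phi> :: "nat \<Rightarrow> real \<Rightarrow> real" and F :: "nat list \<Rightarrow> real"
  assumes L: "finite L"
    and \<phi>: "\<And>l. \<phi> l \<in> borel_measurable borel" "\<And>l. integrable M (\<lambda>\<omega>. \<phi> l (E l \<omega>))"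
  shows "integrable M (\<lambda>\<omega>. F (wd k \<omega>) * (\<Prod>l\<in>L. \<phi> l (E l \<omega>)))"
    and "(\<integral>\<omega>. F (wd k \<omega>) * (\<Prod>l\<in>L. \<phi> l (E l \<omega>)) \<partial>M)
      = EW k x F * (\<Prod>l\<in>L. \<integral>\<omega>. \<phi> l (E l \<omega>) \<partial>M)"
proof -
  define Ws where "Ws = {w. set w \<subseteq> {1..n} \<and> length w = k}"
  have fin: "finite Ws" unfolding Ws_def by (rule finite_lists_length_eq) simp
  let ?g = "\<lambda>w \<omega>. of_bool (wd k \<omega> = w) * (\<Prod>l\<in>L. \<phi> l (E l \<omega>))"
  have eq: "F (wd k \<omega>) * (\<Prod>l\<in>L. \<phi> l (E l \<omega>)) = (\<Sum>w\<in>Ws. F w * ?g w \<omega>)" for \<omega>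
  proof -
    have "(\<Sum>w\<in>Ws. F w * ?g w \<omega>) = (\<Sum>w\<in>Ws. if w = wd k \<omega> then F w * (\<Prod>l\<in>L. \<phi> l (E l \<omega>)) else 0)"
      by (intro sum.cong) auto
    also have "\<dots> = F (wd k \<omega>) * (\<Prod>l\<in>L. \<phi> l (E l \<omega>))"
      using fin set_wd[of k \<omega>] by (simp add: Ws_def)
    finally show ?thesis by simp
  qed
  have int: "integrable M (?g w)" if "w \<in> Ws" for w
    by (rule word_times_clocks(1)) (use that L \<phi> in \<open>auto simp: Ws_def\<close>)
  show "integrable M (\<lambda>\<omega>. F (wd k \<omega>) * (\<Prod>l\<in>L. \<phi> l (E l \<omega>)))"
    unfolding eq using int by auto
  have "(\<integral>\<omega>. (\<Sum>w\<in>Ws. F w * ?g w \<omega>) \<partial>M) = (\<Sum>w\<in>Ws. \<integral>\<omega>. F w * ?g w \<omega> \<partial>M)"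
    by (intro Bochner_Integration.integral_sum integrable_mult_right int)
  also have "\<dots> = (\<Sum>w\<in>Ws. F w * (weight x w * (\<Prod>l\<in>L. \<integral>\<omega>. \<phi> l (E l \<omega>) \<partial>M)))"
  proof (intro sum.cong refl)
    fix w assume "w \<in> Ws"
    then have "(\<integral>\<omega>. ?g w \<omega> \<partial>M) = weight x w * (\<Prod>l\<in>L. \<integral>\<omega>. \<phi> l (E l \<omega>) \<partial>M)"
      by (intro word_times_clocks(2)) (use L \<phi> in \<open>auto simp: Ws_def\<close>)
    then show "(\<integral>\<omega>. F w * ?g w \<omega> \<partial>M) = F w * (weight x w * (\<Prod>l\<in>L. \<integral>\<omega>. \<phi> l (E l \<omega>) \<partial>M))"
      by simp
  qed
  also have "\<dots> = EW k x F * (\<Prod>l\<in>L. \<integral>\<omega>. \<phi> l (E l \<omega>) \<partial>M)"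
    unfolding EW_eq_sum Ws_def by (simp add: sum_distrib_left mult_ac)
  finally show "(\<integral>\<omega>. F (wd k \<omega>) * (\<Prod>l\<in>L. \<phi> l (E l \<omega>)) \<partial>M)
      = EW k x F * (\<Prod>l\<in>L. \<integral>\<omega>. \<phi> l (E l \<omega>) \<partial>M)" unfolding eq .
qed

lemma integrable_wd: "integrable M (\<lambda>\<omega>. F (wd k \<omega>) :: real)"
proof -
  have "integrable M (\<lambda>\<omega>. F (wd k \<omega>) * (\<Prod>l\<in>{}. (\<lambda>_ _. 0) l (E l \<omega>)))"
    by (rule word_function_times_clocks(1)) auto
  then show ?thesis by (simp only: prod.empty mult_1_right)
qed

lemma integral_wd: "(\<integral>\<omega>. F (wd k \<omega>) \<partial>M) = EW k x F"
proof -
  have "(\<integral>\<omega>. F (wd k \<omega>) * (\<Prod>l\<in>{}. (\<lambda>_ _. 0) l (E l \<omega>)) \<partial>M)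
      = EW k x F * (\<Prod>l\<in>{}. \<integral>\<omega>. (\<lambda>_ _. 0) l (E l \<omega>) \<partial>M)"
    by (rule word_function_times_clocks(2)) auto
  then show ?thesis by (simp only: prod.empty mult_1_right)
qed

lemma wd_events: "{\<omega> \<in> space M. P (wd k \<omega>)} \<in> events"
proof -
  have "(\<lambda>\<omega>. of_bool (P (wd k \<omega>)) :: real) \<in> borel_measurable M"
    using integrable_wd[of "\<lambda>w. of_bool (P w)" k] by simp
  then have "{\<omega> \<in> space M. (of_bool (P (wd k \<omega>)) :: real) = 1} \<in> events" by measurable
  then show ?thesis by simp
qed

lemma prob_wd: "prob {\<omega> \<in> space M. P (wd k \<omega>)} = EW k x (\<lambda>w. of_bool (P w))"
proof -
  have "EW k x (\<lambda>w. of_bool (P w)) = (\<integral>\<omega>. indicator {\<omega> \<in> space M. P (wd k \<omega>)} \<omega> \<partial>M)"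
    unfolding integral_wd[symmetric] by (intro Bochner_Integration.integral_cong) (auto simp: indicator_def)
  then show ?thesis using wd_events[of P k] by simp
qed

text \<open>The number of exits has a geometric tail uniform in the horizon, so it is almost surely
  finite. After the last exit, a chain that is in the set stays there.\<close>

lemma AE_eventually_constant:
  assumes "\<exists>d>0. d \<le> 1 \<and> (\<forall>y k. P y \<longrightarrow> d \<le> surv {y. P y} k y)"
  shows "AE \<omega> in M. (\<forall>\<^sub>F k in sequentially. P (Y k \<omega>)) \<or> (\<forall>\<^sub>F k in sequentially. \<not> P (Y k \<omega>))"
proof -
  define B where "B = {y. P y}"
  obtain d where d: "0 < d" "d \<le> 1" and surv: "\<And>y k. y \<in> B \<Longrightarrow> d \<le> surv B k y"
    using assms by (auto simp: B_def)
  define N where "N m k = {\<omega> \<in> space M. m \<le> exits B x (wd k \<omega>)}" for m k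
  have N: "N m k \<in> events" for m k unfolding N_def by (rule wd_events)
  have mono: "exits B x (wd k \<omega>) \<le> exits B x (wd l \<omega>)" if "k \<le> l" for k l \<omega>
    by (rule lift_Suc_mono_le[of "\<lambda>k. exits B x (wd k \<omega>)", OF _ that]) (simp add: wd_Suc exits_snoc)
  have le: "prob (\<Union>k. N m k) \<le> (1 - d) ^ m" for m
  proof (rule LIMSEQ_le_const2)
    show "(\<lambda>k. prob (N m k)) \<longlonglongrightarrow> prob (\<Union>k. N m k)"
    proof (rule finite_Lim_measure_incseq)
      show "incseq (N m)" using mono by (auto simp: incseq_def N_def intro: order_trans)
    qed (use N in auto)
    have "prob (N m k) \<le> (1 - d) ^ m" for k
      unfolding N_def by (subst prob_wd) (rule EW_exits_le[OF less_imp_le[OF d(1)] d(2) surv])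
    then show "\<exists>N'. \<forall>k\<ge>N'. prob (N m k) \<le> (1 - d) ^ m" by blast
  qed
  \<comment> \<open>The event of infinitely many exits.\<close>
  define Z where "Z = (\<Inter>m. \<Union>k. N m k)"
  have Z: "Z \<in> events" unfolding Z_def using N by auto
  have "prob Z \<le> (1 - d) ^ m" for m
    using finite_measure_mono[of Z "\<Union>k. N m k"] le[of m] N by (auto simp: Z_def intro: order_trans)
  moreover have "(\<lambda>m. (1 - d) ^ m) \<longlonglongrightarrow> 0" using d by (intro LIMSEQ_realpow_zero) auto
  ultimately have "prob Z \<le> 0" by (intro LIMSEQ_le_const) auto
  then have "emeasure M Z = 0" using measure_nonneg[of M Z] by (simp add: emeasure_eq_measure)
  then have "AE \<omega> in M. \<omega> \<notin> Z" using Z by (intro AE_not_in) (auto simp: null_sets_def)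
  then show ?thesis
  proof (rule AE_mp, intro AE_I2 impI)
    fix \<omega> assume \<omega>: "\<omega> \<in> space M" "\<omega> \<notin> Z"
    then obtain m where m: "\<And>k. exits B x (wd k \<omega>) < m" by (auto simp: Z_def N_def not_le)
    define ex where "ex k = exits B x (wd k \<omega>)" for k
    have "range ex \<subseteq> {..<m}" unfolding ex_def using m by blast
    then have "finite (range ex)" by (rule finite_subset) simp
    then have "Max (range ex) \<in> range ex" by (intro Max_in) auto
    then obtain K where "Max (range ex) = ex K" by blast
    then have K: "ex k \<le> ex K" for k using \<open>finite (range ex)\<close> by (metis Max_ge rangeI)
    have const: "ex k = ex K" if "k \<ge> K" for k using K[of k] mono[OF that, of \<omega>] by (simp add: ex_def)
    have noexit: "Y (Suc k) \<omega> \<in> B" if "k \<ge> K" "Y k \<omega> \<in> B" for k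
      using const[of k] const[of "Suc k"] that
      by (auto simp: ex_def wd_Suc exits_snoc Y_Suc simp flip: Y_foldl split: if_splits)
    show "(\<forall>\<^sub>F k in sequentially. P (Y k \<omega>)) \<or> (\<forall>\<^sub>F k in sequentially. \<not> P (Y k \<omega>))"
    proof (cases "\<exists>k0\<ge>K. Y k0 \<omega> \<in> B")
      case True
      then obtain k0 where k0: "k0 \<ge> K" "Y k0 \<omega> \<in> B" by blast
      have "Y k \<omega> \<in> B" if "k \<ge> k0" for k using that
        by (induction k rule: dec_induct) (use k0 noexit in auto)
      then show ?thesis by (auto simp: eventually_sequentially B_def)
    next
      case False
      then show ?thesis by (auto simp: eventually_sequentially B_def)
    qed
  qed
qed

text \<open>Splitting the word at \<open>k0\<close> turns staying in \<open>A\<close> from then on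
  into \<open>stay A\<close> averaged over the state reached; countably many \<open>k0\<close> are
  then combined.\<close>

lemma AE_not_eventually_in:
  assumes "\<And>y. stay A y = 0"
  shows "AE \<omega> in M. \<not> (\<forall>\<^sub>F k in sequentially. Y k \<omega> \<in> A)"
proof -
  have "AE \<omega> in M. \<not> (\<forall>k\<ge>k0. Y k \<omega> \<in> A)" for k0
  proof -
    define N where "N l = {\<omega> \<in> space M. \<forall>i\<le>l. Y (k0 + i) \<omega> \<in> A}" for l
    have N_eq: "N l = {\<omega> \<in> space M. (\<lambda>w. \<forall>i\<le>l. foldl bump x (take (k0 + i) w) \<in> A) (wd (k0 + l) \<omega>)}" for l
      unfolding N_def by (simp add: take_wd Y_foldl)
    have N: "N l \<in> events" for l unfolding N_eq by (rule wd_events)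
    have "prob (N l) = EW k0 x (\<lambda>w. surv A l (foldl bump x w))" for l
    proof -
      have "prob (N l) = EW k0 x (\<lambda>w. EW l (foldl bump x w)
          (\<lambda>w'. of_bool (\<forall>i\<le>l. foldl bump x (take (k0 + i) (w @ w')) \<in> A)))"
        unfolding N_eq by (subst prob_wd) (rule EW_append)
      also have "\<dots> = EW k0 x (\<lambda>w. surv A l (foldl bump x w))"
      proof (rule EW_cong)
        fix w :: "nat list" assume "length w = k0"
        then show "EW l (foldl bump x w) (\<lambda>w'. of_bool (\<forall>i\<le>l. foldl bump x (take (k0 + i) (w @ w')) \<in> A))
            = surv A l (foldl bump x w)"
          unfolding EW_surv[symmetric] by simp
      qed
      finally show ?thesis .
    qed
    moreover have "(\<lambda>l. EW k0 x (\<lambda>w. surv A l (foldl bump x w))) \<longlonglongrightarrow> EW k0 x (\<lambda>w. 0)"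
      by (rule EW_tendsto) (use stay_LIMSEQ[of A] assms in simp)
    ultimately have lim: "(\<lambda>l. prob (N l)) \<longlonglongrightarrow> 0" by (simp only: EW_const)
    have Z: "(\<Inter>l. N l) \<in> events" using N by auto
    have "prob (\<Inter>l. N l) \<le> prob (N l)" for l
      using N by (intro finite_measure_mono) auto
    then have "prob (\<Inter>l. N l) \<le> 0" using lim by (intro LIMSEQ_le_const) auto
    then have "prob (\<Inter>l. N l) = 0" by (rule antisym) (rule measure_nonneg)
    then have "emeasure M (\<Inter>l. N l) = 0" by (simp add: emeasure_eq_measure)
    then have "AE \<omega> in M. \<omega> \<notin> (\<Inter>l. N l)" using Z by (intro AE_not_in) (auto simp: null_sets_def)
    then show ?thesis
    proof (rule AE_mp, intro AE_I2 impI notI)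
      fix \<omega> assume "\<omega> \<in> space M" "\<omega> \<notin> (\<Inter>l. N l)" "\<forall>k\<ge>k0. Y k \<omega> \<in> A"
      then show False by (auto simp: N_def)
    qed
  qed
  then have "AE \<omega> in M. \<forall>k0. \<not> (\<forall>k\<ge>k0. Y k \<omega> \<in> A)" by (simp add: AE_all_countable)
  then show ?thesis by (rule AE_mp) (auto simp: eventually_sequentially intro!: AE_I2)
qed

section \<open>Laws of large numbers for jumps and clocks\<close>

lemma pr_le_1:
  assumes "j \<in> {1..n}"
  shows "pr y j \<le> 1"
proof -
  have "pr y j \<le> (\<Sum>i\<in>{1..n}. pr y i)"
    by (rule member_le_sum) (use assms p_nonneg in auto)
  then show ?thesis by (simp only: p_sum)
qed

lemma AE_compensated_jumps:
  assumes j: "j \<in> {1..n}" and f: "\<And>y. \<bar>f y\<bar> \<le> 1"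
  shows "AE \<omega> in M. (\<lambda>k. (\<Sum>i<k. f (Y i \<omega>) * (of_bool (J i \<omega> = j) - pr (Y i \<omega>) j)) / real k) \<longlonglongrightarrow> 0"
proof -
  define S where "S k \<omega> = compensated f j x (wd k \<omega>)" for k \<omega>
  have S_Suc: "S (Suc k) \<omega> = S k \<omega> + f (Y k \<omega>) * (of_bool (J k \<omega> = j) - pr (Y k \<omega>) j)" for k \<omega>
    unfolding S_def wd_Suc compensated_snoc by (simp flip: Y_foldl)
  have S_sum: "(\<Sum>i<k. f (Y i \<omega>) * (of_bool (J i \<omega> = j) - pr (Y i \<omega>) j)) = S k \<omega>" for k \<omega>
    by (induction k) (simp_all add: S_Suc, simp add: S_def)
  have "AE \<omega> in M. (\<lambda>r. S (r\<^sup>2) \<omega> / real (r\<^sup>2)) \<longlonglongrightarrow> 0"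
  proof (rule AE_squares_tendsto_0)
    show "integrable M (\<lambda>\<omega>. (S k \<omega>)\<^sup>2)" for k
      unfolding S_def using integrable_wd[of "\<lambda>w. (compensated f j x w)\<^sup>2"] .
    show "S k \<in> borel_measurable M" for k
      unfolding S_def using integrable_wd[of "compensated f j x"] by auto
    show "(\<integral>\<omega>. (S k \<omega>)\<^sup>2 \<partial>M) \<le> real k" for k
      unfolding S_def using integral_wd[of "\<lambda>w. (compensated f j x w)\<^sup>2" k]
        EW_compensated_square[OF j f, of k x] by simp
  qed
  then show ?thesis
  proof (rule AE_mp, intro AE_I2 impI)
    fix \<omega> assume sq: "(\<lambda>r. S (r\<^sup>2) \<omega> / real (r\<^sup>2)) \<longlonglongrightarrow> 0"
    have inc: "\<bar>S (Suc k) \<omega> - S k \<omega>\<bar> \<le> 1" for k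
    proof -
      have "0 \<le> pr (Y k \<omega>) j" "pr (Y k \<omega>) j \<le> 1"
        using p_nonneg[OF j, of "Y k \<omega>"] pr_le_1[OF j, of "Y k \<omega>"] by auto
      then have "\<bar>of_bool (J k \<omega> = j) - pr (Y k \<omega>) j\<bar> \<le> 1" by (auto simp: of_bool_def)
      then show ?thesis using f[of "Y k \<omega>"] by (simp add: S_Suc abs_mult mult_le_one)
    qed
    show "(\<lambda>k. (\<Sum>i<k. f (Y i \<omega>) * (of_bool (J i \<omega> = j) - pr (Y i \<omega>) j)) / real k) \<longlonglongrightarrow> 0"
      unfolding S_sum
      by (rule tendsto_0_from_squares[of "\<lambda>k. S k \<omega>" "\<lambda>_. 1", OF inc sq gap_const_tendsto_0])
  qed
qed

lemma E_int: "integrable M (\<lambda>\<omega>. E k \<omega> - 1)" "integrable M (\<lambda>\<omega>. (E k \<omega> - 1)\<^sup>2)"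
  and E_mean: "(\<integral>\<omega>. E k \<omega> - 1 \<partial>M) = 0" and E_var: "(\<integral>\<omega>. (E k \<omega> - 1)\<^sup>2 \<partial>M) = 1"
proof -
  have i1: "integrable M (E k)" and i2: "integrable M (\<lambda>\<omega>. (E k \<omega>)\<^sup>2)"
    using erlang_ith_moment_integrable[OF _ E_exp[of k], where i = 1]
      erlang_ith_moment_integrable[OF _ E_exp[of k], where i = 2] by simp_all
  have m: "expectation (E k) = 1" "expectation (\<lambda>\<omega>. (E k \<omega>)\<^sup>2) = 2"
    using erlang_ith_moment[OF _ E_exp[of k], where i = 1]
      erlang_ith_moment[OF _ E_exp[of k], where i = 2] by (simp_all add: fact_numeral)
  show "integrable M (\<lambda>\<omega>. E k \<omega> - 1)" using i1 by simp
  have eq: "(E k \<omega> - 1)\<^sup>2 = (E k \<omega>)\<^sup>2 - 2 * E k \<omega> + 1" for \<omega> by (simp add: power2_diff)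
  show "integrable M (\<lambda>\<omega>. (E k \<omega> - 1)\<^sup>2)" unfolding eq using i1 i2 by simp
  show "(\<integral>\<omega>. E k \<omega> - 1 \<partial>M) = 0" using i1 m by (simp add: prob_space)
  show "(\<integral>\<omega>. (E k \<omega> - 1)\<^sup>2 \<partial>M) = 1" unfolding eq using i1 i2 m by (simp add: prob_space)
qed

lemma E_nonneg: "AE \<omega> in M. \<forall>k. 0 \<le> E k \<omega>"
proof -
  have "AE \<omega> in M. 0 \<le> E k \<omega>" for k
    by (subst distributed_AE2[OF E_exp]) (auto simp: exponential_density_def)
  then show ?thesis by (simp add: AE_all_countable)
qed

text \<open>The weights depend on the word alone, which is independent of the clocks. In the
  expanded square the off-diagonal terms therefore vanish by centring, and each diagonal term is at
  most 1.\<close>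

lemma compensated_clocks_second_moment:
  assumes g: "\<And>y. \<bar>g y\<bar> \<le> 1"
  defines "S \<equiv> \<lambda>k \<omega>. \<Sum>i<k. g (Y i \<omega>) * (E i \<omega> - 1)"
  shows "S k \<in> borel_measurable M" "integrable M (\<lambda>\<omega>. (S k \<omega>)\<^sup>2)" "(\<integral>\<omega>. (S k \<omega>)\<^sup>2 \<partial>M) \<le> real k"
proof -
  define c where "c i w = g (foldl bump x (take i w))" for i and w :: "nat list"
  have c: "g (Y i \<omega>) = c i (wd k \<omega>)" if "i < k" for i \<omega>
    unfolding c_def Y_foldl using that by (simp add: take_wd)
  define t where "t i l \<omega> = (c i (wd k \<omega>) * c l (wd k \<omega>)) * ((E i \<omega> - 1) * (E l \<omega> - 1))" for i l \<omega>
  have t: "integrable M (t i l) \<and> (\<integral>\<omega>. t i l \<omega> \<partial>M) \<le> (if i = l then 1 else 0)" for i l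
  proof (cases "i = l")
    case True
    define F where "F w = (c i w)\<^sup>2" for w
    have "EW k x F \<le> EW k x (\<lambda>_. 1)"
      by (rule EW_mono) (use g in \<open>auto simp: F_def c_def abs_square_le_1\<close>)
    then have "EW k x F \<le> 1" by (simp only: EW_const)
    moreover have "t i l = (\<lambda>\<omega>. F (wd k \<omega>) * (\<Prod>l\<in>{i}. (E l \<omega> - 1)\<^sup>2))"
      by (simp add: t_def[abs_def] F_def power2_eq_square True)
    ultimately show ?thesis
      using word_function_times_clocks[of "{i}" "\<lambda>_ e. (e - 1)\<^sup>2" F k] E_int E_var True by simp
  next
    case False
    then show ?thesis
      using word_function_times_clocks[of "{i, l}" "\<lambda>_ e. e - 1" "\<lambda>w. c i w * c l w" k] E_int E_mean
      by (simp add: t_def[abs_def])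
  qed
  have S_eq: "S k \<omega> = (\<Sum>i<k. c i (wd k \<omega>) * (E i \<omega> - 1))" for \<omega>
    unfolding S_def by (intro sum.cong) (auto simp: c)
  have sq: "(S k \<omega>)\<^sup>2 = (\<Sum>i<k. \<Sum>l<k. t i l \<omega>)" for \<omega>
    unfolding S_eq power2_eq_square sum_product t_def by (intro sum.cong refl) (simp add: mult_ac)
  have "(\<lambda>\<omega>. c i (wd k \<omega>)) \<in> borel_measurable M" for i
    using integrable_wd[of "c i" k] by auto
  then show "S k \<in> borel_measurable M"
    unfolding S_eq[abs_def] using E_meas by measurable
  show "integrable M (\<lambda>\<omega>. (S k \<omega>)\<^sup>2)" unfolding sq using t by auto
  have "(\<integral>\<omega>. (S k \<omega>)\<^sup>2 \<partial>M) = (\<Sum>i<k. \<Sum>l<k. \<integral>\<omega>. t i l \<omega> \<partial>M)"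
    unfolding sq using t by (simp add: Bochner_Integration.integral_sum)
  also have "\<dots> \<le> (\<Sum>i<k. \<Sum>l<k. if i = l then 1 else 0)"
    by (intro sum_mono) (use t in auto)
  finally show "(\<integral>\<omega>. (S k \<omega>)\<^sup>2 \<partial>M) \<le> real k" by simp
qed

text \<open>Clock increments are unbounded, so their sums between squares need control of their own;
  this instance with constant weight supplies it.\<close>

lemma AE_clock_squares:
  "AE \<omega> in M. (\<lambda>r. (\<Sum>i<r\<^sup>2. E i \<omega> - 1) / real (r\<^sup>2)) \<longlonglongrightarrow> 0"
proof -
  define g :: "(nat \<Rightarrow> nat) \<Rightarrow> real" where "g = (\<lambda>_. 1)"
  have g: "\<bar>g y\<bar> \<le> 1" for y by (simp add: g_def)
  have "AE \<omega> in M. (\<lambda>r. (\<Sum>i<r\<^sup>2. g (Y i \<omega>) * (E i \<omega> - 1)) / real (r\<^sup>2)) \<longlonglongrightarrow> 0"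
    by (rule AE_squares_tendsto_0[where S = "\<lambda>k \<omega>. \<Sum>i<k. g (Y i \<omega>) * (E i \<omega> - 1)"])
      (rule compensated_clocks_second_moment(2)[of g, OF g]
        compensated_clocks_second_moment(1)[of g, OF g] compensated_clocks_second_moment(3)[of g, OF g])+
  then show ?thesis by (simp only: g_def mult_1)
qed

text \<open>Writing \<open>1 + e i\<close> as \<open>(e i - 1) + 2\<close> reduces the gap to two
  centred sums at consecutive squares and twice its length. The factor \<open>(1 + 1 / r)^2\<close>
  changes the normalisation from one square to the other.\<close>

lemma clock_gap_tendsto_0:
  assumes "(\<lambda>r. (\<Sum>i<r\<^sup>2. e i - 1) / real (r\<^sup>2)) \<longlonglongrightarrow> (0::real)"
  shows "(\<lambda>r. (\<Sum>i\<in>{r\<^sup>2..<(Suc r)\<^sup>2}. 1 + e i) / real (r\<^sup>2)) \<longlonglongrightarrow> 0"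
proof -
  define a where "a r = (\<Sum>i<r\<^sup>2. e i - 1) / real (r\<^sup>2)" for r
  have a: "a \<longlonglongrightarrow> 0" unfolding a_def[abs_def] by (rule assms)
  have q: "(\<lambda>r. (1 + 1 / real r)\<^sup>2) \<longlonglongrightarrow> (1 + 0)\<^sup>2"
    by (intro tendsto_intros lim_const_over_n)
  have "(\<lambda>r. a (Suc r) * (1 + 1 / real r)\<^sup>2 - a r + (\<Sum>i\<in>{r\<^sup>2..<(Suc r)\<^sup>2}. 2) / real (r\<^sup>2)) \<longlonglongrightarrow> 0 * (1 + 0)\<^sup>2 - 0 + 0"
    by (intro tendsto_intros q a LIMSEQ_Suc[OF a] gap_const_tendsto_0)
  then have lim: "(\<lambda>r. a (Suc r) * (1 + 1 / real r)\<^sup>2 - a r + (\<Sum>i\<in>{r\<^sup>2..<(Suc r)\<^sup>2}. 2) / real (r\<^sup>2)) \<longlonglongrightarrow> 0" by simp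
  show ?thesis
  proof (rule Lim_transform_eventually[OF lim])
    show "\<forall>\<^sub>F r in sequentially. a (Suc r) * (1 + 1 / real r)\<^sup>2 - a r + (\<Sum>i\<in>{r\<^sup>2..<(Suc r)\<^sup>2}. 2) / real (r\<^sup>2)
        = (\<Sum>i\<in>{r\<^sup>2..<(Suc r)\<^sup>2}. 1 + e i) / real (r\<^sup>2)"
      unfolding eventually_sequentially
    proof (intro exI[of _ 1] allI impI)
      fix r :: nat assume r: "1 \<le> r"
      have le: "r\<^sup>2 \<le> (Suc r)\<^sup>2" by (simp add: power_mono)
      have "(1 + 1 / real r)\<^sup>2 = real ((Suc r)\<^sup>2) / real (r\<^sup>2)"
        using r by (simp add: field_simps power2_eq_square)
      moreover have "real ((Suc r)\<^sup>2) \<noteq> 0" by simp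
      ultimately have "a (Suc r) * (1 + 1 / real r)\<^sup>2 = (\<Sum>i<(Suc r)\<^sup>2. e i - 1) / real (r\<^sup>2)"
        by (simp add: a_def)
      then have "a (Suc r) * (1 + 1 / real r)\<^sup>2 - a r = ((\<Sum>i<(Suc r)\<^sup>2. e i - 1) - (\<Sum>i<r\<^sup>2. e i - 1)) / real (r\<^sup>2)"
        by (simp add: a_def diff_divide_distrib)
      also have "(\<Sum>i<(Suc r)\<^sup>2. e i - 1) - (\<Sum>i<r\<^sup>2. e i - 1) = (\<Sum>i\<in>{r\<^sup>2..<(Suc r)\<^sup>2}. e i - 1)"
        using sum_diff_nat_ivl[of 0 "r\<^sup>2" "(Suc r)\<^sup>2" "\<lambda>i. e i - 1"] le by (simp add: lessThan_atLeast0)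
      finally show "a (Suc r) * (1 + 1 / real r)\<^sup>2 - a r + (\<Sum>i\<in>{r\<^sup>2..<(Suc r)\<^sup>2}. 2) / real (r\<^sup>2)
        = (\<Sum>i\<in>{r\<^sup>2..<(Suc r)\<^sup>2}. 1 + e i) / real (r\<^sup>2)"
        by (simp only: add_divide_distrib[symmetric] sum.distrib[symmetric]) simp
    qed
  qed
qed

lemma AE_compensated_clocks:
  assumes g: "\<And>y. \<bar>g y\<bar> \<le> 1"
  shows "AE \<omega> in M. (\<lambda>k. (\<Sum>i<k. g (Y i \<omega>) * (E i \<omega> - 1)) / real k) \<longlonglongrightarrow> 0"
proof -
  have "AE \<omega> in M. (\<lambda>r. (\<Sum>i<r\<^sup>2. g (Y i \<omega>) * (E i \<omega> - 1)) / real (r\<^sup>2)) \<longlonglongrightarrow> 0"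
    by (rule AE_squares_tendsto_0[where S = "\<lambda>k \<omega>. \<Sum>i<k. g (Y i \<omega>) * (E i \<omega> - 1)"])
      (rule compensated_clocks_second_moment(2)[of g, OF g]
        compensated_clocks_second_moment(1)[of g, OF g] compensated_clocks_second_moment(3)[of g, OF g])+
  with AE_clock_squares E_nonneg show ?thesis
  proof eventually_elim
    case (elim \<omega>)
    have inc: "\<bar>(\<Sum>i<Suc k. g (Y i \<omega>) * (E i \<omega> - 1)) - (\<Sum>i<k. g (Y i \<omega>) * (E i \<omega> - 1))\<bar> \<le> 1 + E k \<omega>" for k
    proof -
      have "\<bar>g (Y k \<omega>)\<bar> * \<bar>E k \<omega> - 1\<bar> \<le> 1 * \<bar>E k \<omega> - 1\<bar>" using g by (intro mult_right_mono) auto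
      moreover have "0 \<le> E k \<omega>" using elim by blast
      ultimately show ?thesis by (simp add: abs_mult)
    qed
    show ?case
      by (rule tendsto_0_from_squares[of "\<lambda>k. \<Sum>i<k. g (Y i \<omega>) * (E i \<omega> - 1)", OF inc])
        (use elim clock_gap_tendsto_0[of "\<lambda>i. E i \<omega>"] in auto)
  qed
qed

text \<open>A jump indicator minus rate times holding time is a compensated jump minus
  \<open>pr\<close> times a centred clock. The predicate \<open>P\<close> selects the steps started
  in given states, such as one ordering of a pair.\<close>

lemma AE_jumps_LLN:
  assumes j: "j \<in> {1..n}"
  shows "AE \<omega> in M. (\<lambda>k. (\<Sum>i<k. of_bool (P (Y i \<omega>)) *
      (of_bool (J i \<omega> = j) - rt (Y i \<omega>) j * (E i \<omega> / q (Y i \<omega>)))) / real k) \<longlonglongrightarrow> 0"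
proof -
  have pr1: "\<bar>pr y j\<bar> \<le> 1" for y
    using p_nonneg[OF j, of y] pr_le_1[OF j, of y] by linarith
  have "AE \<omega> in M. (\<lambda>k. (\<Sum>i<k. of_bool (P (Y i \<omega>)) * (of_bool (J i \<omega> = j) - pr (Y i \<omega>) j)) / real k) \<longlonglongrightarrow> 0"
    by (rule AE_compensated_jumps[OF j, of "\<lambda>y. of_bool (P y)"]) auto
  moreover have "AE \<omega> in M. (\<lambda>k. (\<Sum>i<k. (of_bool (P (Y i \<omega>)) * pr (Y i \<omega>) j) * (E i \<omega> - 1)) / real k) \<longlonglongrightarrow> 0"
    by (rule AE_compensated_clocks[of "\<lambda>y. of_bool (P y) * pr y j"]) (use pr1 in \<open>auto simp: of_bool_def\<close>)
  ultimately show ?thesis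
  proof eventually_elim
    case (elim \<omega>)
    have eq: "of_bool (P (Y i \<omega>)) * (of_bool (J i \<omega> = j) - rt (Y i \<omega>) j * (E i \<omega> / q (Y i \<omega>)))
      = of_bool (P (Y i \<omega>)) * (of_bool (J i \<omega> = j) - pr (Y i \<omega>) j)
        - (of_bool (P (Y i \<omega>)) * pr (Y i \<omega>) j) * (E i \<omega> - 1)" for i
      by (cases "P (Y i \<omega>)") (simp_all add: pr_def right_diff_distrib)
    show ?case
      unfolding eq sum_subtractf diff_divide_distrib using tendsto_diff[OF elim] by simp
  qed
qed

end

subsection \<open>Speeds along a path\<close>

lemma tendsto_0_add_const:
  assumes "(\<lambda>k. f k / real k) \<longlonglongrightarrow> (0::real)" "\<And>k. K \<le> k \<Longrightarrow> g k = f k + a"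
  shows "(\<lambda>k. g k / real k) \<longlonglongrightarrow> 0"
proof -
  have "(\<lambda>k. f k / real k + a / real k) \<longlonglongrightarrow> 0 + 0"
    by (intro tendsto_add assms(1) lim_const_over_n)
  then have "(\<lambda>k. f k / real k + a / real k) \<longlonglongrightarrow> 0" by simp
  then show ?thesis
    by (rule Lim_transform_eventually)
      (use assms(2) in \<open>auto simp: eventually_sequentially add_divide_distrib intro!: exI[of _ K]\<close>)
qed

lemma linear_bound_if_sublinear:
  fixes \<epsilon> :: "nat \<Rightarrow> real"
  assumes "(\<lambda>k. \<epsilon> k / real k) \<longlonglongrightarrow> 0" "0 < d"
  shows "\<exists>C\<ge>0. \<forall>k. \<bar>\<epsilon> k\<bar> \<le> d * real k + C"
proof -
  have "\<forall>\<^sub>F k in sequentially. \<bar>\<epsilon> k / real k\<bar> < d"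
    using tendstoD[OF assms] by (simp add: dist_real_def)
  then obtain N where N: "\<And>k. k \<ge> N \<Longrightarrow> \<bar>\<epsilon> k / real k\<bar> < d" by (auto simp: eventually_sequentially)
  define C where "C = (\<Sum>k\<le>N. \<bar>\<epsilon> k\<bar>)"
  have "\<bar>\<epsilon> k\<bar> \<le> d * real k + C" for k
  proof (cases "k \<le> N")
    case True
    then have "\<bar>\<epsilon> k\<bar> \<le> C" unfolding C_def by (intro member_le_sum) auto
    then show ?thesis using assms(2) by (simp add: add_increasing)
  next
    case False
    then have "\<bar>\<epsilon> k\<bar> / real k < d" using N[of k] by simp
    then have "\<bar>\<epsilon> k\<bar> < d * real k" using False by (simp add: field_simps)
    moreover have "0 \<le> C" by (simp add: C_def sum_nonneg)
    ultimately show ?thesis by linarith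
  qed
  moreover have "0 \<le> C" by (simp add: C_def sum_nonneg)
  ultimately show ?thesis by blast
qed

text \<open>Typically \<open>i\<close> is the last time at which \<open>D\<close> was small: since
  then it has grown by noise only, and the linear bounds with arbitrarily small slope control noise
  increments for all \<open>i\<close> up to \<open>k\<close> at once.\<close>

lemma sublinear_if_dominated:
  fixes \<epsilon> D :: "nat \<Rightarrow> real"
  assumes \<epsilon>: "(\<lambda>k. \<epsilon> k / real k) \<longlonglongrightarrow> 0" and D: "\<And>k. 0 \<le> D k" "\<And>k. \<exists>i\<le>k. D k \<le> a + (\<epsilon> k - \<epsilon> i)"
  shows "(\<lambda>k. D k / real k) \<longlonglongrightarrow> 0"
proof (rule LIMSEQ_I)
  fix r :: real assume r: "0 < r"
  obtain C where C: "0 \<le> C" "\<And>k. \<bar>\<epsilon> k\<bar> \<le> r / 4 * real k + C"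
    using linear_bound_if_sublinear[OF \<epsilon>, of "r / 4"] r by auto
  have bound: "D k \<le> r / 2 * real k + (a + 2 * C)" for k
  proof -
    obtain i where i: "i \<le> k" "D k \<le> a + (\<epsilon> k - \<epsilon> i)" using D(2) by blast
    have "r / 4 * real i \<le> r / 4 * real k" using i r by (intro mult_left_mono) auto
    then show ?thesis using i C(2)[of k] C(2)[of i] by (simp add: field_simps)
  qed
  have "(\<lambda>k. (a + 2 * C) / real k) \<longlonglongrightarrow> 0" by (rule lim_const_over_n)
  then have "\<forall>\<^sub>F k in sequentially. (a + 2 * C) / real k < r / 2"
    using r by (intro order_tendstoD(2)) auto
  then obtain N where N: "\<And>k. k \<ge> N \<Longrightarrow> (a + 2 * C) / real k < r / 2" by (auto simp: eventually_sequentially)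
  show "\<exists>no. \<forall>k\<ge>no. norm (D k / real k - 0) < r"
  proof (intro exI allI impI)
    fix k assume k: "k \<ge> max N 1"
    have "D k / real k \<le> (r / 2 * real k + (a + 2 * C)) / real k" using bound by (intro divide_right_mono) auto
    also have "\<dots> = r / 2 + (a + 2 * C) / real k" using k by (simp add: add_divide_distrib)
    also have "\<dots> < r"
    proof -
      have "N \<le> k" using k by simp
      from N[OF this] show ?thesis by linarith
    qed
    finally show "norm (D k / real k - 0) < r" using D(1)[of k] by simp
  qed
qed

text \<open>One trajectory with its holding times. The almost sure laws of large numbers enter as
  hypotheses, and the speeds follow by deterministic arguments.\<close>

locale growth_path =
  fixes y :: "nat \<Rightarrow> nat \<Rightarrow> nat" and js :: "nat \<Rightarrow> nat" and h :: "nat \<Rightarrow> real"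
    and r :: "(nat \<Rightarrow> nat) \<Rightarrow> nat \<Rightarrow> real"
  assumes y_Suc: "\<And>k. y (Suc k) = bump (y k) (js k)" and h_nonneg: "\<And>k. 0 \<le> h k"
begin

definition T :: "nat \<Rightarrow> real" where "T k = (\<Sum>i<k. h i)"

definition LLN :: "((nat \<Rightarrow> nat) \<Rightarrow> bool) \<Rightarrow> nat \<Rightarrow> bool" where
  "LLN P j \<longleftrightarrow> (\<lambda>k. (\<Sum>i<k. of_bool (P (y i)) * (of_bool (js i = j) - r (y i) j * h i)) / real k) \<longlonglongrightarrow> 0"

definition jumps :: "((nat \<Rightarrow> nat) \<Rightarrow> bool) \<Rightarrow> nat \<Rightarrow> nat \<Rightarrow> real" where
  "jumps P j k = (\<Sum>i<k. of_bool (P (y i)) * of_bool (js i = j))"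

definition dur :: "((nat \<Rightarrow> nat) \<Rightarrow> bool) \<Rightarrow> nat \<Rightarrow> real" where
  "dur P k = (\<Sum>i<k. of_bool (P (y i)) * h i)"

text \<open>Steps before \<open>K\<close>, where the rate may differ from \<open>b\<close>,
  contribute a constant that disappears after division by \<open>k\<close>.\<close>

lemma jumps_rate:
  assumes "LLN P j" and ev: "\<And>k. K \<le> k \<Longrightarrow> P (y k) \<Longrightarrow> r (y k) j = b"
  shows "(\<lambda>k. (jumps P j k - b * dur P k) / real k) \<longlonglongrightarrow> 0"
proof (rule tendsto_0_add_const)
  define S where "S k = (\<Sum>i<k. of_bool (P (y i)) * (of_bool (js i = j) - r (y i) j * h i))" for k
  define R where "R k = (\<Sum>i<k. of_bool (P (y i)) * ((r (y i) j - b) * h i))" for k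
  show "(\<lambda>k. S k / real k) \<longlonglongrightarrow> 0" using assms(1) by (simp add: LLN_def S_def)
  have eq: "jumps P j k - b * dur P k = S k + R k" for k
    unfolding jumps_def dur_def S_def R_def sum_distrib_left sum_subtractf[symmetric] sum.distrib[symmetric]
    by (intro sum.cong refl) (simp add: algebra_simps)
  have RK: "R k = R K" if "K \<le> k" for k using that
  proof (induction k rule: dec_induct)
    case (step m)
    then have "P (y m) \<Longrightarrow> r (y m) j = b" using ev by simp
    then have "R (Suc m) = R m" by (cases "P (y m)") (simp_all add: R_def)
    then show ?case using step by simp
  qed simp
  show "jumps P j k - b * dur P k = S k + R K" if "K \<le> k" for k
    unfolding eq RK[OF that] ..
qed

lemma height_eq_jumps: "real (y k j) = real (y 0 j) + jumps (\<lambda>_. True) j k"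
  by (induction k) (auto simp: jumps_def y_Suc bump_apply)

lemma dur_True: "dur (\<lambda>_. True) k = T k"
  by (simp add: dur_def T_def)

lemma single_speed:
  assumes "LLN (\<lambda>_. True) j" "\<forall>\<^sub>F k in sequentially. r (y k) j = b"
  shows "(\<lambda>k. (real (y k j) - b * T k) / real k) \<longlonglongrightarrow> 0"
proof -
  obtain K where K: "\<And>k. K \<le> k \<Longrightarrow> r (y k) j = b" using assms(2) by (auto simp: eventually_sequentially)
  have "(\<lambda>k. (jumps (\<lambda>_. True) j k - b * dur (\<lambda>_. True) k) / real k) \<longlonglongrightarrow> 0"
    by (rule jumps_rate[of _ _ K]) (use assms K in auto)
  then show ?thesis
  proof (rule tendsto_0_add_const[where K = 0 and a = "real (y 0 j)"])
    show "real (y k j) - b * T k = jumps (\<lambda>_. True) j k - b * dur (\<lambda>_. True) k + real (y 0 j)" for k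
      unfolding height_eq_jumps[of k j] dur_True by simp
  qed
qed

text \<open>While \<open>u\<close> is ahead its rate is at most that of \<open>v\<close>, so the
  positive part of the height difference has grown by noise only since it was last zero. Jump counts
  are used so that times spent in each ordering can be compared later.\<close>

lemma positive_gap_sublinear:
  assumes "u \<noteq> v" and "\<alpha> \<le> \<gamma>"
    and LLN: "\<And>j. j \<in> {u, v} \<Longrightarrow> LLN (\<lambda>y. y v < y u) j"
    and ev: "\<And>k. K \<le> k \<Longrightarrow> y k v < y k u \<Longrightarrow> r (y k) u = \<alpha> \<and> r (y k) v = \<gamma>"
  shows "(\<lambda>k. (jumps (\<lambda>y. y u = y v) u k + jumps (\<lambda>y. y v < y u) u k - jumps (\<lambda>y. y v < y u) v k) / real k) \<longlonglongrightarrow> 0"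
proof -
  let ?G = "\<lambda>y :: nat \<Rightarrow> nat. y v < y u"
  \<comment> \<open>Truncated subtraction of naturals yields the positive part directly.\<close>
  define D where "D k = real (y k u - y k v)" for k
  have D_Suc: "D (Suc k) = D k + of_bool (y k u = y k v) * of_bool (js k = u)
      + of_bool (?G (y k)) * (of_bool (js k = u) - of_bool (js k = v))" for k
  proof -
    have up: "real (Suc a - b) = real (a - b) + of_bool (a = b) + of_bool (b < a)" for a b :: nat
      by (cases a b rule: linorder_cases) (simp_all add: Suc_diff_le)
    have down: "real (a - Suc b) = real (a - b) - of_bool (b < a)" for a b :: nat
      by (cases a b rule: linorder_cases) (simp_all add: of_nat_diff)
    consider "js k = u" | "js k = v" | "js k \<noteq> u" "js k \<noteq> v" by blast
    then show ?thesis
      by cases (use assms(1) in \<open>simp_all add: D_def y_Suc bump_apply up down\<close>)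
  qed
  define m where "m k = jumps ?G u k - jumps ?G v k" for k
  have D_eq: "D k = D 0 + (jumps (\<lambda>y. y u = y v) u k + jumps ?G u k - jumps ?G v k)" for k
    by (induction k) (simp_all add: D_Suc jumps_def algebra_simps)
  have m_Suc: "m (Suc k) = m k + of_bool (?G (y k)) * (of_bool (js k = u) - of_bool (js k = v))" for k
    by (simp add: m_def jumps_def algebra_simps)
  define \<epsilon> where "\<epsilon> k = m k - (\<alpha> - \<gamma>) * dur ?G k" for k
  have "(\<lambda>k. (jumps ?G u k - \<alpha> * dur ?G k) / real k - (jumps ?G v k - \<gamma> * dur ?G k) / real k) \<longlonglongrightarrow> 0 - 0"
    by (intro tendsto_diff jumps_rate[of _ _ K] LLN) (use ev in auto)
  then have \<epsilon>: "(\<lambda>k. \<epsilon> k / real k) \<longlonglongrightarrow> 0"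
    by (simp add: \<epsilon>_def m_def algebra_simps flip: diff_divide_distrib)
  have "\<exists>i\<le>k. D k \<le> (D 0 + 1) + (\<epsilon> k - \<epsilon> i)" for k
  proof (induction k)
    case 0
    then show ?case by simp
  next
    case (Suc k)
    show ?case
    proof (cases "?G (y k)")
      case False
      then have "D k = 0" by (simp add: D_def)
      then have "D (Suc k) \<le> 1" using False by (simp add: D_Suc of_bool_def)
      \<comment> \<open>A closed gap opens by at most 1, so the comparison time is reset to the
        present.\<close>
      then have "D (Suc k) \<le> (D 0 + 1) + (\<epsilon> (Suc k) - \<epsilon> (Suc k))" by (simp add: D_def)
      then show ?thesis by blast
    next
      case True
      obtain i where i: "i \<le> k" "D k \<le> (D 0 + 1) + (\<epsilon> k - \<epsilon> i)" using Suc by blast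
      have "D (Suc k) - D k = m (Suc k) - m k" using True by (simp add: D_Suc m_Suc)
      also have "\<dots> = \<epsilon> (Suc k) - \<epsilon> k + (\<alpha> - \<gamma>) * h k"
        using True by (simp add: \<epsilon>_def dur_def algebra_simps)
      also have "\<dots> \<le> \<epsilon> (Suc k) - \<epsilon> k"
        using assms(2) h_nonneg[of k] by (simp add: mult_nonpos_nonneg)
      finally have "D (Suc k) \<le> (D 0 + 1) + (\<epsilon> (Suc k) - \<epsilon> i)" using i by simp
      then show ?thesis using i by (intro exI[of _ i]) simp
    qed
  qed
  then have "(\<lambda>k. D k / real k) \<longlonglongrightarrow> 0" by (intro sublinear_if_dominated[OF \<epsilon>]) (auto simp: D_def)
  then show ?thesis
  proof (rule tendsto_0_add_const[where K = 0 and a = "- D 0"])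
    show "jumps (\<lambda>y. y u = y v) u k + jumps ?G u k - jumps ?G v k = D k + - D 0" for k
      using D_eq[of k] by linarith
  qed
qed

text \<open>With \<open>s\<^sub>0\<close>, \<open>s\<^sub>1\<close>, \<open>s\<^sub>2\<close> the times spent in the three orderings of a pair, both gaps being sublinear
  gives \<open>\<alpha> s\<^sub>0 + (\<alpha> - \<gamma>) s\<^sub>1 \<approx> 0 \<approx> \<alpha> s\<^sub>0 + (\<alpha> - \<gamma>) s\<^sub>2\<close>; a linear combination of the two
  identifies the speed without dividing by \<open>\<gamma> - \<alpha>\<close>, which may vanish.\<close>

lemma pair_speed:
  assumes uv: "u \<noteq> v" and \<alpha>\<gamma>: "0 < \<alpha>" "\<alpha> \<le> \<gamma>"
    and LLN: "\<And>j. j \<in> {u, v} \<Longrightarrow> LLN (\<lambda>y. y u = y v) j" "\<And>j. j \<in> {u, v} \<Longrightarrow> LLN (\<lambda>y. y v < y u) j"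
      "\<And>j. j \<in> {u, v} \<Longrightarrow> LLN (\<lambda>y. y u < y v) j"
    and ev: "\<forall>\<^sub>F k in sequentially. (y k u \<le> y k v \<longrightarrow> r (y k) v = \<alpha>) \<and> (y k v \<le> y k u \<longrightarrow> r (y k) u = \<alpha>)
      \<and> (y k u < y k v \<longrightarrow> r (y k) u = \<gamma>) \<and> (y k v < y k u \<longrightarrow> r (y k) v = \<gamma>)"
  shows "(\<lambda>k. (real (y k u) - 2 * \<alpha> * \<gamma> / (\<alpha> + \<gamma>) * T k) / real k) \<longlonglongrightarrow> 0"
proof -
  obtain K where K: "\<And>k. K \<le> k \<Longrightarrow> (y k u \<le> y k v \<longrightarrow> r (y k) v = \<alpha>) \<and> (y k v \<le> y k u \<longrightarrow> r (y k) u = \<alpha>)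
      \<and> (y k u < y k v \<longrightarrow> r (y k) u = \<gamma>) \<and> (y k v < y k u \<longrightarrow> r (y k) v = \<gamma>)"
    using ev unfolding eventually_sequentially by blast
  let ?E = "\<lambda>y :: nat \<Rightarrow> nat. y u = y v" and ?G = "\<lambda>y :: nat \<Rightarrow> nat. y v < y u" and ?L = "\<lambda>y :: nat \<Rightarrow> nat. y u < y v"
  define s0 where "s0 = dur ?E"
  define s1 where "s1 = dur ?G"
  define s2 where "s2 = dur ?L"
  have T_eq: "T k = s0 k + s1 k + s2 k" for k
    unfolding T_def s0_def s1_def s2_def dur_def sum.distrib[symmetric]
    by (intro sum.cong refl) (auto simp: of_bool_def)
  have J_eq: "jumps (\<lambda>_. True) u k = jumps ?E u k + jumps ?G u k + jumps ?L u k" for k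
    unfolding jumps_def sum.distrib[symmetric] by (intro sum.cong refl) (auto simp: of_bool_def)
  \<comment> \<open>The gap lemma with the sites exchanged produces equality in the other
    order.\<close>
  have sym: "jumps (\<lambda>y. y v = y u) = jumps ?E" by (intro arg_cong[of _ _ jumps] ext) auto
  have g1: "(\<lambda>k. (jumps ?E u k + jumps ?G u k - jumps ?G v k) / real k) \<longlonglongrightarrow> 0"
    by (rule positive_gap_sublinear[OF uv \<alpha>\<gamma>(2) LLN(2), of K]) (use K in auto)
  have g2: "(\<lambda>k. (jumps ?E v k + jumps ?L v k - jumps ?L u k) / real k) \<longlonglongrightarrow> 0"
    using positive_gap_sublinear[OF uv[symmetric] \<alpha>\<gamma>(2) LLN(3), of K] K sym by auto
  have rE: "(\<lambda>k. (jumps ?E u k - \<alpha> * s0 k) / real k) \<longlonglongrightarrow> 0" "(\<lambda>k. (jumps ?E v k - \<alpha> * s0 k) / real k) \<longlonglongrightarrow> 0"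
    unfolding s0_def by (rule jumps_rate[of _ _ K]; use LLN K in auto)+
  have rG: "(\<lambda>k. (jumps ?G u k - \<alpha> * s1 k) / real k) \<longlonglongrightarrow> 0" "(\<lambda>k. (jumps ?G v k - \<gamma> * s1 k) / real k) \<longlonglongrightarrow> 0"
    unfolding s1_def by (rule jumps_rate[of _ _ K]; use LLN K in auto)+
  have rL: "(\<lambda>k. (jumps ?L u k - \<gamma> * s2 k) / real k) \<longlonglongrightarrow> 0" "(\<lambda>k. (jumps ?L v k - \<alpha> * s2 k) / real k) \<longlonglongrightarrow> 0"
    unfolding s2_def by (rule jumps_rate[of _ _ K]; use LLN K in auto)+
  define e1 where "e1 k = \<alpha> * s0 k + (\<alpha> - \<gamma>) * s1 k" for k
  define e2 where "e2 k = \<alpha> * s0 k + (\<alpha> - \<gamma>) * s2 k" for k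
  have "(\<lambda>k. (jumps ?E u k + jumps ?G u k - jumps ?G v k) / real k - (jumps ?E u k - \<alpha> * s0 k) / real k
      - (jumps ?G u k - \<alpha> * s1 k) / real k + (jumps ?G v k - \<gamma> * s1 k) / real k) \<longlonglongrightarrow> 0 - 0 - 0 + 0"
    by (intro tendsto_intros g1 rE rG)
  then have e1: "(\<lambda>k. e1 k / real k) \<longlonglongrightarrow> 0"
    by (simp add: e1_def algebra_simps flip: diff_divide_distrib add_divide_distrib)
  have "(\<lambda>k. (jumps ?E v k + jumps ?L v k - jumps ?L u k) / real k - (jumps ?E v k - \<alpha> * s0 k) / real k
      - (jumps ?L v k - \<alpha> * s2 k) / real k + (jumps ?L u k - \<gamma> * s2 k) / real k) \<longlonglongrightarrow> 0 - 0 - 0 + 0"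
    by (intro tendsto_intros g2 rE rL)
  then have e2: "(\<lambda>k. e2 k / real k) \<longlonglongrightarrow> 0"
    by (simp add: e2_def algebra_simps flip: diff_divide_distrib add_divide_distrib)
  define z where "z k = (jumps ?E u k - \<alpha> * s0 k) + (jumps ?G u k - \<alpha> * s1 k) + (jumps ?L u k - \<gamma> * s2 k)
      + (\<alpha> / (\<alpha> + \<gamma>) * e1 k - \<gamma> / (\<alpha> + \<gamma>) * e2 k)" for k
  have "(\<lambda>k. (jumps ?E u k - \<alpha> * s0 k) / real k + (jumps ?G u k - \<alpha> * s1 k) / real k + (jumps ?L u k - \<gamma> * s2 k) / real k
      + (\<alpha> / (\<alpha> + \<gamma>) * (e1 k / real k) - \<gamma> / (\<alpha> + \<gamma>) * (e2 k / real k)))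
      \<longlonglongrightarrow> 0 + 0 + 0 + (\<alpha> / (\<alpha> + \<gamma>) * 0 - \<gamma> / (\<alpha> + \<gamma>) * 0)"
    by (intro tendsto_add tendsto_diff tendsto_mult tendsto_const rE rG rL e1 e2)
  then have z0: "(\<lambda>k. z k / real k) \<longlonglongrightarrow> 0"
    by (simp add: z_def add_divide_distrib diff_divide_distrib)
  have ne: "\<alpha> + \<gamma> \<noteq> 0" using \<alpha>\<gamma> by simp
  have key: "\<alpha> * s0 k + \<alpha> * s1 k + \<gamma> * s2 k - 2 * \<alpha> * \<gamma> / (\<alpha> + \<gamma>) * T k
      = \<alpha> / (\<alpha> + \<gamma>) * e1 k - \<gamma> / (\<alpha> + \<gamma>) * e2 k" for k
  proof -
    have "(\<alpha> + \<gamma>) * (\<alpha> * s0 k + \<alpha> * s1 k + \<gamma> * s2 k) - 2 * \<alpha> * \<gamma> * T k = \<alpha> * e1 k - \<gamma> * e2 k"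
      by (simp add: e1_def e2_def T_eq algebra_simps)
    then have "((\<alpha> + \<gamma>) * (\<alpha> * s0 k + \<alpha> * s1 k + \<gamma> * s2 k) - 2 * \<alpha> * \<gamma> * T k) / (\<alpha> + \<gamma>)
        = (\<alpha> * e1 k - \<gamma> * e2 k) / (\<alpha> + \<gamma>)" by simp
    then show ?thesis using ne by (simp add: diff_divide_distrib)
  qed
  show ?thesis
  proof (rule tendsto_0_add_const[OF z0, where K = 0 and a = "real (y 0 u)"])
    fix k
    show "real (y k u) - 2 * \<alpha> * \<gamma> / (\<alpha> + \<gamma>) * T k = z k + real (y 0 u)"
      using key[of k] unfolding height_eq_jumps[of k u] J_eq z_def by linarith
  qed
qed

lemma T_mono: "i \<le> k \<Longrightarrow> T i \<le> T k"
  unfolding T_def using h_nonneg by (intro sum_mono2) auto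

text \<open>The process at time \<open>t\<close> is the jump chain after \<open>N t\<close> steps, where \<open>T (N t) \<le> t < T (N t + 1)\<close>.\<close>

lemma continuous_time_limit:
  assumes c: "0 < c" "\<forall>\<^sub>F k in sequentially. c * real k \<le> T k"
    and h0: "(\<lambda>k. h k / real k) \<longlonglongrightarrow> 0"
    and a: "(\<lambda>k. (a k - b * T k) / real k) \<longlonglongrightarrow> 0"
  shows "((\<lambda>t. a (card {k. 0 < k \<and> T k \<le> t}) / t) \<longlongrightarrow> b) at_top"
proof -
  obtain K where K: "K > 0" "\<And>k. K \<le> k \<Longrightarrow> c * real k \<le> T k"
    using c(2) unfolding eventually_sequentially by (metis gr0I le_trans not_less_eq_eq zero_less_Suc le_SucI)
  have quot: "(\<lambda>k. f k / T k) \<longlonglongrightarrow> 0" if "(\<lambda>k. f k / real k) \<longlonglongrightarrow> 0" for f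
  proof (rule Lim_null_comparison)
    show "(\<lambda>k. \<bar>f k / real k\<bar> / c) \<longlonglongrightarrow> 0"
      using tendsto_divide[OF tendsto_rabs[OF that] tendsto_const[of c]] c by simp
    show "\<forall>\<^sub>F k in sequentially. norm (f k / T k) \<le> \<bar>f k / real k\<bar> / c"
      unfolding eventually_sequentially
    proof (intro exI[of _ K] allI impI)
      fix k assume k: "K \<le> k"
      have "0 < c * real k" using c(1) K(1) k by simp
      then have "\<bar>f k\<bar> / T k \<le> \<bar>f k\<bar> / (c * real k)"
        using K(2)[OF k] by (intro divide_left_mono) auto
      moreover have "0 < T k" using K(2)[OF k] \<open>0 < c * real k\<close> by linarith
      ultimately show "norm (f k / T k) \<le> \<bar>f k / real k\<bar> / c" by (simp add: mult.commute)
    qed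
  qed
  have Tpos: "0 < T k" if "K \<le> k" for k
  proof -
    have "0 < c * real k" using c(1) K(1) that by simp
    then show ?thesis using K(2)[OF that] by linarith
  qed
  have aT: "(\<lambda>k. a k / T k) \<longlonglongrightarrow> b"
  proof -
    have "(\<lambda>k. (a k - b * T k) / T k + b) \<longlonglongrightarrow> 0 + b" by (intro tendsto_add quot a tendsto_const)
    then have "(\<lambda>k. (a k - b * T k) / T k + b) \<longlonglongrightarrow> b" by simp
    then show ?thesis
    proof (rule Lim_transform_eventually)
      show "\<forall>\<^sub>F k in sequentially. (a k - b * T k) / T k + b = a k / T k"
        unfolding eventually_sequentially
      proof (intro exI[of _ K] allI impI)
        fix k assume "K \<le> k"
        from Tpos[OF this] show "(a k - b * T k) / T k + b = a k / T k" by (simp add: diff_divide_distrib)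
      qed
    qed
  qed
  \<comment> \<open>A single holding time is negligible against \<open>T k\<close>, which grows at
    least linearly.\<close>
  have ratio: "(\<lambda>k. T (Suc k) / T k) \<longlonglongrightarrow> 1"
  proof -
    have "(\<lambda>k. 1 + h k / T k) \<longlonglongrightarrow> 1 + 0" by (intro tendsto_add tendsto_const quot h0)
    then have "(\<lambda>k. 1 + h k / T k) \<longlonglongrightarrow> 1" by simp
    then show ?thesis
    proof (rule Lim_transform_eventually)
      show "\<forall>\<^sub>F k in sequentially. 1 + h k / T k = T (Suc k) / T k"
        unfolding eventually_sequentially
      proof (intro exI[of _ K] allI impI)
        fix k assume "K \<le> k"
        have "T (Suc k) = T k + h k" by (simp add: T_def)
        then show "1 + h k / T k = T (Suc k) / T k"
          using Tpos[OF \<open>K \<le> k\<close>] by (simp add: add_divide_distrib)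
      qed
    qed
  qed
  define N where "N t = card {k. 0 < k \<and> T k \<le> t}" for t
  have Tinf: "\<exists>k. t < T k" for t
  proof -
    obtain m :: nat where m: "t < real m * c" using ex_less_of_nat_mult[OF c(1), of t] by blast
    have "real m * c \<le> real (max m K) * c" using c(1) by (intro mult_right_mono) auto
    then have "t < T (max m K)" using m K(2)[of "max m K"] by (simp add: mult.commute)
    then show ?thesis by blast
  qed
  have N: "T (N t) \<le> t \<and> t < T (Suc (N t))" if "0 \<le> t" for t
  proof -
    \<comment> \<open>The first index past \<open>t\<close>. By monotonicity the counted indices are
      those strictly between 0 and \<open>m\<close>, so their number is
      \<open>m - 1\<close>.\<close>
    define m where "m = (LEAST k. t < T k)"
    have m: "t < T m" unfolding m_def by (rule LeastI_ex[OF Tinf])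
    have m': "T k \<le> t" if "k < m" for k
      using not_less_Least[OF that[unfolded m_def]] by simp
    have "T 0 = 0" by (simp add: T_def)
    then have m0: "m \<noteq> 0" using m that by (metis not_less)
    have "{k. 0 < k \<and> T k \<le> t} = {0<..<m}"
    proof (intro set_eqI iffI)
      fix k assume "k \<in> {k. 0 < k \<and> T k \<le> t}"
      then have k: "0 < k" "T k \<le> t" by auto
      have "\<not> m \<le> k" using T_mono[of m k] m k(2) by linarith
      then show "k \<in> {0<..<m}" using k(1) by simp
    qed (use m' in simp)
    then have "N t = m - 1" by (simp add: N_def)
    then show ?thesis using m m'[of "m - 1"] m0 by simp
  qed
  have Nlim: "filterlim N at_top at_top"
    unfolding filterlim_at_top
  proof
    fix Z
    show "\<forall>\<^sub>F t in at_top. Z \<le> N t"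
      unfolding eventually_at_top_linorder
    proof (intro exI[of _ "max 0 (T Z)"] allI impI)
      fix t assume t: "max 0 (T Z) \<le> t"
      then have "T Z < T (Suc (N t))" using N[of t] by simp
      then have "\<not> Suc (N t) \<le> Z" using T_mono[of "Suc (N t)" Z] by linarith
      then show "Z \<le> N t" by simp
    qed
  qed
  \<comment> \<open>Time \<open>t\<close> lies between two consecutive jump times, whose ratio tends
    to 1.\<close>
  have TN: "((\<lambda>t. T (N t) / t) \<longlongrightarrow> 1) at_top"
  proof (rule tendsto_sandwich)
    show "((\<lambda>t. inverse (T (Suc (N t)) / T (N t))) \<longlongrightarrow> 1) at_top"
      using tendsto_inverse[OF filterlim_compose[OF ratio Nlim]] by simp
    have ev: "\<forall>\<^sub>F t in at_top. K \<le> N t" using Nlim by (simp add: filterlim_at_top)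
    then show "\<forall>\<^sub>F t in at_top. inverse (T (Suc (N t)) / T (N t)) \<le> T (N t) / t"
      using eventually_gt_at_top[of 0]
    proof eventually_elim
      case (elim t)
      then have "T (N t) / T (Suc (N t)) \<le> T (N t) / t"
        using N[of t] Tpos[of "N t"] by (intro divide_left_mono) auto
      then show ?case by simp
    qed
    show "\<forall>\<^sub>F t in at_top. T (N t) / t \<le> 1"
      using eventually_gt_at_top[of 0]
    proof eventually_elim
      case (elim t)
      then show ?case using N[of t] by simp
    qed
  qed simp
  have "((\<lambda>t. (a (N t) / T (N t)) * (T (N t) / t)) \<longlongrightarrow> b * 1) at_top"
    by (intro tendsto_mult filterlim_compose[OF aT Nlim] TN)
  then have "((\<lambda>t. (a (N t) / T (N t)) * (T (N t) / t)) \<longlongrightarrow> b) at_top" by simp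
  then have "((\<lambda>t. a (N t) / t) \<longlongrightarrow> b) at_top"
  proof (rule Lim_transform_eventually)
    have "\<forall>\<^sub>F t in at_top. K \<le> N t" using Nlim by (simp add: filterlim_at_top)
    then show "\<forall>\<^sub>F t in at_top. (a (N t) / T (N t)) * (T (N t) / t) = a (N t) / t"
    proof eventually_elim
      case (elim t)
      then show ?case using Tpos[OF elim] by simp
    qed
  qed
  then show ?thesis by (simp add: N_def)
qed

end

subsection \<open>Limit shapes\<close>

lemma maximal_block:
  fixes W :: "nat set"
  assumes "1 \<le> j" "j \<le> n" "j \<notin> W"
  obtains a b where "1 \<le> a" "a \<le> j" "j \<le> b" "b \<le> n" "\<And>i. i \<in> {a..b} \<Longrightarrow> i \<notin> W"
    "a = 1 \<or> a - 1 \<in> W" "b = n \<or> b + 1 \<in> W"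
proof -
  have "1 \<le> j \<Longrightarrow> j \<notin> W \<Longrightarrow> \<exists>a. 1 \<le> a \<and> a \<le> j \<and> (\<forall>i\<in>{a..j}. i \<notin> W) \<and> (a = 1 \<or> a - 1 \<in> W)" for j
  proof (induction j)
    case (Suc j)
    show ?case
    proof (cases "j = 0 \<or> j \<in> W")
      case True
      then show ?thesis using Suc.prems by (intro exI[of _ "Suc j"]) auto
    next
      case False
      then obtain a where a: "1 \<le> a" "a \<le> j" "\<forall>i\<in>{a..j}. i \<notin> W" "a = 1 \<or> a - 1 \<in> W"
        using Suc.IH by auto
      have "{a..Suc j} = insert (Suc j) {a..j}" using a(2) by auto
      then show ?thesis using a Suc.prems by (intro exI[of _ a]) auto
    qed
  qed simp
  then obtain a where a: "1 \<le> a" "a \<le> j" "\<forall>i\<in>{a..j}. i \<notin> W" "a = 1 \<or> a - 1 \<in> W"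
    using assms by blast
  define b where "b = (LEAST b. j \<le> b \<and> (b = n \<or> b + 1 \<in> W))"
  have b: "j \<le> b \<and> (b = n \<or> b + 1 \<in> W)"
    unfolding b_def by (rule LeastI[of _ n]) (use assms in simp)
  have bn: "b \<le> n" unfolding b_def by (rule Least_le) (use assms in simp)
  have "i \<notin> W" if "i \<in> {j..b}" for i
  proof (cases "i = j")
    case False
    then have "i - 1 < b" "j \<le> i - 1" "i - 1 + 1 = i" using that by auto
    then show ?thesis using not_less_Least[of "i - 1" "\<lambda>b. j \<le> b \<and> (b = n \<or> b + 1 \<in> W)"]
      by (simp add: b_def)
  qed (use assms in simp)
  then have "i \<notin> W" if "i \<in> {a..b}" for i using a(3) that by (cases "i \<le> j") auto
  then show ?thesis using that a b bn by blast
qed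

context crystal_model
begin

text \<open>Equal rates give a neutral triple directly. Otherwise the drift argument is applied to
  the whole maximal block around the three sites, as it needs valleys or the boundary at both
  ends.\<close>

lemma stay_three_without_valley:
  assumes "b0 \<le> b1" "1 \<le> j" "j + 2 \<le> n" "j \<notin> W" "j + 1 \<notin> W" "j + 2 \<notin> W"
  shows "stay {y. valleys n y = W} y = 0"
proof (cases "b0 = b1")
  case True
  then show ?thesis using assms by (intro stay_three_without_valley_neutral[of j]) auto
next
  case False
  obtain a b where ab: "1 \<le> a" "a \<le> j" "j \<le> b" "b \<le> n" "\<And>i. i \<in> {a..b} \<Longrightarrow> i \<notin> W"
    "a = 1 \<or> a - 1 \<in> W" "b = n \<or> b + 1 \<in> W"
    using maximal_block[of j n W] assms by auto
  have "b \<noteq> j" "b \<noteq> j + 1" using ab(7) assms by auto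
  then have "a + 2 \<le> b" using ab by linarith
  then show ?thesis using stay_three_without_valley_contracting[of a b W] ab False assms by simp
qed

text \<open>A maximal block touching the boundary is excluded by its edge pair alone, so the
  contracting argument meets only blocks enclosed by two peaks.\<close>

lemma stay_three_without_peak:
  assumes "b1 \<le> b2" "1 \<le> j" "j + 2 \<le> n" "j \<notin> P" "j + 1 \<notin> P" "j + 2 \<notin> P"
  shows "stay {y. peaks n y = P} y = 0"
proof (cases "b1 = b2")
  case True
  then show ?thesis using assms by (intro stay_three_without_peak_neutral[of j]) auto
next
  case False
  obtain a b where ab: "1 \<le> a" "a \<le> j" "j \<le> b" "b \<le> n" "\<And>i. i \<in> {a..b} \<Longrightarrow> i \<notin> P"
    "a = 1 \<or> a - 1 \<in> P" "b = n \<or> b + 1 \<in> P"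
    using maximal_block[of j n P] assms by auto
  have "b \<noteq> j" "b \<noteq> j + 1" using ab(7) assms by auto
  then have ab2: "a + 2 \<le> b" using ab by linarith
  consider "a = 1" | "b = n" | "a \<noteq> 1" "b \<noteq> n" by blast
  then show ?thesis
  proof cases
    case 1
    then show ?thesis using ab(5)[of 1] ab(5)[of 2] ab2 by (intro stay_edge_without_peak[of 1 2]) auto
  next
    case 2
    then show ?thesis using ab(5)[of n] ab(5)[of "n - 1"] ab2 by (intro stay_edge_without_peak[of n "n - 1"]) auto
  next
    case 3
    then show ?thesis using stay_three_without_peak_contracting[of a b P] ab ab2 False assms by simp
  qed
qed

definition speed1 :: "nat set \<Rightarrow> nat \<Rightarrow> real" where
  "speed1 W j = (if j \<in> W then b2
     else if (j = 1 \<or> j - 1 \<in> W) \<and> (j = n \<or> j + 1 \<in> W) then b0 else vel b0 b1)"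

definition speed3 :: "nat set \<Rightarrow> nat \<Rightarrow> real" where
  "speed3 P j = (if j \<in> P then b0 else if j = 1 \<or> j = n then b1
     else if j - 1 \<in> P \<and> j + 1 \<in> P then b2 else vel b1 b2)"

text \<open>Read from the left end or just after a valley, the next block has one or two sites
  because any three in a row meet \<open>W\<close>. Strong induction on the remaining length
  supplies the rest.\<close>

lemma speed1_in_E1:
  assumes edges: "1 \<notin> W" "n \<notin> W" and adj: "\<And>j. j \<in> W \<Longrightarrow> j + 1 \<notin> W"
    and three: "\<And>j. 1 \<le> j \<Longrightarrow> j + 2 \<le> n \<Longrightarrow> j \<in> W \<or> j + 1 \<in> W \<or> j + 2 \<in> W"
  shows "map (speed1 W) [1..<Suc n] \<in> E1 b0 b1 b2 n"
proof -
  define B where "B = {[b0], [vel b0 b1, vel b0 b1]}"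
  have "1 \<le> a \<Longrightarrow> a \<le> n \<Longrightarrow> a \<notin> W \<Longrightarrow> a = 1 \<or> a - 1 \<in> W \<Longrightarrow>
    \<exists>c as. c \<in> B \<and> (\<forall>c\<in>set as. c \<in> B) \<and> map (speed1 W) [a..<Suc n] = c @ concat (map (\<lambda>c. b2 # c) as)" for a
  proof (induction "n - a" arbitrary: a rule: less_induct)
    case less
    have IH: "\<exists>c as. c \<in> B \<and> (\<forall>c\<in>set as. c \<in> B) \<and>
        map (speed1 W) [Suc w..<Suc n] = c @ concat (map (\<lambda>c. b2 # c) as)"
      if "w \<in> W" "a < w" "w \<le> n" for w
    proof -
      have "w \<noteq> n" "Suc w \<notin> W" using that edges adj[of w] by auto
      then show ?thesis using that less.prems by (intro less.hyps) auto
    qed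
    consider "a = n" | "a < n" "Suc a \<in> W" | "Suc a = n" "Suc a \<notin> W"
      | "Suc (Suc a) \<le> n" "Suc a \<notin> W" "Suc (Suc a) \<in> W"
      using less.prems three[of a] by fastforce
    then show ?case
    proof cases
      case 1
      then have "map (speed1 W) [a..<Suc n] = [b0] @ concat (map (\<lambda>c. b2 # c) [])"
        using less.prems by (auto simp: speed1_def)
      moreover have "[b0] \<in> B" by (simp add: B_def)
      ultimately show ?thesis by (metis empty_iff empty_set)
    next
      case 2
      obtain c as where ca: "c \<in> B" "\<forall>c\<in>set as. c \<in> B"
        "map (speed1 W) [Suc (Suc a)..<Suc n] = c @ concat (map (\<lambda>c. b2 # c) as)"
        using IH[of "Suc a"] 2 by auto
      have "[a..<Suc n] = a # Suc a # [Suc (Suc a)..<Suc n]"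
        using 2 by (simp add: upt_conv_Cons del: upt_Suc)
      moreover have "speed1 W a = b0" "speed1 W (Suc a) = b2" using 2 less.prems by (auto simp: speed1_def)
      ultimately have "map (speed1 W) [a..<Suc n] = [b0] @ concat (map (\<lambda>c. b2 # c) (c # as))"
        using ca(3) by simp
      moreover have "[b0] \<in> B" "\<forall>c\<in>set (c # as). c \<in> B" using ca by (auto simp: B_def)
      ultimately show ?thesis by blast
    next
      case 3
      have "[a..<Suc n] = [a, Suc a]" using 3 by (auto simp: upt_conv_Cons simp del: upt_Suc)
      moreover have "speed1 W a = vel b0 b1" "speed1 W (Suc a) = vel b0 b1"
        using 3 less.prems by (auto simp: speed1_def)
      ultimately have "map (speed1 W) [a..<Suc n] = [vel b0 b1, vel b0 b1] @ concat (map (\<lambda>c. b2 # c) [])" by simp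
      moreover have "[vel b0 b1, vel b0 b1] \<in> B" by (simp add: B_def)
      ultimately show ?thesis by (metis empty_iff empty_set)
    next
      case 4
      obtain c as where ca: "c \<in> B" "\<forall>c\<in>set as. c \<in> B"
        "map (speed1 W) [Suc (Suc (Suc a))..<Suc n] = c @ concat (map (\<lambda>c. b2 # c) as)"
        using IH[of "Suc (Suc a)"] 4 by auto
      have "[a..<Suc n] = a # Suc a # Suc (Suc a) # [Suc (Suc (Suc a))..<Suc n]"
        using 4 by (simp add: upt_conv_Cons del: upt_Suc)
      moreover have "speed1 W a = vel b0 b1" "speed1 W (Suc a) = vel b0 b1" "speed1 W (Suc (Suc a)) = b2"
        using 4 less.prems by (auto simp: speed1_def)
      ultimately have "map (speed1 W) [a..<Suc n] = [vel b0 b1, vel b0 b1] @ concat (map (\<lambda>c. b2 # c) (c # as))"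
        using ca(3) by simp
      moreover have "[vel b0 b1, vel b0 b1] \<in> B" "\<forall>c\<in>set (c # as). c \<in> B" using ca by (auto simp: B_def)
      ultimately show ?thesis by blast
    qed
  qed
  from this[of 1] obtain c as where "c \<in> B" "\<forall>c\<in>set as. c \<in> B"
    "map (speed1 W) [1..<Suc n] = c @ concat (map (\<lambda>c. b2 # c) as)"
    using edges n_ge by auto
  moreover have "length (map (speed1 W) [1..<Suc n]) = n" by simp
  ultimately show ?thesis unfolding E1_def B_def Let_def by blast
qed

text \<open>Suffixes are read from a peak, so each step produces an inner block and reaches the peak
  closing it. The edge hypotheses leave at most one site outside the outermost peaks.\<close>

lemma speed3_in_E3:
  assumes adj: "\<And>j. j \<in> P \<Longrightarrow> j + 1 \<notin> P" and left: "1 \<in> P \<or> 2 \<in> P" and right: "n \<in> P \<or> n - 1 \<in> P"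
    and three: "\<And>j. 1 \<le> j \<Longrightarrow> j + 2 \<le> n \<Longrightarrow> j \<in> P \<or> j + 1 \<in> P \<or> j + 2 \<in> P"
  shows "map (speed3 P) [1..<Suc n] \<in> E3 b0 b1 b2 n"
proof -
  define B where "B = {[b2], [vel b1 b2, vel b1 b2]}"
  have suffix: "1 \<le> a \<Longrightarrow> a \<le> n \<Longrightarrow> a \<in> P \<Longrightarrow> \<exists>as eR. eR \<in> {[], [b1]} \<and> (\<forall>c\<in>set as. c \<in> B) \<and>
     map (speed3 P) [a..<Suc n] = [b0] @ concat (map (\<lambda>c. c @ [b0]) as) @ eR" for a
  proof (induction "n - a" arbitrary: a rule: less_induct)
    case less
    have sa: "speed3 P a = b0" using less.prems by (simp add: speed3_def)
    have a1: "Suc a \<notin> P" using adj[of a] less.prems by simp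
    consider "a = n" | "Suc a = n" | "Suc (Suc a) \<le> n" "Suc (Suc a) \<in> P"
      | "Suc (Suc a) \<le> n" "Suc (Suc a) \<notin> P"
      using less.prems by linarith
    then show ?case
    proof cases
      case 1
      then have "map (speed3 P) [a..<Suc n] = [b0] @ concat (map (\<lambda>c. c @ [b0]) []) @ []"
        using sa by simp
      then show ?thesis by (metis empty_iff empty_set insertI1)
    next
      case 2
      have "[a..<Suc n] = [a, Suc a]" using 2 by (auto simp: upt_conv_Cons simp del: upt_Suc)
      moreover have "speed3 P (Suc a) = b1" using 2 a1 by (simp add: speed3_def)
      ultimately have "map (speed3 P) [a..<Suc n] = [b0] @ concat (map (\<lambda>c. c @ [b0]) []) @ [b1]"
        using sa by simp
      then show ?thesis by (metis empty_iff empty_set insertI1 insertI2)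
    next
      case 3
      have "n - Suc (Suc a) < n - a" using 3 by simp
      from less.hyps[OF this] obtain as eR where ca: "eR \<in> {[], [b1]}" "\<forall>c\<in>set as. c \<in> B"
        "map (speed3 P) [Suc (Suc a)..<Suc n] = [b0] @ concat (map (\<lambda>c. c @ [b0]) as) @ eR"
        using 3 by auto
      have "[a..<Suc n] = a # Suc a # [Suc (Suc a)..<Suc n]"
        using 3 by (simp add: upt_conv_Cons del: upt_Suc)
      moreover have "speed3 P (Suc a) = b2" using 3 a1 less.prems by (auto simp: speed3_def)
      ultimately have "map (speed3 P) [a..<Suc n] = [b0] @ concat (map (\<lambda>c. c @ [b0]) ([b2] # as)) @ eR"
        using ca(3) sa by simp
      moreover have "\<forall>c\<in>set ([b2] # as). c \<in> B" using ca by (auto simp: B_def)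
      ultimately show ?thesis using ca(1) by blast
    next
      case 4
      have "Suc (Suc a) \<noteq> n" using right 4 a1 by auto
      then have 5: "Suc (Suc (Suc a)) \<le> n" using 4 by simp
      then have in3: "Suc (Suc (Suc a)) \<in> P" using three[of "Suc a"] a1 4 by (simp add: numeral_2_eq_2)
      have "n - Suc (Suc (Suc a)) < n - a" using 5 by simp
      from less.hyps[OF this] obtain as eR where ca: "eR \<in> {[], [b1]}" "\<forall>c\<in>set as. c \<in> B"
        "map (speed3 P) [Suc (Suc (Suc a))..<Suc n] = [b0] @ concat (map (\<lambda>c. c @ [b0]) as) @ eR"
        using 5 in3 by auto
      have "[a..<Suc n] = a # Suc a # Suc (Suc a) # [Suc (Suc (Suc a))..<Suc n]"
        using 5 by (simp add: upt_conv_Cons del: upt_Suc)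
      moreover have "speed3 P (Suc a) = vel b1 b2" "speed3 P (Suc (Suc a)) = vel b1 b2"
        using 4 5 a1 less.prems by (auto simp: speed3_def)
      ultimately have "map (speed3 P) [a..<Suc n]
          = [b0] @ concat (map (\<lambda>c. c @ [b0]) ([vel b1 b2, vel b1 b2] # as)) @ eR"
        using ca(3) sa by simp
      moreover have "\<forall>c\<in>set ([vel b1 b2, vel b1 b2] # as). c \<in> B" using ca by (auto simp: B_def)
      ultimately show ?thesis using ca(1) by blast
    qed
  qed
  have "\<exists>eL as eR. eL \<in> {[], [b1]} \<and> eR \<in> {[], [b1]} \<and> (\<forall>c\<in>set as. c \<in> B) \<and>
     map (speed3 P) [1..<Suc n] = eL @ [b0] @ concat (map (\<lambda>c. c @ [b0]) as) @ eR"
  proof (cases "1 \<in> P")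
    case True
    obtain as eR where "eR \<in> {[], [b1]}" "\<forall>c\<in>set as. c \<in> B"
      "map (speed3 P) [1..<Suc n] = [b0] @ concat (map (\<lambda>c. c @ [b0]) as) @ eR"
      using suffix[of 1] True n_ge by auto
    then show ?thesis by (intro exI[of _ "[]"] exI[of _ as] exI[of _ eR]) simp
  next
    case False
    then have "2 \<in> P" using left by simp
    then obtain as eR where ca: "eR \<in> {[], [b1]}" "\<forall>c\<in>set as. c \<in> B"
      "map (speed3 P) [2..<Suc n] = [b0] @ concat (map (\<lambda>c. c @ [b0]) as) @ eR"
      using suffix[of 2] n_ge by auto
    have "[1..<Suc n] = 1 # [2..<Suc n]" using n_ge by (simp add: upt_conv_Cons numeral_2_eq_2 del: upt_Suc)
    moreover have "speed3 P 1 = b1" using False by (simp add: speed3_def)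
    ultimately have "map (speed3 P) [1..<Suc n] = [b1] @ [b0] @ concat (map (\<lambda>c. c @ [b0]) as) @ eR"
      using ca(3) by simp
    then show ?thesis using ca(1,2) by blast
  qed
  then obtain eL as eR where e: "eL \<in> {[], [b1]}" "eR \<in> {[], [b1]}" "\<forall>c\<in>set as. c \<in> B"
    "map (speed3 P) [1..<Suc n] = eL @ [b0] @ concat (map (\<lambda>c. c @ [b0]) as) @ eR" by blast
  moreover have "length (map (speed3 P) [1..<Suc n]) = n" by simp
  ultimately show ?thesis unfolding E3_def B_def by blast
qed

definition index2 :: "nat set \<Rightarrow> nat set \<Rightarrow> nat \<Rightarrow> nat" where
  "index2 P W j = (if j \<in> P then 0 else if j \<in> W then 2 else 1)"

text \<open>Equal neighbouring indices would mean two adjacent peaks, two adjacent valleys or two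
  adjacent unlabelled sites.\<close>

lemma index2_in_E2:
  assumes edges: "1 \<notin> W" "n \<notin> W" and adj: "\<And>j. j \<in> P \<Longrightarrow> j + 1 \<notin> P" "\<And>j. j \<in> W \<Longrightarrow> j + 1 \<notin> W"
    and two: "\<And>j. 1 \<le> j \<Longrightarrow> j + 1 \<le> n \<Longrightarrow> j \<in> P \<union> W \<or> j + 1 \<in> P \<union> W"
  shows "map (\<lambda>j. beta b0 b1 b2 (index2 P W j)) [1..<Suc n] \<in> E2 b0 b1 b2 n"
proof -
  define ix where "ix = map (index2 P W) [1..<Suc n]"
  have len: "length ix = n" by (simp add: ix_def)
  have nth: "ix ! j = index2 P W (Suc j)" if "j < n" for j using that by (simp add: ix_def del: upt_Suc)
  have "set ix \<subseteq> {0, 1, 2}" by (auto simp: ix_def index2_def)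
  moreover have "\<forall>j. j + 1 < n \<longrightarrow> ix ! j \<noteq> ix ! (j + 1)"
  proof (intro allI impI)
    fix j assume j: "j + 1 < n"
    then show "ix ! j \<noteq> ix ! (j + 1)"
      using adj(1)[of "Suc j"] adj(2)[of "Suc j"] two[of "Suc j"] by (auto simp: nth index2_def)
  qed
  moreover have "ix \<noteq> []" using len n_ge by auto
  then have "hd ix = index2 P W 1" "last ix = index2 P W n"
    using nth[of 0] nth[of "n - 1"] len n_ge by (simp_all add: hd_conv_nth last_conv_nth)
  then have "hd ix \<noteq> 2" "last ix \<noteq> 2" using edges by (simp_all add: index2_def)
  moreover have "map (\<lambda>j. beta b0 b1 b2 (index2 P W j)) [1..<Suc n] = map (beta b0 b1 b2) ix"
    by (simp add: ix_def)
  ultimately show ?thesis using len unfolding E2_def by blast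
qed

end

subsection \<open>Almost sure limits\<close>

context crystal_process
begin

definition lln :: "((nat \<Rightarrow> nat) \<Rightarrow> bool) \<Rightarrow> nat \<Rightarrow> 'a \<Rightarrow> bool" where
  "lln P j \<omega> \<longleftrightarrow> (\<lambda>k. (\<Sum>i<k. of_bool (P (Y i \<omega>)) *
      (of_bool (J i \<omega> = j) - rt (Y i \<omega>) j * (E i \<omega> / q (Y i \<omega>)))) / real k) \<longlonglongrightarrow> 0"

text \<open>One event serving every possible limit shape: it covers all sites and, through the
  countable range of \<open>u\<close> and \<open>v\<close>, all orderings of pairs, so the speeds
  can be read off path by path.\<close>

definition good :: "'a \<Rightarrow> bool" where
  "good \<omega> \<longleftrightarrow> (\<forall>k. 0 \<le> E k \<omega>) \<and> (\<lambda>k. (\<Sum>i<k. E i \<omega> - 1) / real k) \<longlonglongrightarrow> 0 \<and>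
    (\<forall>j\<in>{1..n}. lln (\<lambda>_. True) j \<omega> \<and>
      (\<forall>u v. lln (\<lambda>y. y u = y v) j \<omega> \<and> lln (\<lambda>y. y v < y u) j \<omega>))"

lemma AE_good: "AE \<omega> in M. good \<omega>"
proof -
  have "AE \<omega> in M. (\<lambda>k. (\<Sum>i<k. (\<lambda>_. 1) (Y i \<omega>) * (E i \<omega> - 1)) / real k) \<longlonglongrightarrow> 0"
    by (rule AE_compensated_clocks) simp
  then have clk: "AE \<omega> in M. (\<lambda>k. (\<Sum>i<k. E i \<omega> - 1) / real k) \<longlonglongrightarrow> 0" by simp
  have "AE \<omega> in M. lln P j \<omega>" if "j \<in> {1..n}" for P j
    unfolding lln_def by (rule AE_jumps_LLN[OF that])
  then have "AE \<omega> in M. lln (\<lambda>_. True) j \<omega> \<and>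
      (\<forall>u v. lln (\<lambda>y. y u = y v) j \<omega> \<and> lln (\<lambda>y. y v < y u) j \<omega>)" if "j \<in> {1..n}" for j
    using that by (simp only: AE_conj_iff AE_all_countable simp_thms)
  then have "AE \<omega> in M. \<forall>j\<in>{1..n}. lln (\<lambda>_. True) j \<omega> \<and>
      (\<forall>u v. lln (\<lambda>y. y u = y v) j \<omega> \<and> lln (\<lambda>y. y v < y u) j \<omega>)"
    by (rule AE_finite_allI[OF finite_atLeastAtMost])
  with clk E_nonneg show ?thesis unfolding good_def by eventually_elim blast
qed

lemma good_growth_path:
  "good \<omega> \<Longrightarrow> growth_path (\<lambda>k. Y k \<omega>) (\<lambda>k. J k \<omega>) (\<lambda>k. E k \<omega> / q (Y k \<omega>))"
  using q_pos by unfold_locales (auto simp: good_def Y_Suc less_imp_le intro!: divide_nonneg_nonneg)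

lemma good_limit:
  assumes good: "good \<omega>"
    and lim: "(\<lambda>k. (real (Y k \<omega> j) - b * (\<Sum>i<k. E i \<omega> / q (Y i \<omega>))) / real k) \<longlonglongrightarrow> 0"
  shows "((\<lambda>t. real (crystal b0 b1 b2 n x (\<lambda>k. E k \<omega>) (\<lambda>k. U k \<omega>) t j) / t) \<longlongrightarrow> b) at_top"
proof -
  define h where "h k = E k \<omega> / q (Y k \<omega>)" for k
  interpret growth_path "\<lambda>k. Y k \<omega>" "\<lambda>k. J k \<omega>" h rt
    unfolding h_def[abs_def] by (rule good_growth_path[OF good])
  have E0: "0 \<le> E k \<omega>" for k using good by (simp add: good_def)
  define S where "S k = (\<Sum>i<k. E i \<omega> - 1)" for k
  have S: "(\<lambda>k. S k / real k) \<longlonglongrightarrow> 0" using good by (simp add: good_def S_def)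
  have jt: "jump_time b0 b1 b2 n x (\<lambda>k. E k \<omega>) (\<lambda>k. U k \<omega>) k = T k" for k
  proof (induction k)
    case (Suc k)
    have "T (Suc k) = T k + h k" by (simp add: T_def)
    also have "h k = E k \<omega> / q (jump_chain b0 b1 b2 n x (\<lambda>k. U k \<omega>) k)" by (simp only: h_def Y_def)
    finally show ?case unfolding jump_time.simps Suc ..
  qed (simp add: T_def)
  \<comment> \<open>The clock sum eventually exceeds \<open>k / 2\<close>, and no total rate exceeds
    \<open>real n * bmax\<close>.\<close>
  define c where "c = 1 / (2 * (real n * bmax))"
  have nb: "0 < real n * bmax" "0 < real n * bmin" using n_ge bmax_pos bmin_pos by auto
  have "\<forall>\<^sub>F k in sequentially. - (1 / 2) < S k / real k" using S by (rule order_tendstoD(1)) simp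
  then have ev: "\<forall>\<^sub>F k in sequentially. c * real k \<le> T k"
    using eventually_gt_at_top[of 0]
  proof eventually_elim
    case (elim k)
    have "- (real k / 2) \<le> S k" using elim by (simp add: field_simps)
    moreover have "S k = (\<Sum>i<k. E i \<omega>) - real k" by (simp add: S_def sum_subtractf)
    ultimately have "real k / 2 \<le> (\<Sum>i<k. E i \<omega>)" by simp
    then have "c * real k \<le> (\<Sum>i<k. E i \<omega>) / (real n * bmax)"
      using nb by (simp add: c_def field_simps)
    also have "\<dots> \<le> T k"
      unfolding T_def h_def sum_divide_distrib
      by (intro sum_mono divide_left_mono q_le E0) (use nb q_pos in auto)
    finally show ?case .
  qed
  \<comment> \<open>The last clock is a difference of consecutive centred sums plus 1, and both sums
    are sublinear.\<close>
  have h0: "(\<lambda>k. h k / real k) \<longlonglongrightarrow> 0"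
  proof -
    have "(\<lambda>k. S (Suc k) / real (Suc k) * (1 + 1 / real k) - S k / real k + 1 / real k) \<longlonglongrightarrow> 0 * (1 + 0) - 0 + 0"
      by (intro tendsto_intros S LIMSEQ_Suc[OF S] lim_const_over_n)
    then have "(\<lambda>k. S (Suc k) / real (Suc k) * (1 + 1 / real k) - S k / real k + 1 / real k) \<longlonglongrightarrow> 0" by simp
    then have e: "(\<lambda>k. E k \<omega> / real k) \<longlonglongrightarrow> 0"
    proof (rule Lim_transform_eventually)
      show "\<forall>\<^sub>F k in sequentially. S (Suc k) / real (Suc k) * (1 + 1 / real k) - S k / real k + 1 / real k = E k \<omega> / real k"
        using eventually_gt_at_top[of 0]
      proof eventually_elim
        case (elim k)
        have "1 + 1 / real k = real (Suc k) / real k" using elim by (simp add: field_simps)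
        then have "S (Suc k) / real (Suc k) * (1 + 1 / real k) = S (Suc k) / real k"
          by (simp del: of_nat_Suc)
        moreover have "S (Suc k) = S k + (E k \<omega> - 1)" by (simp add: S_def)
        ultimately show ?case by (simp add: add_divide_distrib diff_divide_distrib)
      qed
    qed
    show ?thesis
    proof (rule Lim_null_comparison)
      show "(\<lambda>k. E k \<omega> / real k / (real n * bmin)) \<longlonglongrightarrow> 0"
        by (rule tendsto_divide_zero[OF e])
      have "h k \<le> E k \<omega> / (real n * bmin)" for k
        unfolding h_def by (intro divide_left_mono q_ge E0) (use nb q_pos in auto)
      then have "h k / real k \<le> E k \<omega> / real k / (real n * bmin)" for k
        using divide_right_mono[of "h k" "E k \<omega> / (real n * bmin)" "real k"] by (simp add: mult.commute)
      then show "\<forall>\<^sub>F k in sequentially. norm (h k / real k) \<le> E k \<omega> / real k / (real n * bmin)"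
        using h_nonneg by simp
    qed
  qed
  have "((\<lambda>t. real (Y (card {k. 0 < k \<and> T k \<le> t}) \<omega> j) / t) \<longlongrightarrow> b) at_top"
    by (rule continuous_time_limit[of c "\<lambda>k. real (Y k \<omega> j)", OF _ ev h0])
      (use lim nb in \<open>simp_all add: T_def h_def c_def\<close>)
  then show ?thesis by (simp add: crystal_def jt Y_def)
qed

lemma good_single_limit:
  assumes good: "good \<omega>" and j: "j \<in> {1..n}" and ev: "\<forall>\<^sub>F k in sequentially. V (Y k \<omega>) j = i"
  shows "((\<lambda>t. real (crystal b0 b1 b2 n x (\<lambda>k. E k \<omega>) (\<lambda>k. U k \<omega>) t j) / t) \<longlongrightarrow> beta b0 b1 b2 i) at_top"
proof (rule good_limit[OF good])
  interpret growth_path "\<lambda>k. Y k \<omega>" "\<lambda>k. J k \<omega>" "\<lambda>k. E k \<omega> / q (Y k \<omega>)" rt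
    by (rule good_growth_path[OF good])
  have "LLN (\<lambda>_. True) j" using good j unfolding good_def lln_def LLN_def by blast
  moreover have "\<forall>\<^sub>F k in sequentially. rt (Y k \<omega>) j = beta b0 b1 b2 i"
    using ev by eventually_elim (simp add: rate_def)
  ultimately show "(\<lambda>k. (real (Y k \<omega> j) - beta b0 b1 b2 i * (\<Sum>i<k. E i \<omega> / q (Y i \<omega>))) / real k) \<longlonglongrightarrow> 0"
    using single_speed[of j "beta b0 b1 b2 i"] by (simp add: T_def)
qed

text \<open>The base index \<open>i\<close> is the contribution of the neighbour outside the pair: 0
  if it is a valley or missing, 1 if it is a peak.\<close>

lemma good_pair_limit:
  assumes good: "good \<omega>" and uv: "u \<in> {1..n}" "v \<in> {1..n}" "u \<noteq> v"
    and i: "i < 2" "beta b0 b1 b2 i \<le> beta b0 b1 b2 (i + 1)"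
    and ev: "\<forall>\<^sub>F k in sequentially. V (Y k \<omega>) u = i + of_bool (Y k \<omega> u < Y k \<omega> v) \<and>
      V (Y k \<omega>) v = i + of_bool (Y k \<omega> v < Y k \<omega> u)"
  shows "((\<lambda>t. real (crystal b0 b1 b2 n x (\<lambda>k. E k \<omega>) (\<lambda>k. U k \<omega>) t u) / t) \<longlongrightarrow>
    vel (beta b0 b1 b2 i) (beta b0 b1 b2 (i + 1))) at_top"
proof (rule good_limit[OF good])
  interpret growth_path "\<lambda>k. Y k \<omega>" "\<lambda>k. J k \<omega>" "\<lambda>k. E k \<omega> / q (Y k \<omega>)" rt
    by (rule good_growth_path[OF good])
  have L: "LLN (\<lambda>y. y u = y v) j" "LLN (\<lambda>y. y v < y u) j" "LLN (\<lambda>y. y u < y v) j" if "j \<in> {u, v}" for j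
  proof -
    have "j \<in> {1..n}" using that uv by auto
    then have "lln (\<lambda>y. y u = y v) j \<omega>" "lln (\<lambda>y. y v < y u) j \<omega>" "lln (\<lambda>y. y u < y v) j \<omega>"
      using good unfolding good_def by blast+
    then show "LLN (\<lambda>y. y u = y v) j" "LLN (\<lambda>y. y v < y u) j" "LLN (\<lambda>y. y u < y v) j"
      unfolding lln_def LLN_def .
  qed
  have pos: "0 < beta b0 b1 b2 i" using b_pos by (auto simp: beta_def)
  have "(\<lambda>k. (real (Y k \<omega> u) - 2 * beta b0 b1 b2 i * beta b0 b1 b2 (i + 1) / (beta b0 b1 b2 i + beta b0 b1 b2 (i + 1)) * T k) / real k) \<longlonglongrightarrow> 0"
    by (rule pair_speed[OF uv(3) pos i(2) L])
      (use ev in \<open>auto elim!: eventually_mono simp: rate_def\<close>)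
  then show "(\<lambda>k. (real (Y k \<omega> u) - vel (beta b0 b1 b2 i) (beta b0 b1 b2 (i + 1)) * (\<Sum>i<k. E i \<omega> / q (Y i \<omega>))) / real k) \<longlonglongrightarrow> 0"
    by (simp add: vel_def T_def)
qed

lemma converges_intoI:
  assumes "map s [1..<Suc n] \<in> A"
    and "\<And>j. j \<in> {1..n} \<Longrightarrow>
      ((\<lambda>t. real (crystal b0 b1 b2 n x (\<lambda>k. E k \<omega>) (\<lambda>k. U k \<omega>) t j) / t) \<longlongrightarrow> s j) at_top"
  shows "converges_into b0 b1 b2 n x (\<lambda>k. E k \<omega>) (\<lambda>k. U k \<omega>) A"
  unfolding converges_into_def
proof (intro exI[of _ "map s [1..<Suc n]"] conjI allI impI)
  fix j assume "j < n"
  then show "((\<lambda>t. real (crystal b0 b1 b2 n x (\<lambda>k. E k \<omega>) (\<lambda>k. U k \<omega>) t (j + 1)) / t) \<longlongrightarrow> map s [1..<Suc n] ! j) at_top"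
    using assms(2)[of "j + 1"] by (simp del: upt_Suc)
qed (use assms(1) in simp_all)

lemma eventually_constant_set:
  assumes "\<And>y j. P y j \<Longrightarrow> j \<in> {1..n}"
    and "\<forall>j\<in>{1..n}. (\<forall>\<^sub>F k in sequentially. P (Y k \<omega>) j) \<or> (\<forall>\<^sub>F k in sequentially. \<not> P (Y k \<omega>) j)"
  obtains S where "S \<subseteq> {1..n}" "\<forall>\<^sub>F k in sequentially. {j. P (Y k \<omega>) j} = S"
proof
  define S where "S = {j \<in> {1..n}. \<forall>\<^sub>F k in sequentially. P (Y k \<omega>) j}"
  show "S \<subseteq> {1..n}" by (auto simp: S_def)
  have "\<forall>\<^sub>F k in sequentially. P (Y k \<omega>) j \<longleftrightarrow> j \<in> S" if j: "j \<in> {1..n}" for j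
  proof (cases "\<forall>\<^sub>F k in sequentially. P (Y k \<omega>) j")
    case True
    then show ?thesis using j by (auto simp: S_def elim: eventually_mono)
  next
    case False
    then have "\<forall>\<^sub>F k in sequentially. \<not> P (Y k \<omega>) j" using assms(2) j by blast
    then show ?thesis using False by (auto simp: S_def elim: eventually_mono)
  qed
  then have "\<forall>\<^sub>F k in sequentially. \<forall>j\<in>{1..n}. P (Y k \<omega>) j \<longleftrightarrow> j \<in> S"
    by (intro eventually_ball_finite) auto
  then show "\<forall>\<^sub>F k in sequentially. {j. P (Y k \<omega>) j} = S"
  proof eventually_elim
    case (elim k)
    have "P (Y k \<omega>) j \<longleftrightarrow> j \<in> S" for j
    proof (cases "j \<in> {1..n}")
      case True
      then show ?thesis using elim by blast
    next
      case False
      then have "\<not> P (Y k \<omega>) j" using assms(1) by blast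
      moreover have "j \<notin> S" using False unfolding S_def by blast
      ultimately show ?thesis by blast
    qed
    then show ?case by blast
  qed
qed

lemma AE_all_eventually_constant:
  assumes "\<And>j. \<exists>d>0. d \<le> 1 \<and> (\<forall>y k. P y j \<longrightarrow> d \<le> surv {y. P y j} k y)"
  shows "AE \<omega> in M. \<forall>j\<in>{1..n}. (\<forall>\<^sub>F k in sequentially. P (Y k \<omega>) j) \<or> (\<forall>\<^sub>F k in sequentially. \<not> P (Y k \<omega>) j)"
  by (intro AE_finite_allI finite_atLeastAtMost AE_eventually_constant[of "\<lambda>y. P y _"] assms)

text \<open>There are only finitely many candidate sets, so their exceptional null events can be
  united.\<close>

lemma AE_excludes_sets:
  assumes "\<And>S y. bad S \<Longrightarrow> stay {y. F y = S} y = 0"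
  shows "AE \<omega> in M. \<forall>S\<in>Pow {1..n}. bad S \<longrightarrow> \<not> (\<forall>\<^sub>F k in sequentially. F (Y k \<omega>) = S)"
proof (rule AE_finite_allI)
  show "finite (Pow {1..n})" by simp
  fix S
  show "AE \<omega> in M. bad S \<longrightarrow> \<not> (\<forall>\<^sub>F k in sequentially. F (Y k \<omega>) = S)"
  proof (cases "bad S")
    case True
    then show ?thesis using AE_not_eventually_in[of "{y. F y = S}", OF assms[OF True]] by simp
  qed simp
qed

lemma AE_converges_into_E1:
  assumes "b2 < b0" "b0 \<le> b1"
  shows "AE \<omega> in M. converges_into b0 b1 b2 n x (\<lambda>k. E k \<omega>) (\<lambda>k. U k \<omega>) (E1 b0 b1 b2 n)"
proof -
  define bad where "bad W \<longleftrightarrow> (\<exists>j. 1 \<le> j \<and> j + 2 \<le> n \<and> j \<notin> W \<and> j + 1 \<notin> W \<and> j + 2 \<notin> W)" for W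
  have "AE \<omega> in M. \<forall>W\<in>Pow {1..n}. bad W \<longrightarrow> \<not> (\<forall>\<^sub>F k in sequentially. valleys n (Y k \<omega>) = W)"
    by (rule AE_excludes_sets) (use stay_three_without_valley assms in \<open>auto simp: bad_def\<close>)
  moreover have "AE \<omega> in M. \<forall>j\<in>{1..n}. (\<forall>\<^sub>F k in sequentially. valley n (Y k \<omega>) j) \<or> (\<forall>\<^sub>F k in sequentially. \<not> valley n (Y k \<omega>) j)"
    using assms by (intro AE_all_eventually_constant[of "valley n"] valley_persists) auto
  ultimately show ?thesis using AE_good
  proof eventually_elim
    case (elim \<omega>)
    obtain W where W: "W \<subseteq> {1..n}" and "\<forall>\<^sub>F k in sequentially. {j. valley n (Y k \<omega>) j} = W"
      using eventually_constant_set[of "valley n" \<omega>] elim(2) by (auto simp: valley_def)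
    then have ev: "\<forall>\<^sub>F k in sequentially. valleys n (Y k \<omega>) = W" by (simp add: valleys_def)
    then obtain k0 where "valleys n (Y k0 \<omega>) = W" by (auto simp: eventually_sequentially)
    then have W_eq: "W = {j. valley n (Y k0 \<omega>) j}" by (simp add: valleys_def)
    have three: "j \<in> W \<or> j + 1 \<in> W \<or> j + 2 \<in> W" if "1 \<le> j" "j + 2 \<le> n" for j
      using elim(1) W ev that by (auto simp: bad_def)
    have edges: "1 \<notin> W" "n \<notin> W" and adj: "\<And>j. j \<in> W \<Longrightarrow> j + 1 \<notin> W"
      unfolding W_eq by (auto simp: valley_def)
    \<comment> \<open>As soon as one of two adjacent sites is a valley, membership in
      \<open>W\<close> decides their order.\<close>
    have low: "(y j < y (j + 1) \<longleftrightarrow> j \<in> W) \<and> (y (j + 1) < y j \<longleftrightarrow> j + 1 \<in> W)"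
      if "valleys n y = W" "j \<in> W \<or> j + 1 \<in> W" for y j
    proof -
      have "valley n y i \<longleftrightarrow> i \<in> W" for i using that(1) by (auto simp: valleys_def)
      from this[of j] this[of "j + 1"] show ?thesis using that(2) adj[of j] by (auto simp: valley_def)
    qed
    show ?case
    proof (rule converges_intoI[of "speed1 W"])
      show "map (speed1 W) [1..<Suc n] \<in> E1 b0 b1 b2 n" by (rule speed1_in_E1[OF edges adj three])
      fix j assume j: "j \<in> {1..n}"
      let ?lim = "\<lambda>u b. ((\<lambda>t. real (crystal b0 b1 b2 n x (\<lambda>k. E k \<omega>) (\<lambda>k. U k \<omega>) t u) / t) \<longlongrightarrow> b) at_top"
      have pair: "?lim u (vel b0 b1)" if uv: "(u, v) = (i, i + 1) \<or> (u, v) = (i + 1, i)"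
        and i: "1 \<le> i" "i + 1 \<le> n" "i \<notin> W" "i + 1 \<notin> W" for u v i
      proof -
        \<comment> \<open>Beyond the pair there is a valley or nothing on either side, so both
          indices depend only on the order of the two heights.\<close>
        have l: "i = 1 \<or> i - 1 \<in> W" using three[of "i - 1"] i by (cases "i = 1") auto
        have r: "i + 1 = n \<or> i + 2 \<in> W" using three[of i] i by (cases "i + 1 = n") auto
        have "\<forall>\<^sub>F k in sequentially. V (Y k \<omega>) i = 0 + of_bool (Y k \<omega> i < Y k \<omega> (i + 1)) \<and>
          V (Y k \<omega>) (i + 1) = 0 + of_bool (Y k \<omega> (i + 1) < Y k \<omega> i)"
          using ev
        proof eventually_elim
          case (elim k)
          have "1 < i \<Longrightarrow> \<not> Y k \<omega> i < Y k \<omega> (i - 1)" using low[OF elim, of "i - 1"] l i by auto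
          moreover have "i + 1 < n \<Longrightarrow> \<not> Y k \<omega> (i + 1) < Y k \<omega> (i + 2)" using low[OF elim, of "i + 1"] r i by auto
          ultimately show ?case using i by (cases "i = 1"; cases "i + 1 = n") (auto simp: Vn_eq)
        qed
        then have "?lim u (vel (beta b0 b1 b2 0) (beta b0 b1 b2 (0 + 1)))"
          using uv i assms by (intro good_pair_limit[OF elim(3), of u v]) (auto simp: beta_def elim!: eventually_mono)
        then show ?thesis by (simp add: beta_def)
      qed
      consider "j \<in> W" | "j \<notin> W" "j = 1 \<or> j - 1 \<in> W" "j = n \<or> j + 1 \<in> W"
        | "j \<notin> W" "j \<noteq> n" "j + 1 \<notin> W" | "j \<notin> W" "j \<noteq> 1" "j - 1 \<notin> W" by blast
      then show "?lim j (speed1 W j)"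
      proof cases
        case 1
        have "\<forall>\<^sub>F k in sequentially. V (Y k \<omega>) j = 2" using ev
        proof eventually_elim
          case (elim k)
          then have "valley n (Y k \<omega>) j" using 1 by (auto simp: valleys_def)
          then show ?case using Vn_eq_2_iff[of j n "Y k \<omega>"] j by auto
        qed
        then show ?thesis using good_single_limit[OF elim(3) j, of 2] 1 by (simp add: speed1_def beta_def)
      next
        case 2
        have "\<forall>\<^sub>F k in sequentially. V (Y k \<omega>) j = 0" using ev
        proof eventually_elim
          case (elim k)
          have "1 < j \<Longrightarrow> \<not> Y k \<omega> j < Y k \<omega> (j - 1)" using low[OF elim, of "j - 1"] 2 by auto
          moreover have "j < n \<Longrightarrow> \<not> Y k \<omega> j < Y k \<omega> (j + 1)" using low[OF elim, of j] 2 by auto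
          ultimately show ?case using j by (simp add: Vn_eq)
        qed
        then show ?thesis using good_single_limit[OF elim(3) j, of 0] 2 by (simp add: speed1_def beta_def)
      next
        case 3
        then show ?thesis using pair[of j "j + 1" j] j by (auto simp: speed1_def)
      next
        case 4
        then have "j = j - 1 + 1" using j by auto
        then show ?thesis using pair[of j "j - 1" "j - 1"] 4 j by (auto simp: speed1_def)
      qed
    qed
  qed
qed

lemma AE_converges_into_E2:
  assumes "b2 < b1" "b1 < b0"
  shows "AE \<omega> in M. converges_into b0 b1 b2 n x (\<lambda>k. E k \<omega>) (\<lambda>k. U k \<omega>) (E2 b0 b1 b2 n)"
proof -
  have "AE \<omega> in M. \<forall>P\<in>Pow {1..n}. \<forall>W\<in>Pow {1..n}.
      (\<exists>j. 1 \<le> j \<and> j + 1 \<le> n \<and> j \<notin> P \<and> j + 1 \<notin> P \<and> j \<notin> W \<and> j + 1 \<notin> W) \<longrightarrow>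
      \<not> (\<forall>\<^sub>F k in sequentially. Y k \<omega> \<in> {y. peaks n y = P \<and> valleys n y = W})"
  proof (intro AE_finite_allI)
    fix P W :: "nat set"
    show "AE \<omega> in M. (\<exists>j. 1 \<le> j \<and> j + 1 \<le> n \<and> j \<notin> P \<and> j + 1 \<notin> P \<and> j \<notin> W \<and> j + 1 \<notin> W) \<longrightarrow>
      \<not> (\<forall>\<^sub>F k in sequentially. Y k \<omega> \<in> {y. peaks n y = P \<and> valleys n y = W})"
    proof (cases "\<exists>j. 1 \<le> j \<and> j + 1 \<le> n \<and> j \<notin> P \<and> j + 1 \<notin> P \<and> j \<notin> W \<and> j + 1 \<notin> W")
      case True
      then have "\<And>y. stay {y. peaks n y = P \<and> valleys n y = W} y = 0"
        using stay_adjacent_unlabelled by blast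
      from AE_not_eventually_in[OF this] show ?thesis by (rule AE_mp) (auto intro!: AE_I2)
    next
      case False
      then show ?thesis by (intro AE_I2) blast
    qed
  qed auto
  moreover have "AE \<omega> in M. \<forall>j\<in>{1..n}. (\<forall>\<^sub>F k in sequentially. valley n (Y k \<omega>) j) \<or> (\<forall>\<^sub>F k in sequentially. \<not> valley n (Y k \<omega>) j)"
    using assms by (intro AE_all_eventually_constant[of "valley n"] valley_persists) auto
  moreover have "AE \<omega> in M. \<forall>j\<in>{1..n}. (\<forall>\<^sub>F k in sequentially. peak n (Y k \<omega>) j) \<or> (\<forall>\<^sub>F k in sequentially. \<not> peak n (Y k \<omega>) j)"
    using assms by (intro AE_all_eventually_constant[of "peak n"] peak_persists) auto
  ultimately show ?thesis using AE_good
  proof eventually_elim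
    case (elim \<omega>)
    obtain W where W: "W \<subseteq> {1..n}" and "\<forall>\<^sub>F k in sequentially. {j. valley n (Y k \<omega>) j} = W"
      using eventually_constant_set[of "valley n" \<omega>] elim(2) by (auto simp: valley_def)
    then have evW: "\<forall>\<^sub>F k in sequentially. valleys n (Y k \<omega>) = W" by (simp add: valleys_def)
    obtain P where P: "P \<subseteq> {1..n}" and "\<forall>\<^sub>F k in sequentially. {j. peak n (Y k \<omega>) j} = P"
      using eventually_constant_set[of "peak n" \<omega>] elim(3) by (auto simp: peak_def)
    then have evP: "\<forall>\<^sub>F k in sequentially. peaks n (Y k \<omega>) = P" by (simp add: peaks_def)
    have ev: "\<forall>\<^sub>F k in sequentially. peaks n (Y k \<omega>) = P \<and> valleys n (Y k \<omega>) = W"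
      using evP evW by eventually_elim simp
    then obtain k0 where k0: "peaks n (Y k0 \<omega>) = P" "valleys n (Y k0 \<omega>) = W" by (auto simp: eventually_sequentially)
    have two: "j \<in> P \<union> W \<or> j + 1 \<in> P \<union> W" if "1 \<le> j" "j + 1 \<le> n" for j
      using elim(1) W P ev that by auto
    have edges: "1 \<notin> W" "n \<notin> W" and adj: "\<And>j. j \<in> P \<Longrightarrow> j + 1 \<notin> P" "\<And>j. j \<in> W \<Longrightarrow> j + 1 \<notin> W"
      unfolding k0[symmetric] by (auto simp: valleys_def valley_def peaks_def peak_def)
    \<comment> \<open>An unlabelled site has only labelled neighbours. If its index were 0, none of
      them could be a peak, so all would be valleys and the site itself a peak.\<close>
    have V_index: "V y j = index2 P W j" if y: "peaks n y = P" "valleys n y = W" and j: "j \<in> {1..n}" for y j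
    proof -
      have vl: "valley n y i \<longleftrightarrow> i \<in> W" and pk: "peak n y i \<longleftrightarrow> i \<in> P" for i
        using y by (auto simp: valleys_def peaks_def)
      consider "j \<in> P" | "j \<notin> P" "j \<in> W" | "j \<notin> P" "j \<notin> W" by blast
      then show ?thesis
      proof cases
        case 1
        then show ?thesis using pk[of j] j by (auto simp: Vn_eq peak_def index2_def)
      next
        case 2
        then show ?thesis using vl[of j] Vn_eq_2_iff[of j n y] j by (auto simp: index2_def)
      next
        case 3
        have "V y j \<noteq> 2" using vl[of j] Vn_eq_2_iff[of j n y] j 3 by auto
        moreover have "V y j \<noteq> 0"
        proof
          assume V0: "V y j = 0"
          have "y (j - 1) < y j" if "1 < j"
          proof -
            have nb: "j - 1 \<in> P \<union> W" "\<not> y j < y (j - 1)" using two[of "j - 1"] 3 j that V0 by (auto simp: Vn_eq)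
            show ?thesis using nb vl[of "j - 1"] pk[of "j - 1"] j that by (auto simp: valley_def peak_def)
          qed
          moreover have "y (j + 1) < y j" if "j < n"
          proof -
            have nb: "j + 1 \<in> P \<union> W" "\<not> y j < y (j + 1)" using two[of j] 3 j that V0 by (auto simp: Vn_eq)
            show ?thesis using nb vl[of "j + 1"] pk[of "j + 1"] j that by (auto simp: valley_def peak_def)
          qed
          ultimately have "peak n y j" using j by (auto simp: peak_def)
          then show False using pk[of j] 3 by simp
        qed
        ultimately show ?thesis using Vn_le_2[of n y j] 3 by (simp add: index2_def)
      qed
    qed
    show ?case
    proof (rule converges_intoI[of "\<lambda>j. beta b0 b1 b2 (index2 P W j)"])
      show "map (\<lambda>j. beta b0 b1 b2 (index2 P W j)) [1..<Suc n] \<in> E2 b0 b1 b2 n"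
        by (rule index2_in_E2[OF edges adj two])
      fix j assume j: "j \<in> {1..n}"
      have "\<forall>\<^sub>F k in sequentially. V (Y k \<omega>) j = index2 P W j"
        using ev by eventually_elim (use V_index j in blast)
      then show "((\<lambda>t. real (crystal b0 b1 b2 n x (\<lambda>k. E k \<omega>) (\<lambda>k. U k \<omega>) t j) / t) \<longlongrightarrow> beta b0 b1 b2 (index2 P W j)) at_top"
        by (rule good_single_limit[OF elim(4) j])
    qed
  qed
qed

lemma AE_converges_into_E3:
  assumes "b1 \<le> b2" "b2 < b0"
  shows "AE \<omega> in M. converges_into b0 b1 b2 n x (\<lambda>k. E k \<omega>) (\<lambda>k. U k \<omega>) (E3 b0 b1 b2 n)"
proof -
  \<comment> \<open>Edge pairs are listed separately: two adjacent unlabelled sites may persist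
    between peaks but not at the boundary.\<close>
  define bad where "bad P \<longleftrightarrow> (1 \<notin> P \<and> 2 \<notin> P) \<or> (n \<notin> P \<and> n - 1 \<notin> P) \<or>
    (\<exists>j. 1 \<le> j \<and> j + 2 \<le> n \<and> j \<notin> P \<and> j + 1 \<notin> P \<and> j + 2 \<notin> P)" for P
  have "stay {y. peaks n y = P} y = 0" if "bad P" for P y
    using that stay_edge_without_peak[of 1 2 P y] stay_edge_without_peak[of n "n - 1" P y]
      stay_three_without_peak[OF assms(1), of _ P y] unfolding bad_def by blast
  then have "AE \<omega> in M. \<forall>P\<in>Pow {1..n}. bad P \<longrightarrow> \<not> (\<forall>\<^sub>F k in sequentially. peaks n (Y k \<omega>) = P)"
    by (rule AE_excludes_sets)
  moreover have "AE \<omega> in M. \<forall>j\<in>{1..n}. (\<forall>\<^sub>F k in sequentially. peak n (Y k \<omega>) j) \<or> (\<forall>\<^sub>F k in sequentially. \<not> peak n (Y k \<omega>) j)"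
    using assms by (intro AE_all_eventually_constant[of "peak n"] peak_persists) auto
  ultimately show ?thesis using AE_good
  proof eventually_elim
    case (elim \<omega>)
    obtain P where P: "P \<subseteq> {1..n}" and "\<forall>\<^sub>F k in sequentially. {j. peak n (Y k \<omega>) j} = P"
      using eventually_constant_set[of "peak n" \<omega>] elim(2) by (auto simp: peak_def)
    then have ev: "\<forall>\<^sub>F k in sequentially. peaks n (Y k \<omega>) = P" by (simp add: peaks_def)
    then obtain k0 where k0: "peaks n (Y k0 \<omega>) = P" by (auto simp: eventually_sequentially)
    have nbad: "\<not> bad P" using elim(1) P ev by auto
    have three: "j \<in> P \<or> j + 1 \<in> P \<or> j + 2 \<in> P" if "1 \<le> j" "j + 2 \<le> n" for j
      using nbad that by (auto simp: bad_def)
    have left: "1 \<in> P \<or> 2 \<in> P" and right: "n \<in> P \<or> n - 1 \<in> P" using nbad by (auto simp: bad_def)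
    have adj: "j + 1 \<notin> P" if "j \<in> P" for j
      using that unfolding k0[symmetric] by (auto simp: peaks_def peak_def)
    \<comment> \<open>As soon as one of two adjacent sites is a peak, membership in \<open>P\<close>
      decides their order.\<close>
    have high: "(y (j + 1) < y j \<longleftrightarrow> j \<in> P) \<and> (y j < y (j + 1) \<longleftrightarrow> j + 1 \<in> P)"
      if "peaks n y = P" "j \<in> P \<or> j + 1 \<in> P" "1 \<le> j" "j + 1 \<le> n" for y j
    proof -
      have "peak n y i \<longleftrightarrow> i \<in> P" for i using that(1) by (auto simp: peaks_def)
      from this[of j] this[of "j + 1"] show ?thesis using that(2-) adj[of j] by (auto simp: peak_def)
    qed
    show ?case
    proof (rule converges_intoI[of "speed3 P"])
      show "map (speed3 P) [1..<Suc n] \<in> E3 b0 b1 b2 n" by (rule speed3_in_E3[OF adj left right three])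
      fix j assume j: "j \<in> {1..n}"
      let ?lim = "\<lambda>u b. ((\<lambda>t. real (crystal b0 b1 b2 n x (\<lambda>k. E k \<omega>) (\<lambda>k. U k \<omega>) t u) / t) \<longlongrightarrow> b) at_top"
      have pair: "?lim u (vel b1 b2)" if uv: "(u, v) = (i, i + 1) \<or> (u, v) = (i + 1, i)"
        and i: "1 < i" "i + 1 < n" "i \<notin> P" "i + 1 \<notin> P" for u v i
      proof -
        \<comment> \<open>Both outer neighbours are peaks, so each index is 1 plus the comparison
          within the pair.\<close>
        have l: "i - 1 \<in> P" using three[of "i - 1"] i by auto
        have r: "i + 2 \<in> P" using three[of i] i by auto
        have "\<forall>\<^sub>F k in sequentially. V (Y k \<omega>) i = 1 + of_bool (Y k \<omega> i < Y k \<omega> (i + 1)) \<and>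
          V (Y k \<omega>) (i + 1) = 1 + of_bool (Y k \<omega> (i + 1) < Y k \<omega> i)"
          using ev
        proof eventually_elim
          case (elim k)
          have "Y k \<omega> i < Y k \<omega> (i - 1)" using high[OF elim, of "i - 1"] l i by auto
          moreover have "Y k \<omega> (i + 1) < Y k \<omega> (i + 2)" using high[OF elim, of "i + 1"] r i by auto
          ultimately show ?case using i by (simp add: Vn_eq)
        qed
        then have "?lim u (vel (beta b0 b1 b2 1) (beta b0 b1 b2 (1 + 1)))"
          using uv i assms by (intro good_pair_limit[OF elim(3), of u v]) (auto simp: beta_def elim!: eventually_mono)
        then show ?thesis by (simp add: beta_def)
      qed
      have single: "?lim j (beta b0 b1 b2 m)" if "\<And>y. peaks n y = P \<Longrightarrow> V y j = m" for m
        using ev by (intro good_single_limit[OF elim(3) j]) (auto elim!: eventually_mono that)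
      consider "j \<in> P" | "j \<notin> P" "j = 1" | "j \<notin> P" "j = n" | "j \<notin> P" "1 < j" "j < n" "j - 1 \<in> P" "j + 1 \<in> P"
        | "j \<notin> P" "1 < j" "j < n" "j + 1 \<notin> P" | "j \<notin> P" "1 < j" "j < n" "j - 1 \<notin> P"
        using j by fastforce
      then show "?lim j (speed3 P j)"
      proof cases
        case 1
        have "V y j = 0" if "peaks n y = P" for y
        proof -
          have "peak n y j" using that 1 by (auto simp: peaks_def)
          then show ?thesis using j by (auto simp: Vn_eq peak_def)
        qed
        from single[OF this] show ?thesis using 1 by (simp add: speed3_def beta_def)
      next
        case 2
        then have "2 \<in> P" using left by auto
        then have "V y j = 1" if "peaks n y = P" for y
          using high[OF that, of 1] 2 n_ge by (simp add: Vn_eq numeral_2_eq_2)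
        from single[OF this] show ?thesis using 2 by (simp add: speed3_def beta_def)
      next
        case 3
        then have "n - 1 \<in> P" using right by auto
        then have "V y j = 1" if "peaks n y = P" for y
          using high[OF that, of "n - 1"] 3 n_ge by (simp add: Vn_eq)
        from single[OF this] show ?thesis using 3 by (simp add: speed3_def beta_def)
      next
        case 4
        then have "V y j = 2" if "peaks n y = P" for y
          using high[OF that, of "j - 1"] high[OF that, of j] by (simp add: Vn_eq)
        from single[OF this] show ?thesis using 4 by (simp add: speed3_def beta_def)
      next
        case 5
        then have "j + 1 \<noteq> n" using right by auto
        then show ?thesis using pair[of j "j + 1" j] 5 by (auto simp: speed3_def)
      next
        case 6
        \<comment> \<open>The left edge condition keeps the pair \<open>j - 1\<close>,
          \<open>j\<close> away from the boundary, as the pair argument requires.\<close>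
        have "j \<noteq> 2" using 6 left by auto
        then have "1 < j - 1" using 6 by simp
        then show ?thesis using pair[of j "j - 1" "j - 1"] 6 by (auto simp: speed3_def)
      qed
    qed
  qed
qed

end

theorem theorem5:
  fixes M :: "'a measure" and E U :: "nat \<Rightarrow> 'a \<Rightarrow> real"
    and b0 b1 b2 :: real and n :: nat and x :: "nat \<Rightarrow> nat"
  assumes "prob_space M"
    and "0 < b0" "0 < b1" "0 < b2" and "2 \<le> n"
    and "\<And>k. distributed M lborel (E k) (exponential_density 1)"
    and "\<And>k. U k \<in> borel_measurable M"
    and "\<And>k. distr M lborel (U k) = uniform_measure lborel {0..1}"
    and "prob_space.indep_vars M (\<lambda>_. borel)
           (\<lambda>i. case i of Inl k \<Rightarrow> E k | Inr k \<Rightarrow> U k) UNIV"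
  shows "(b2 < b0 \<and> b0 \<le> b1 \<longrightarrow>
           (AE \<omega> in M. converges_into b0 b1 b2 n x (\<lambda>k. E k \<omega>) (\<lambda>k. U k \<omega>) (E1 b0 b1 b2 n)))
       \<and> (b2 < b1 \<and> b1 < b0 \<longrightarrow>
           (AE \<omega> in M. converges_into b0 b1 b2 n x (\<lambda>k. E k \<omega>) (\<lambda>k. U k \<omega>) (E2 b0 b1 b2 n)))
       \<and> (b1 \<le> b2 \<and> b2 < b0 \<longrightarrow>
           (AE \<omega> in M. converges_into b0 b1 b2 n x (\<lambda>k. E k \<omega>) (\<lambda>k. U k \<omega>) (E3 b0 b1 b2 n)))"
proof -
  interpret prob_space M by (rule assms(1))
  interpret crystal_process b0 b1 b2 n M E U x
    using assms by unfold_locales auto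
  show ?thesis using AE_converges_into_E1 AE_converges_into_E2 AE_converges_into_E3 by blast
qed

end
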